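(* Let $n\geq 2$ and let $\Omega\subset\mathbb{R}^n$ be a bounded domain. Then $\Omega$ is a $(BV, BV)$-extension domain if and only if it is a $(W^{1,1}, BV)$-extension domain.
   Context: For a domain $\Omega\subset\mathbb{R}^n$ and $1\leq p\leq\infty$, $W^{1,p}(\Omega)$ is the space of $u\in L^p(\Omega)$ whose distributional gradient lies in $L^p(\Omega;\mathbb{R}^n)$, with norm $\|u\|_{W^{1,p}(\Omega)}=\|u\|_{L^p(\Omega)}+\|\nabla u\|_{L^p(\Omega)}$. $BV(\Omega)$ is the space of $u\in L^1(\Omega)$ with total variation $\|Du\|(\Omega):=\sup\{\int_\Omega u\,\mathrm{div}\,\phi\,dx:\ \phi\in C^1_c(\Omega;\mathbb{R}^n),\ |\phi|\leq 1\}<\infty$, with norm $\|u\|_{BV(\Omega)}=\|u\|_{L^1(\Omega)}+\|Du\|(\Omega)$. A bounded domain $\Omega$ is a $(W^{1,1},BV)$-extension domain if there is an operator $E\colon W^{1,1}(\Omega)\to BV(\mathbb{R}^n)$ and a constant $C>1$ such that for every $u\in W^{1,1}(\Omega)$, $E(u)|_\Omega= u$ and $\|E(u)\|_{BV(\mathbb{R}^n)}\leq C\|u\|_{W^{1,1}(\Omega)}$; it is a $(BV,BV)$-extension domain if there is an operator $E\colon BV(\Omega)\to BV(\mathbb{R}^n)$ and $C>1$ such that for every $u\in BV(\Omega)$, $E(u)|_\Omega=u$ and $\|E(u)\|_{BV(\mathbb{R}^n)}\leq C\|u\|_{BV(\Omega)}$. *)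

theory Defs
  imports "HOL-Analysis.Analysis"
begin

definition bounded_domain :: "'a::euclidean_space set \<Rightarrow> bool" where
  "bounded_domain \<Omega> \<longleftrightarrow> open \<Omega> \<and> connected \<Omega> \<and> \<Omega> \<noteq> {} \<and> bounded \<Omega>"

definition C1c :: "'a::euclidean_space set \<Rightarrow> ('a \<Rightarrow> 'a) set" where
  "C1c \<Omega> = {\<phi>. (\<exists>D. (\<forall>x. (\<phi> has_derivative D x) (at x)) \<and>
                     (\<forall>v. continuous_on UNIV (\<lambda>x. D x v))) \<and>
               compact (closure {x. \<phi> x \<noteq> 0}) \<and> closure {x. \<phi> x \<noteq> 0} \<subseteq> \<Omega>}"

definition divergence :: "('a::euclidean_space \<Rightarrow> 'a) \<Rightarrow> 'a \<Rightarrow> real" where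
  "divergence \<phi> x = (\<Sum>b\<in>Basis. frechet_derivative \<phi> (at x) b \<bullet> b)"

definition L1_norm :: "'a::euclidean_space set \<Rightarrow> ('a \<Rightarrow> 'b::{banach,second_countable_topology}) \<Rightarrow> real" where
  "L1_norm \<Omega> f = integral\<^sup>L (lebesgue_on \<Omega>) (\<lambda>x. norm (f x))"

definition weak_gradient :: "'a::euclidean_space set \<Rightarrow> ('a \<Rightarrow> real) \<Rightarrow> ('a \<Rightarrow> 'a) \<Rightarrow> bool" where
  "weak_gradient \<Omega> u g \<longleftrightarrow>
     (\<forall>\<phi>\<in>C1c \<Omega>. integral\<^sup>L (lebesgue_on \<Omega>) (\<lambda>x. u x * divergence \<phi> x)
                 = - integral\<^sup>L (lebesgue_on \<Omega>) (\<lambda>x. g x \<bullet> \<phi> x))"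

definition W11 :: "'a::euclidean_space set \<Rightarrow> ('a \<Rightarrow> real) set" where
  "W11 \<Omega> = {u. integrable (lebesgue_on \<Omega>) u \<and>
               (\<exists>g. integrable (lebesgue_on \<Omega>) g \<and> weak_gradient \<Omega> u g)}"

definition W11_norm :: "'a::euclidean_space set \<Rightarrow> ('a \<Rightarrow> real) \<Rightarrow> real" where
  "W11_norm \<Omega> u = L1_norm \<Omega> u +
     L1_norm \<Omega> (SOME g. integrable (lebesgue_on \<Omega>) g \<and> weak_gradient \<Omega> u g)"

definition total_variation :: "'a::euclidean_space set \<Rightarrow> ('a \<Rightarrow> real) \<Rightarrow> ereal" where
  "total_variation \<Omega> u = (SUP \<phi>\<in>{\<phi>\<in>C1c \<Omega>. \<forall>x. norm (\<phi> x) \<le> 1}.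
       ereal (integral\<^sup>L (lebesgue_on \<Omega>) (\<lambda>x. u x * divergence \<phi> x)))"

definition BV :: "'a::euclidean_space set \<Rightarrow> ('a \<Rightarrow> real) set" where
  "BV \<Omega> = {u. integrable (lebesgue_on \<Omega>) u \<and> total_variation \<Omega> u < \<infinity>}"

definition BV_norm :: "'a::euclidean_space set \<Rightarrow> ('a \<Rightarrow> real) \<Rightarrow> real" where
  "BV_norm \<Omega> u = L1_norm \<Omega> u + real_of_ereal (total_variation \<Omega> u)"

text \<open>Extension domains. Restriction E(u)|_\<Omega> = u is understood a.e. on \<Omega>
  (elements of these spaces are a.e.-equivalence classes).\<close>
definition W11_BV_extension_domain :: "'a::euclidean_space set \<Rightarrow> bool" where
  "W11_BV_extension_domain \<Omega> \<longleftrightarrow> bounded \<Omega> \<and>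
     (\<exists>E C. C > 1 \<and> (\<forall>u\<in>W11 \<Omega>. E u \<in> BV (UNIV::'a set) \<and>
        (AE x in lebesgue_on \<Omega>. E u x = u x) \<and>
        BV_norm UNIV (E u) \<le> C * W11_norm \<Omega> u))"

definition BV_BV_extension_domain :: "'a::euclidean_space set \<Rightarrow> bool" where
  "BV_BV_extension_domain \<Omega> \<longleftrightarrow> bounded \<Omega> \<and>
     (\<exists>E C. C > 1 \<and> (\<forall>u\<in>BV \<Omega>. E u \<in> BV (UNIV::'a set) \<and>
        (AE x in lebesgue_on \<Omega>. E u x = u x) \<and>
        BV_norm UNIV (E u) \<le> C * BV_norm \<Omega> u))"

end

theory Submission
  imports Defs
begin

text \<open>
  The direction from (BV, BV) to (W11, BV) holds because the total variation of a W11 function is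
  at most the L1 norm of its weak gradient. For the converse, write a given u in BV as u = v + W,
  where v is a W11 function on \<open>\<Omega>\<close> and W is a function of bounded variation on the whole space, both
  with norms controlled by the BV norm of u; then the extension of v plus W extends u.

  To find the decomposition, take a partition of unity \<open>\<psi>\<^sub>i\<close> of \<open>\<Omega>\<close> and let v be the sum of the
  mollified pieces \<open>\<rho>\<^sub>i * (\<psi>\<^sub>i u)\<close>, with radii so small that mollifying \<open>\<psi>\<^sub>i u\<close> and \<open>u \<nabla>\<psi>\<^sub>i\<close> changes them
  by at most \<open>\<delta> / 2\<^sup>i\<close> in L1. The vector fields \<open>\<nabla>(\<rho>\<^sub>i * (\<psi>\<^sub>i u)) - u \<nabla>\<psi>\<^sub>i\<close> are absolutely summable in L1
  with total at most the variation of u plus \<open>\<delta>\<close>: test the i-th one with its own sign \<open>\<theta>\<^sub>i\<close> and observe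
  that \<open>\<Sum> \<psi>\<^sub>i (\<rho>\<^sub>i * \<theta>\<^sub>i)\<close> is an admissible test field for u. As the gradients \<open>\<nabla>\<psi>\<^sub>i\<close> cancel in the sum,
  their sum is the weak gradient of v. No compactness in BV is needed.
\<close>
section \<open>Continuity of translation in L1\<close>

text \<open>The delicate claim is that \<open>W\<close> has bounded variation on the whole space
  although \<open>u\<close> is known on \<Omega> only. Let \<open>w i\<close> be the i-th piece
  minus its mollification and \<open>h i\<close> the i-th vector field. Summing an identity for
  single pieces gives, for every test field \<phi> on the whole space, even one that does not vanish
  on the boundary of \<Omega>: the sum of the first \<open>n\<close> fields \<open>w i\<close>,
  tested with div \<phi>, equals \<open>u\<close> tested with the divergence of (sum of the first
  \<open>n\<close> cutoffs) times \<phi>, plus the sum of the first \<open>n\<close> fields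
  \<open>h i\<close> tested with \<phi>. The cut off field is supported in \<Omega> and has norm at
  most 1, so it costs at most the variation of \<open>u\<close>; the rest costs at most the L1 norms
  of the \<open>h i\<close>. Thus no boundary term arises, and the bound survives the L1 limit. The
  radii are chosen by L1 errors alone. A mollified piece may leak out of \<Omega> and the sum need
  not be locally finite, so the weak gradient of v is obtained from L1 limits, not from smoothness.
  With \<delta> equal to the L1 norm of \<open>u\<close>, every error is absorbed by the BV
  norm.\<close>

lemma lborel_translate:
  fixes f :: "'a::euclidean_space \<Rightarrow> 'b::{banach,second_countable_topology}"
  shows integrable_translate: "integrable lborel f \<Longrightarrow> integrable lborel (\<lambda>x. f (x - h))"
    and integral_translate:
      "f \<in> borel_measurable borel \<Longrightarrow> (\<integral>x. f (x - h) \<partial>lborel) = (\<integral>x. f x \<partial>lborel)"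
proof -
  have d: "distr lborel borel (\<lambda>x. x - h) = (lborel :: 'a measure)"
    using lborel_distr_plus[of "- h"] by (simp add: add.commute[of "- h"] cong: distr_cong)
  show "integrable lborel f \<Longrightarrow> integrable lborel (\<lambda>x. f (x - h))"
    using integrable_distr[of "\<lambda>x. x - h" lborel borel f] by (simp add: d)
  show "(\<integral>x. f (x - h) \<partial>lborel) = (\<integral>x. f x \<partial>lborel)" if "f \<in> borel_measurable borel"
    using integral_distr[of "\<lambda>x. x - h" lborel borel f] that by (simp add: d)
qed

lemma lborel_reflect:
  fixes f :: "'a::euclidean_space \<Rightarrow> 'b::{banach,second_countable_topology}"
  shows integrable_reflect_translate: "integrable lborel f \<Longrightarrow> integrable lborel (\<lambda>x. f (h - x))"
    and integral_reflect_translate: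
      "f \<in> borel_measurable borel \<Longrightarrow> (\<integral>x. f (h - x) \<partial>lborel) = (\<integral>x. f x \<partial>lborel)"
proof -
  have d: "distr lborel borel (\<lambda>x. h - x) = (lborel :: 'a measure)"
    using lborel_affine[of "-1" h] by (simp add: density_1)
  show "integrable lborel f \<Longrightarrow> integrable lborel (\<lambda>x. f (h - x))"
    using integrable_distr[of "\<lambda>x. h - x" lborel borel f] by (simp add: d)
  show "(\<integral>x. f (h - x) \<partial>lborel) = (\<integral>x. f x \<partial>lborel)" if "f \<in> borel_measurable borel"
    using integral_distr[of "\<lambda>x. h - x" lborel borel f] that by (simp add: d)
qed

definition L1_translation_continuous ::
    "('a::euclidean_space \<Rightarrow> 'b::{banach,second_countable_topology}) \<Rightarrow> bool" where
  "L1_translation_continuous f \<longleftrightarrow>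
     (\<forall>e>0. \<exists>d>0. \<forall>h. norm h < d \<longrightarrow> (\<integral>x. norm (f (x - h) - f x) \<partial>lborel) < e)"

text \<open>Three-epsilon argument: translation preserves the L1 norm, so \<open>f\<close> is as far
  from \<open>g\<close> as their translates are. The property is thus closed under L1 limits, on
  which both the base case and the limit case of the induction below rely.\<close>

lemma L1_translation_continuous_approx:
  fixes f :: "'a::euclidean_space \<Rightarrow> 'b::{banach,second_countable_topology}"
  assumes f: "integrable lborel f"
    and approx: "\<And>e. e > 0 \<Longrightarrow> \<exists>g. integrable lborel g \<and> L1_translation_continuous g \<and>
                  (\<integral>x. norm (f x - g x) \<partial>lborel) < e"
  shows "L1_translation_continuous f"
  unfolding L1_translation_continuous_def
proof (intro allI impI)
  fix e :: real assume "e > 0"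
  then obtain g where g: "integrable lborel g" "L1_translation_continuous g"
    "(\<integral>x. norm (f x - g x) \<partial>lborel) < e/3"
    using approx[of "e/3"] by auto
  obtain d where d: "d > 0"
    "\<And>h. norm h < d \<Longrightarrow> (\<integral>x. norm (g (x - h) - g x) \<partial>lborel) < e/3"
    using g(2) \<open>e > 0\<close> unfolding L1_translation_continuous_def by (meson divide_pos_pos zero_less_numeral)
  have "(\<integral>x. norm (f (x - h) - f x) \<partial>lborel) < e" if h: "norm h < d" for h
  proof -
    note [simp] = f g(1) integrable_translate[OF f] integrable_translate[OF g(1)]
    have "(\<integral>x. norm (f (x - h) - f x) \<partial>lborel) \<le>
      (\<integral>x. norm (f (x - h) - g (x - h)) + (norm (g (x - h) - g x) + norm (f x - g x)) \<partial>lborel)"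
    proof (rule integral_mono)
      fix x show "norm (f (x - h) - f x) \<le>
        norm (f (x - h) - g (x - h)) + (norm (g (x - h) - g x) + norm (f x - g x))"
        using norm_triangle_ineq[of "f (x - h) - g (x - h)" "(g (x - h) - g x) - (f x - g x)"]
          norm_triangle_ineq4[of "g (x - h) - g x" "f x - g x"] by simp
    qed auto
    also have "\<dots> = (\<integral>x. norm (f (x - h) - g (x - h)) \<partial>lborel) +
        ((\<integral>x. norm (g (x - h) - g x) \<partial>lborel) + (\<integral>x. norm (f x - g x) \<partial>lborel))"
      by (subst Bochner_Integration.integral_add; (simp)?)+
    also have "(\<integral>x. norm (f (x - h) - g (x - h)) \<partial>lborel) = (\<integral>x. norm (f x - g x) \<partial>lborel)"
      using borel_measurable_integrable[OF f] borel_measurable_integrable[OF g(1)]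
      by (intro integral_translate) auto
    finally show ?thesis using d(2)[OF h] g(3) by simp
  qed
  then show "\<exists>d>0. \<forall>h. norm h < d \<longrightarrow> (\<integral>x. norm (f (x - h) - f x) \<partial>lborel) < e"
    using d(1) by blast
qed

text \<open>Take an open \<open>U\<close> around \<open>K\<close> with \<open>U - K\<close> of small
  measure. A short shift keeps \<open>K\<close> inside \<open>U\<close>, so \<open>K\<close> and its
  translate both fill \<open>U\<close> up to that small measure.\<close>

lemma L1_translation_continuous_indicator_compact:
  fixes K :: "'a::euclidean_space set" and c :: "'b::{banach,second_countable_topology}"
  assumes K: "compact K"
  shows "L1_translation_continuous (\<lambda>x. indicator K x *\<^sub>R c)"
  unfolding L1_translation_continuous_def
proof (intro allI impI)
  fix e :: real assume "e > 0"
  \<comment> \<open>Chosen so that \<open>2 * e' * norm c < e\<close>; the \<open>+ 1\<close> covers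
    \<open>c = 0\<close>.\<close>
  define e' where "e' = e / (2 * (norm c + 1))"
  have e': "e' > 0" using \<open>e > 0\<close> unfolding e'_def by (intro divide_pos_pos) (auto intro: add_nonneg_pos)
  have Kb[measurable]: "K \<in> sets borel" using K by (simp add: borel_compact)
  obtain U where U: "open U" "K \<subseteq> U" "U - K \<in> lmeasurable" "emeasure lebesgue (U - K) < ennreal e'"
    using sets_lebesgue_outer_open[of K e'] e' by auto
  have Ub[measurable]: "U \<in> sets borel" using U by simp
  obtain d where d: "d > 0" "\<And>x y. x \<in> K \<Longrightarrow> dist x y < d \<Longrightarrow> y \<in> U"
  proof (cases "K = {} \<or> U = UNIV")
    case True
    then show ?thesis using that[of 1] by auto
  next
    case False
    then have "K \<noteq> {}" "- U \<noteq> {}" by auto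
    then have "setdist K (- U) > 0"
      using K U by (subst setdist_gt_0_compact_closed) auto
    moreover have "y \<in> U" if "x \<in> K" "dist x y < setdist K (- U)" for x y
      using setdist_le_dist[of x K y "- U"] that by force
    ultimately show ?thesis using that by blast
  qed
  have mK: "emeasure lborel K < \<infinity>" using K by (rule emeasure_compact_finite)
  have mD: "emeasure lborel (U - K) < ennreal e'" using U by simp
  have iK: "integrable lborel (indicator K :: 'a \<Rightarrow> real)" using mK by simp
  have iD: "integrable lborel (indicator (U - K) :: 'a \<Rightarrow> real)" using mD
    by (intro integrable_real_indicator) (auto intro: order_less_trans[OF _ ennreal_less_top])
  have iU: "integrable lborel (indicator U :: 'a \<Rightarrow> real)"
  proof -
    have "(indicator U :: 'a \<Rightarrow> real) = (\<lambda>x. indicator K x + indicator (U - K) x)"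
      using U(2) by (auto simp: fun_eq_iff indicator_def)
    with iK iD show ?thesis by simp
  qed
  have "(\<integral>x. norm (indicator K (x - h) *\<^sub>R c - indicator K x *\<^sub>R c) \<partial>lborel) < e" if h: "norm h < d" for h
  proof -
    note [simp] = iK iU integrable_translate[OF iK]
    \<comment> \<open>Both indicators lie below that of \<open>U\<close>, so their difference is at
      most the sum of the two gaps; by translation invariance both gaps have the same
      integral.\<close>
    have le: "\<bar>indicator K (x - h) - indicator K x\<bar> \<le>
        (indicator U x - indicator K (x - h)) + (indicator U x - indicator K x :: real)" for x
      using U(2) d(2)[of "x - h" x] h by (auto simp: indicator_def dist_norm)
    have "(\<integral>x. norm (indicator K (x - h) *\<^sub>R c - indicator K x *\<^sub>R c) \<partial>lborel) =
          (\<integral>x. \<bar>indicator K (x - h) - indicator K x\<bar> * norm c \<partial>lborel)"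
      by (simp add: scaleR_diff_left[symmetric])
    also have "\<dots> = (\<integral>x. \<bar>indicator K (x - h) - indicator K x\<bar> \<partial>lborel) * norm c"
      by simp
    also have "(\<integral>x. \<bar>indicator K (x - h) - indicator K x\<bar> \<partial>lborel) \<le>
         (\<integral>x. ((indicator U x - indicator K (x - h)) + (indicator U x - indicator K x) :: real) \<partial>lborel)"
      by (rule integral_mono) (use le in auto)
    also have "\<dots> = ((\<integral>x. indicator U x \<partial>lborel) - (\<integral>x. indicator K (x - h) \<partial>lborel))
        + ((\<integral>x. indicator U x \<partial>lborel) - (\<integral>x. indicator K x \<partial>lborel))"
      by (subst Bochner_Integration.integral_add Bochner_Integration.integral_diff; (simp del: Bochner_Integration.integral_indicator integral_indicator)?)+
    also have "(\<integral>x. indicator K (x - h) \<partial>lborel) = (\<integral>x. (indicator K x :: real) \<partial>lborel)"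
      by (rule integral_translate) simp
    also have "((\<integral>x. indicator U x \<partial>lborel) - (\<integral>x. indicator K x \<partial>lborel))
      + ((\<integral>x. indicator U x \<partial>lborel) - (\<integral>x. indicator K x \<partial>lborel)) = 
       2 * (\<integral>x. (indicator U x - indicator K x :: real) \<partial>lborel)"
      by (subst Bochner_Integration.integral_diff) auto
    also have "(\<integral>x. indicator U x - indicator K x \<partial>lborel) = (\<integral>x. (indicator (U - K) x :: real) \<partial>lborel)"
      using U(2) by (intro Bochner_Integration.integral_cong) (auto simp: indicator_def)
    also have "\<dots> = measure lborel (U - K)" by simp
    also have "measure lborel (U - K) \<le> e'"
      using mD e' unfolding measure_def by (intro enn2real_leI) auto
    finally have "(\<integral>x. norm (indicator K (x - h) *\<^sub>R c - indicator K x *\<^sub>R c) \<partial>lborel) \<le> 2 * e' * norm c"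
      by (simp add: mult_right_mono)
    also have "\<dots> < e" using \<open>e > 0\<close> add_nonneg_pos[of "norm c * 2" 2] unfolding e'_def
      by (simp add: pos_divide_less_eq algebra_simps)
    finally show ?thesis .
  qed
  then show "\<exists>d>0. \<forall>h. norm h < d \<longrightarrow>
      (\<integral>x. norm (indicator K (x - h) *\<^sub>R c - indicator K x *\<^sub>R c) \<partial>lborel) < e"
    using d(1) by blast
qed

text \<open>The factor \<open>2\<close> is the domination supplied by the limit case of
  \<open>integrable_induct\<close>; truncations to balls satisfy it as well.\<close>

lemma L1_approx_of_dominated:
  fixes f :: "'a \<Rightarrow> 'b::{banach,second_countable_topology}"
  assumes s: "\<And>i. integrable M (s i)" and f: "integrable M f"
    and lim: "\<And>x. x \<in> space M \<Longrightarrow> (\<lambda>i. s i x) \<longlonglongrightarrow> f x"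
    and bd: "\<And>i x. x \<in> space M \<Longrightarrow> norm (s i x) \<le> 2 * norm (f x)"
  shows "(\<lambda>i. \<integral>x. norm (f x - s i x) \<partial>M) \<longlonglongrightarrow> 0"
proof -
  have "(\<lambda>i. \<integral>x. norm (f x - s i x) \<partial>M) \<longlonglongrightarrow> (\<integral>x. 0 \<partial>M)"
  proof (rule integral_dominated_convergence[where w = "\<lambda>x. 3 * norm (f x)"])
    show "AE x in M. (\<lambda>i. norm (f x - s i x)) \<longlonglongrightarrow> 0"
    proof (rule AE_I2)
      fix x assume "x \<in> space M"
      then have "(\<lambda>i. norm (f x - s i x)) \<longlonglongrightarrow> norm (f x - f x)"
        by (intro tendsto_intros lim)
      then show "(\<lambda>i. norm (f x - s i x)) \<longlonglongrightarrow> 0" by simp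
    qed
    show "AE x in M. norm (norm (f x - s i x)) \<le> 3 * norm (f x)" for i
    proof (rule AE_I2)
      fix x assume "x \<in> space M"
      from bd[OF this, of i] show "norm (norm (f x - s i x)) \<le> 3 * norm (f x)"
        using norm_triangle_ineq4[of "f x" "s i x"] by simp
    qed
  qed (use s f in auto)
  then show ?thesis by simp
qed

lemma integrable_imp_L1_translation_continuous:
  fixes f :: "'a::euclidean_space \<Rightarrow> 'b::{banach,second_countable_topology}"
  assumes "integrable lborel f"
  shows "L1_translation_continuous f"
  using assms
proof (induct f rule: integrable_induct)
  case (base A c)
  \<comment> \<open>Bounded sets first: a closed set approximating \<open>B\<close> from inside is
    then compact. A general \<open>A\<close> of finite measure is afterwards cut by balls.\<close>
  have bdd: "L1_translation_continuous (\<lambda>x. indicator B x *\<^sub>R c)"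
    if B[measurable]: "B \<in> sets borel" and "bounded B" for B :: "'a set"
  proof (rule L1_translation_continuous_approx)
    have mB: "emeasure lborel B < \<infinity>" using \<open>bounded B\<close> by (rule emeasure_bounded_finite)
    then show iB: "integrable lborel (\<lambda>x. indicator B x *\<^sub>R c)" by simp
    fix e :: real assume "e > 0"
    define e' where "e' = e / (norm c + 1)"
    have e': "e' > 0" using \<open>e > 0\<close> unfolding e'_def by (intro divide_pos_pos) (auto intro: add_nonneg_pos)
    obtain T where T: "closed T" "T \<subseteq> B" "B - T \<in> lmeasurable" "emeasure lebesgue (B - T) < ennreal e'"
      using sets_lebesgue_inner_closed[of B e'] e' B by auto
    have K: "compact T" using T \<open>bounded B\<close> bounded_subset compact_eq_bounded_closed by blast
    have [measurable]: "T \<in> sets borel" using T by simp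
    have "(\<integral>x. norm (indicator B x *\<^sub>R c - indicator T x *\<^sub>R c) \<partial>lborel) =
        (\<integral>x. indicator (B - T) x * norm c \<partial>lborel)"
      using T(2) by (intro Bochner_Integration.integral_cong) (auto simp: indicator_def)
    also have "\<dots> = measure lborel (B - T) * norm c" by simp
    also have "\<dots> \<le> e' * norm c"
      using T(4) e' unfolding measure_def by (intro mult_right_mono enn2real_leI) auto
    also have "\<dots> < e"
      using \<open>e > 0\<close> unfolding e'_def by (simp add: pos_divide_less_eq add_nonneg_pos)
    finally show "\<exists>g. integrable lborel g \<and> L1_translation_continuous g \<and>
                  (\<integral>x. norm (indicator B x *\<^sub>R c - g x) \<partial>lborel) < e"
      using L1_translation_continuous_indicator_compact[OF K, of c] emeasure_compact_finite[OF K]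
      by (intro exI[of _ "\<lambda>x. indicator T x *\<^sub>R c"]) simp
  qed
  show ?case
  proof (rule L1_translation_continuous_approx)
    show iA: "integrable lborel (\<lambda>x. indicator A x *\<^sub>R c)" using base by simp
    fix e :: real assume "e > 0"
    define s where "s n x = indicator (A \<inter> cball 0 (real n)) x *\<^sub>R c" for n x
    have int: "integrable lborel (s n)" for n
      unfolding s_def using base emeasure_bounded_finite[of "A \<inter> cball 0 (real n)"]
      by (auto intro!: integrable_scaleR_left simp: bounded_Int)
    have "(\<lambda>n. \<integral>x. norm (indicator A x *\<^sub>R c - s n x) \<partial>lborel) \<longlonglongrightarrow> 0"
    proof (rule L1_approx_of_dominated[OF int iA])
      fix x :: 'a
      obtain N where N: "norm x \<le> real N" using real_arch_simple by blast
      have "s n x = indicator A x *\<^sub>R c" if "n \<ge> N" for n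
        using N that by (auto simp: s_def indicator_def)
      then show "(\<lambda>i. s i x) \<longlonglongrightarrow> indicator A x *\<^sub>R c"
        by (intro tendsto_eventually) (auto simp: eventually_sequentially)
    qed (auto simp: s_def indicator_def)
    then obtain n where "(\<integral>x. norm (indicator A x *\<^sub>R c - s n x) \<partial>lborel) < e"
      using \<open>e > 0\<close> by (metis (no_types, lifting) eventually_sequentially order_tendsto_iff order_refl)
    moreover have "L1_translation_continuous (s n)"
      unfolding s_def using base by (intro bdd) (auto simp: bounded_Int)
    ultimately show "\<exists>g. integrable lborel g \<and> L1_translation_continuous g \<and>
                  (\<integral>x. norm (indicator A x *\<^sub>R c - g x) \<partial>lborel) < e"
      using int by blast
  qed
next
  case (add f g)
  show ?case
    unfolding L1_translation_continuous_def
  proof (intro allI impI)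
    fix e :: real assume "e > 0"
    obtain d1 where d1: "d1 > 0" "\<And>h. norm h < d1 \<Longrightarrow> (\<integral>x. norm (f (x - h) - f x) \<partial>lborel) < e/2"
      using add(2) \<open>e > 0\<close> unfolding L1_translation_continuous_def by (meson half_gt_zero)
    obtain d2 where d2: "d2 > 0" "\<And>h. norm h < d2 \<Longrightarrow> (\<integral>x. norm (g (x - h) - g x) \<partial>lborel) < e/2"
      using add(4) \<open>e > 0\<close> unfolding L1_translation_continuous_def by (meson half_gt_zero)
    note [simp] = add(1,3) integrable_translate[OF add(1)] integrable_translate[OF add(3)]
    have "(\<integral>x. norm (f (x - h) + g (x - h) - (f x + g x)) \<partial>lborel) < e" if h: "norm h < min d1 d2" for h
    proof -
      have "(\<integral>x. norm (f (x - h) + g (x - h) - (f x + g x)) \<partial>lborel) \<le>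
         (\<integral>x. norm (f (x - h) - f x) + norm (g (x - h) - g x) \<partial>lborel)"
        by (rule integral_mono) (auto simp: norm_diff_triangle_ineq)
      also have "\<dots> = (\<integral>x. norm (f (x - h) - f x) \<partial>lborel) + (\<integral>x. norm (g (x - h) - g x) \<partial>lborel)"
        by simp
      finally show ?thesis using d1(2)[of h] d2(2)[of h] h by simp
    qed
    then show "\<exists>d>0. \<forall>h. norm h < d \<longrightarrow> (\<integral>x. norm (f (x - h) + g (x - h) - (f x + g x)) \<partial>lborel) < e"
      using d1(1) d2(1) by (intro exI[of _ "min d1 d2"]) auto
  qed
next
  case (lim f s)
  show ?case
  proof (rule L1_translation_continuous_approx[OF lim(5)])
    fix e :: real assume "e > 0"
    have "(\<lambda>n. \<integral>x. norm (f x - s n x) \<partial>lborel) \<longlonglongrightarrow> 0"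
      by (rule L1_approx_of_dominated) (use lim in auto)
    then obtain n where "(\<integral>x. norm (f x - s n x) \<partial>lborel) < e"
      using \<open>e > 0\<close> by (metis (no_types, lifting) eventually_sequentially order_tendsto_iff order_refl)
    then show "\<exists>g. integrable lborel g \<and> L1_translation_continuous g \<and>
                  (\<integral>x. norm (f x - g x) \<partial>lborel) < e"
      using lim by blast
  qed
qed

section \<open>A mollifier with Lipschitz gradient\<close>

text \<open>A kernel that is C1 with Lipschitz gradient suffices, since \<open>C1c\<close> asks for
  C1 fields; being a truncated polynomial, it reduces all estimates to elementary
  inequalities.\<close>

definition bump :: "'a::euclidean_space \<Rightarrow> real" where
  "bump x = (max 0 (1 - x \<bullet> x))\<^sup>2"

definition dbump :: "'a::euclidean_space \<Rightarrow> 'a" where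
  "dbump x = (- 4 * max 0 (1 - x \<bullet> x)) *\<^sub>R x"

lemma has_derivative_of_quadratic_bound:
  fixes f :: "'a::real_normed_vector \<Rightarrow> 'b::real_normed_vector"
  assumes D: "bounded_linear D" and bd: "\<And>h. norm (f (x + h) - f x - D h) \<le> C * (norm h)\<^sup>2"
  shows "(f has_derivative D) (at x)"
proof -
  have "norm (f (x + h) - f x - D h) / norm h \<le> C * norm h" if "h \<noteq> 0" for h
    using bd[of h] that by (subst pos_divide_le_eq) (auto simp: power2_eq_square mult.assoc)
  then have 1: "norm (f (x + h) - f x - D h) / norm h \<le> C * norm h" for h
    by (cases "h = 0") simp_all
  have 2: "((\<lambda>h::'a. C * norm h) \<longlongrightarrow> 0) (at 0)"
    by (rule tendsto_mult_right_zero) (rule tendsto_norm_zero[OF tendsto_ident_at])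
  have "((\<lambda>h. norm (f (x + h) - f x - D h) / norm h) \<longlongrightarrow> 0) (at 0)"
    by (rule Lim_null_comparison[OF always_eventually 2]) (simp add: 1)
  with D show ?thesis unfolding has_derivative_at by (rule conjI)
qed

lemma bump_has_derivative: "(bump has_derivative (\<lambda>h. dbump x \<bullet> h)) (at x)"
proof -
  define p where "p t = (max 0 t)\<^sup>2" for t :: real
  have "(p has_derivative (\<lambda>h. 2 * max 0 t * h)) (at t)" for t
  proof (rule has_derivative_of_quadratic_bound)
    show "bounded_linear ((*) (2 * max 0 t))" by (rule bounded_linear_mult_right)
    fix h :: real
    show "norm (p (t + h) - p t - 2 * max 0 t * h) \<le> 1 * (norm h)\<^sup>2"
    proof -
      consider "t \<ge> 0" "t + h \<ge> 0" | "t \<ge> 0" "t + h < 0" | "t < 0" "t + h \<ge> 0" | "t < 0" "t + h < 0"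
        by linarith
      then show ?thesis
      proof cases
        case 2
        \<comment> \<open>Completing the square: the remainder is
          \<open>h\<^sup>2 - (t + h)\<^sup>2\<close>, and it is nonnegative because
          \<open>t + h < 0 \<le> t\<close>.\<close>
        have "\<bar>- t\<^sup>2 - 2 * t * h\<bar> = (- h)\<^sup>2 - (- t - h)\<^sup>2"
        proof -
          have "0 \<le> t * (- t - 2 * h)" using 2 by (intro mult_nonneg_nonneg) auto
          then show ?thesis by (simp add: power2_eq_square algebra_simps)
        qed
        also have "\<dots> \<le> h\<^sup>2" by simp
        finally show ?thesis using 2 by (simp add: p_def max_def)
      next
        case 3
        then have "(t + h)\<^sup>2 \<le> h\<^sup>2" by (intro power_mono) auto
        then show ?thesis using 3 by (simp add: p_def max_def)
      qed (auto simp: p_def max_def power2_eq_square algebra_simps)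
    qed
  qed
  moreover have "((\<lambda>x. 1 - x \<bullet> x) has_derivative (\<lambda>h. - (x \<bullet> h + h \<bullet> x))) (at x)"
    by (auto intro!: derivative_eq_intros)
  ultimately have "((\<lambda>x. p (1 - x \<bullet> x)) has_derivative (\<lambda>h. 2 * max 0 (1 - x \<bullet> x) * - (x \<bullet> h + h \<bullet> x))) (at x)"
    by (rule has_derivative_compose[rotated])
  then show ?thesis
    unfolding bump_def[abs_def] dbump_def p_def by (simp add: inner_commute algebra_simps)
qed

text \<open>Up to the factor \<open>- 4\<close> the field is \<open>f\<close> below, polynomial in
  the unit ball and zero outside. Its Lipschitz constant comes out as 3 inside the ball and 2 across
  the sphere; both are rounded up to 4, whence 16.\<close>

lemma dbump_lipschitz: "norm (dbump x - dbump y) \<le> 16 * norm (x - y)"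
proof -
  define f where "f x = max 0 (1 - x \<bullet> x) *\<^sub>R x" for x :: 'a
  have f0: "f x = 0" if "norm x \<ge> 1" for x
  proof -
    have "1\<^sup>2 \<le> (norm x)\<^sup>2" using that by (intro power_mono) auto
    then show ?thesis by (simp add: f_def power2_norm_eq_inner)
  qed
  have ff: "f x = (1 - (norm x)\<^sup>2) *\<^sub>R x" if "norm x \<le> 1" for x
  proof -
    have "(norm x)\<^sup>2 \<le> 1\<^sup>2" using that by (intro power_mono) auto
    then show ?thesis by (simp add: f_def power2_norm_eq_inner)
  qed
  \<comment> \<open>The value at \<open>x\<close> is at most twice the distance
    \<open>1 - norm x\<close> to the sphere, which is less than
    \<open>norm y - norm x\<close>.\<close>
  have out: "norm (f x - f y) \<le> 4 * norm (x - y)" if "norm x \<le> 1" "norm y > 1" for x y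
  proof -
    have "norm (f x - f y) = (1 - (norm x)\<^sup>2) * norm x"
      using that abs_square_le_1[of "norm x"] by (simp add: f0 ff)
    also have "\<dots> = (1 - norm x) * ((1 + norm x) * norm x)"
      by (simp add: power2_eq_square algebra_simps)
    also have "\<dots> \<le> (1 - norm x) * (2 * 1)"
      using that by (intro mult_left_mono mult_mono) auto
    also have "\<dots> \<le> 2 * (norm y - norm x)" using that by simp
    also have "norm y - norm x \<le> norm (x - y)" using norm_triangle_ineq2[of y x] by (simp add: norm_minus_commute)
    finally show ?thesis using norm_ge_zero[of "x - y"] by linarith
  qed
  have "norm (f x - f y) \<le> 4 * norm (x - y)"
  proof -
    consider "norm x \<le> 1" "norm y \<le> 1" | "norm x \<le> 1" "norm y > 1" | "norm x > 1" "norm y \<le> 1"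
      | "norm x > 1" "norm y > 1" by linarith
    then show ?thesis
    proof cases
      case 1
      have "f x - f y = (1 - (norm x)\<^sup>2) *\<^sub>R (x - y) - ((norm x - norm y) * (norm x + norm y)) *\<^sub>R y"
        by (simp add: ff 1 power2_eq_square algebra_simps)
      also have "norm \<dots> \<le> (1 - (norm x)\<^sup>2) * norm (x - y) +
          (\<bar>norm x - norm y\<bar> * (norm x + norm y)) * norm y"
        by (rule order_trans[OF norm_triangle_ineq4]) (use 1 abs_square_le_1[of "norm x"] in \<open>simp add: abs_mult\<close>)
      also have "\<dots> \<le> 1 * norm (x - y) + (norm (x - y) * 2) * 1"
        using 1 norm_triangle_ineq3[of x y] by (intro add_mono mult_mono) auto
      finally show ?thesis using norm_ge_zero[of "x - y"] by linarith
    next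
      case 2 then show ?thesis by (rule out)
    next
      case 3 then show ?thesis using out[of y x] by (simp add: norm_minus_commute)
    next
      case 4 then show ?thesis by (simp add: f0)
    qed
  qed
  moreover have "dbump x - dbump y = (- 4) *\<^sub>R (f x - f y)"
    by (simp add: dbump_def f_def algebra_simps)
  ultimately show ?thesis by simp
qed

text \<open>The \<open>itself\<close> argument fixes the space: neither the radius nor the real
  result mentions \<open>'a\<close>, while the mass depends on its dimension.\<close>

definition moll_mass :: "'a::euclidean_space itself \<Rightarrow> real \<Rightarrow> real" where
  "moll_mass _ e = (\<integral>y. bump (y /\<^sub>R e :: 'a) \<partial>lborel)"

definition moll :: "real \<Rightarrow> 'a::euclidean_space \<Rightarrow> real" where
  "moll e x = bump (x /\<^sub>R e) / moll_mass TYPE('a) e"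

definition dmoll :: "real \<Rightarrow> 'a::euclidean_space \<Rightarrow> 'a" where
  "dmoll e x = dbump (x /\<^sub>R e) /\<^sub>R (e * moll_mass TYPE('a) e)"

lemma continuous_on_moll: "continuous_on UNIV (moll e)"
  unfolding moll_def bump_def divide_inverse by (intro continuous_intros)

lemma continuous_on_dmoll: "continuous_on UNIV (dmoll e)"
  unfolding dmoll_def dbump_def by (intro continuous_intros)

lemma borel_measurable_moll [measurable]: "moll e \<in> borel_measurable borel"
  by (rule borel_measurable_continuous_onI[OF continuous_on_moll])

lemma borel_measurable_dmoll [measurable]: "dmoll e \<in> borel_measurable borel"
  by (rule borel_measurable_continuous_onI[OF continuous_on_dmoll])

lemma moll_minus: "moll e (- x) = moll e x"
  by (simp add: moll_def bump_def)

lemma dmoll_minus: "dmoll e (- x) = - dmoll e x"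
  by (simp add: dmoll_def dbump_def)

lemma scaled_bump_eq_0:
  fixes x :: "'a::euclidean_space"
  assumes "e > 0" "norm x \<ge> e" shows "max 0 (1 - (x /\<^sub>R e) \<bullet> (x /\<^sub>R e)) = 0"
proof -
  have "1\<^sup>2 \<le> (norm (x /\<^sub>R e))\<^sup>2" using assms by (intro power_mono) (auto simp: divide_simps)
  then show ?thesis by (simp only: power2_norm_eq_inner) simp
qed

lemma moll_eq_0: "e > 0 \<Longrightarrow> norm x \<ge> e \<Longrightarrow> moll e x = 0"
  using scaled_bump_eq_0[of e x] by (simp add: moll_def bump_def)

lemma dmoll_eq_0: "e > 0 \<Longrightarrow> norm x \<ge> e \<Longrightarrow> dmoll e x = 0"
  using scaled_bump_eq_0[of e x] by (simp add: dmoll_def dbump_def)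

section \<open>Mass, bounds and linearization of the mollifier\<close>

lemma integrable_of_compact_support:
  fixes f :: "'a::euclidean_space \<Rightarrow> 'b::{banach,second_countable_topology}"
  assumes "continuous_on UNIV f" "\<And>x. norm x \<ge> e \<Longrightarrow> f x = 0"
  shows "integrable lborel f"
proof -
  have "integrable lborel (\<lambda>x. indicator (cball 0 e) x *\<^sub>R f x)"
    by (rule borel_integrable_compact) (use assms(1) continuous_on_subset[of UNIV f] in auto)
  moreover have "(\<lambda>x. indicator (cball 0 e) x *\<^sub>R f x) = f"
    using assms(2) by (auto simp: fun_eq_iff indicator_def)
  ultimately show ?thesis by simp
qed

lemma integrable_scaled_bump:
  assumes "e > 0" shows "integrable lborel (\<lambda>y::'a::euclidean_space. bump (y /\<^sub>R e))"
proof (rule integrable_of_compact_support)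
  show "continuous_on UNIV (\<lambda>y::'a. bump (y /\<^sub>R e))"
    unfolding bump_def by (intro continuous_intros)
  show "bump (x /\<^sub>R e) = 0" if "norm x \<ge> e" for x :: 'a
    using scaled_bump_eq_0[OF assms that] by (simp add: bump_def)
qed

lemma moll_mass_pos:
  assumes "e > 0" shows "moll_mass TYPE('a::euclidean_space) e > 0"
proof -
  let ?B = "ball (0::'a) (e/2)"
  \<comment> \<open>On the ball of radius \<open>e/2\<close> the scaled point has squared norm at
    most \<open>1/4\<close>, so \<open>bump\<close> is at least
    \<open>(3/4)\<^sup>2 = 9/16\<close>.\<close>
  have "0 < (9/16) * measure lborel ?B"
    using content_ball_pos[of "e/2" "0::'a"] assms by simp
  also have "\<dots> = (\<integral>x. (9/16) * indicator ?B x \<partial>lborel)" by simp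
  also have "\<dots> \<le> moll_mass TYPE('a) e" unfolding moll_mass_def
  proof (rule integral_mono)
    show "integrable lborel (\<lambda>x. 9/16 * indicator ?B x :: real)"
      using emeasure_bounded_finite[of ?B] by simp
    fix x :: 'a
    have "9/16 \<le> bump (x /\<^sub>R e)" if "x \<in> ?B"
    proof -
      have "(norm (x /\<^sub>R e))\<^sup>2 \<le> (1/2)\<^sup>2"
        using that assms by (intro power_mono) (auto simp: divide_simps)
      then have "(x /\<^sub>R e) \<bullet> (x /\<^sub>R e) \<le> 1/4" by (simp only: power2_norm_eq_inner) (simp add: power2_eq_square)
      then have "(3/4)\<^sup>2 \<le> (max 0 (1 - (x /\<^sub>R e) \<bullet> (x /\<^sub>R e)))\<^sup>2" by (intro power_mono) auto
      then show ?thesis unfolding bump_def by (simp add: power2_eq_square)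
    qed
    then show "9/16 * indicator ?B x \<le> bump (x /\<^sub>R e)"
      by (auto simp: indicator_def bump_def)
  qed (rule integrable_scaled_bump[OF assms])
  finally show ?thesis .
qed

lemma moll_nonneg: "e > 0 \<Longrightarrow> moll e x \<ge> 0" for x :: "'a::euclidean_space"
  using moll_mass_pos[where 'a='a, of e] by (simp add: moll_def bump_def)

lemma integrable_moll: "e > 0 \<Longrightarrow> integrable lborel (moll e :: 'a::euclidean_space \<Rightarrow> real)"
  by (rule integrable_of_compact_support[OF continuous_on_moll moll_eq_0])

lemma integrable_dmoll: "e > 0 \<Longrightarrow> integrable lborel (dmoll e :: 'a::euclidean_space \<Rightarrow> 'a)"
  by (rule integrable_of_compact_support[OF continuous_on_dmoll dmoll_eq_0])

lemma integral_moll: "e > 0 \<Longrightarrow> (\<integral>x. moll e (x::'a::euclidean_space) \<partial>lborel) = 1"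
  using moll_mass_pos[where 'a='a, of e] unfolding moll_def by (simp add: moll_mass_def)

lemma moll_has_derivative: "(moll e has_derivative (\<lambda>h. dmoll e x \<bullet> h)) (at x)"
proof -
  have "((\<lambda>x::'a. bump (x /\<^sub>R e)) has_derivative (\<lambda>h. dbump (x /\<^sub>R e) \<bullet> (h /\<^sub>R e))) (at x)"
    by (rule has_derivative_compose[OF _ bump_has_derivative]) (auto intro!: derivative_eq_intros)
  from has_derivative_mult_right[OF this, of "inverse (moll_mass TYPE('a) e)"] show ?thesis
    unfolding moll_def[abs_def] dmoll_def by (simp add: field_simps)
qed

lemma dmoll_lipschitz:
  assumes "e > 0"
  obtains L where "L \<ge> 0" "\<And>x y :: 'a::euclidean_space. norm (dmoll e x - dmoll e y) \<le> L * norm (x - y)"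
proof
  let ?c = "inverse (e * moll_mass TYPE('a) e)"
  have c: "?c > 0" using assms moll_mass_pos[where 'a='a, of e] by simp
  show "?c * (16 * inverse e) \<ge> 0" using c assms by simp
  fix x y :: 'a
  have "norm (dmoll e x - dmoll e y) = ?c * norm (dbump (x /\<^sub>R e) - dbump (y /\<^sub>R e))"
    using c by (simp add: dmoll_def scaleR_diff_right[symmetric] del: inverse_mult_distrib)
  also have "\<dots> \<le> ?c * (16 * norm (x /\<^sub>R e - y /\<^sub>R e))"
    using c by (intro mult_left_mono dbump_lipschitz) auto
  also have "x /\<^sub>R e - y /\<^sub>R e = (x - y) /\<^sub>R e" by (simp add: scaleR_diff_right)
  also have "16 * norm ((x - y) /\<^sub>R e) = 16 * inverse e * norm (x - y)" using assms by simp
  finally show "norm (dmoll e x - dmoll e y) \<le> ?c * (16 * inverse e) * norm (x - y)"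
    by (simp add: mult.assoc)
qed

text \<open>The field vanishes at the origin, so its Lipschitz constant controls it on the ball of
  radius \<open>e\<close>, and outside that ball it is zero.\<close>

lemma dmoll_bounded:
  assumes "e > 0" obtains B where "\<And>x :: 'a::euclidean_space. norm (dmoll e x) \<le> B"
proof -
  obtain L where L: "L \<ge> 0" "\<And>x y :: 'a. norm (dmoll e x - dmoll e y) \<le> L * norm (x - y)"
    using dmoll_lipschitz[OF assms] by blast
  have "norm (dmoll e x) \<le> L * e" for x :: 'a
  proof (cases "norm x \<ge> e")
    case True then show ?thesis using L assms by (simp add: dmoll_eq_0)
  next
    case False
    have "norm (dmoll e x) \<le> L * norm x" using L(2)[of x 0] by (simp add: dmoll_def dbump_def)
    also have "\<dots> \<le> L * e" using False L(1) by (intro mult_left_mono) auto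
    finally show ?thesis .
  qed
  then show ?thesis by (rule that)
qed

lemma moll_bounded:
  assumes "e > 0" obtains B where "\<And>x :: 'a::euclidean_space. \<bar>moll e x\<bar> \<le> B"
proof -
  have "\<bar>moll e x\<bar> \<le> 1 / moll_mass TYPE('a) e" for x :: 'a
  proof -
    have "max 0 (1 - (x /\<^sub>R e) \<bullet> (x /\<^sub>R e)) \<le> 1" 
      using inner_ge_zero[of "x /\<^sub>R e"] by linarith
    then have "bump (x /\<^sub>R e) \<le> 1" unfolding bump_def by (intro power_le_one) auto
    moreover have "bump (x /\<^sub>R e) \<ge> 0" by (simp add: bump_def)
    ultimately show ?thesis using moll_mass_pos[where 'a='a, OF assms]
      by (simp add: moll_def divide_right_mono)
  qed
  then show ?thesis by (rule that)
qed

text \<open>Mean value inequality along the segment, with the Lipschitz gradient. The constant is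
  independent of \<open>x\<close>, which is what lets the derivative pass under the convolution
  integral below.\<close>

lemma moll_linearization:
  assumes "e > 0"
  obtains L where "L \<ge> 0"
    "\<And>x h :: 'a::euclidean_space. \<bar>moll e (x + h) - moll e x - dmoll e x \<bullet> h\<bar> \<le> L * (norm h)\<^sup>2"
proof -
  obtain L where L: "L \<ge> 0" "\<And>x y :: 'a. norm (dmoll e x - dmoll e y) \<le> L * norm (x - y)"
    using dmoll_lipschitz[OF assms] by blast
  have "\<bar>moll e (x + h) - moll e x - dmoll e x \<bullet> h\<bar> \<le> L * (norm h)\<^sup>2" for x h :: 'a
  proof -
    have "norm (moll e (x + h) - moll e x - dmoll e x \<bullet> (x + h - x)) \<le> norm (x + h - x) * (L * norm h)"
    proof (rule differentiable_bound_linearization[where S = "closed_segment x (x + h)" and f' = "\<lambda>x h. dmoll e x \<bullet> h"])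
      fix t :: real assume "t \<in> {0..1}"
      then show "x + t *\<^sub>R (x + h - x) \<in> closed_segment x (x + h)"
        by (auto simp: in_segment algebra_simps intro!: exI[of _ t])
    next
      fix z show "(moll e has_derivative (\<bullet>) (dmoll e z)) (at z within closed_segment x (x + h))"
        using moll_has_derivative by (rule has_derivative_at_withinI)
    next
      fix z assume "z \<in> closed_segment x (x + h)"
      then obtain t where t: "0 \<le> t" "t \<le> 1" "z = (1 - t) *\<^sub>R x + t *\<^sub>R (x + h)" by (auto simp: in_segment)
      then have "z - x = t *\<^sub>R h" by (simp add: algebra_simps)
      then have zx: "norm (z - x) \<le> norm h" using t by (simp add: mult_left_le_one_le)
      show "onorm ((\<bullet>) (dmoll e z) - (\<bullet>) (dmoll e x)) \<le> L * norm h"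
      proof (rule onorm_le)
        fix k
        have "norm (((\<bullet>) (dmoll e z) - (\<bullet>) (dmoll e x)) k) = \<bar>(dmoll e z - dmoll e x) \<bullet> k\<bar>"
          by (simp add: inner_diff_left)
        also have "\<dots> \<le> norm (dmoll e z - dmoll e x) * norm k" by (rule Cauchy_Schwarz_ineq2)
        also have "\<dots> \<le> L * norm h * norm k"
          using L(2)[of z x] mult_left_mono[OF zx L(1)] by (intro mult_right_mono) auto
        finally show "norm (((\<bullet>) (dmoll e z) - (\<bullet>) (dmoll e x)) k) \<le> L * norm h * norm k" .
      qed
    qed simp
    then show ?thesis by (simp add: power2_eq_square mult_ac)
  qed
  then show ?thesis using that L(1) by blast
qed

section \<open>Convolution with the mollifier\<close>

lemma integrable_pair_product_bound:
  fixes f :: "'a::euclidean_space \<Rightarrow> 'b::{banach,second_countable_topology}"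
    and g :: "'a \<Rightarrow> 'c::{banach,second_countable_topology}"
    and F :: "'a \<times> 'a \<Rightarrow> 'd::{banach,second_countable_topology}"
  assumes f: "integrable lborel f" and g: "integrable lborel g"
    and F: "F \<in> borel_measurable (lborel \<Otimes>\<^sub>M lborel)"
    and bd: "\<And>x y. norm (F (x, y)) \<le> B * norm (f x) * norm (g y)"
  shows "integrable (lborel \<Otimes>\<^sub>M lborel) F"
proof -
  have [measurable]: "f \<in> borel_measurable borel" "g \<in> borel_measurable borel"
    using f g by (auto dest: borel_measurable_integrable)
  have "integrable (lborel \<Otimes>\<^sub>M lborel) (\<lambda>p. norm (f (fst p)) * norm (g (snd p)))"
    by (rule lborel_pair.Fubini_integrable) (use f g in auto)
  then have "integrable (lborel \<Otimes>\<^sub>M lborel) (\<lambda>p. B * (norm (f (fst p)) * norm (g (snd p))))"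
    by (rule integrable_mult_right)
  then show ?thesis
  proof (rule Bochner_Integration.integrable_bound[OF _ F], intro AE_I2)
    fix p :: "'a \<times> 'a"
    obtain x y where p: "p = (x, y)" by fastforce
    show "norm (F p) \<le> norm (B * (norm (f (fst p)) * norm (g (snd p))))"
      unfolding p using order_trans[OF bd[of x y] abs_ge_self] by (simp add: mult.assoc)
  qed
qed

text \<open>The L1 case of Young's inequality: by translation invariance the integral of
  \<open>norm (K (x - y))\<close> over \<open>x\<close> does not depend on \<open>y\<close>. The
  pair is ordered \<open>(y, x)\<close> so that \<open>integrable_snd\<close> yields integrability
  of the convolution in \<open>x\<close>.\<close>

lemma integrable_pair_convolution_bound:
  fixes f :: "'a::euclidean_space \<Rightarrow> 'b::{banach,second_countable_topology}"
    and K :: "'a \<Rightarrow> 'c::{banach,second_countable_topology}"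
    and F :: "'a \<times> 'a \<Rightarrow> 'd::{banach,second_countable_topology}"
  assumes f: "integrable lborel f" and K: "integrable lborel K"
    and F: "F \<in> borel_measurable (lborel \<Otimes>\<^sub>M lborel)"
    and bd: "\<And>x y. norm (F (y, x)) \<le> norm (f y) * norm (K (x - y))"
  shows "integrable (lborel \<Otimes>\<^sub>M lborel) F"
proof -
  have [measurable]: "f \<in> borel_measurable borel" "K \<in> borel_measurable borel"
    using f K by (auto dest: borel_measurable_integrable)
  have iK: "integrable lborel (\<lambda>x. K (x - y))" for y by (rule integrable_translate[OF K])
  have eq: "(\<integral>x. norm (K (x - y)) \<partial>lborel) = (\<integral>x. norm (K x) \<partial>lborel)" for y
    by (rule integral_translate[where f = "\<lambda>x. norm (K x)"]) simp
  have "integrable (lborel \<Otimes>\<^sub>M lborel) (\<lambda>p. norm (f (fst p)) * norm (K (snd p - fst p)))"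
    by (rule lborel_pair.Fubini_integrable) (use f iK in \<open>auto simp: eq\<close>)
  then show ?thesis
  proof (rule Bochner_Integration.integrable_bound[OF _ F], intro AE_I2)
    fix p :: "'a \<times> 'a"
    obtain x y where p: "p = (x, y)" by fastforce
    show "norm (F p) \<le> norm (norm (f (fst p)) * norm (K (snd p - fst p)))"
      unfolding p using bd[of x y] by simp
  qed
qed

text \<open>Vector-valued, so that one operator serves the pieces of \<open>u\<close>, the fields
  \<open>u x *\<^sub>R d\<psi> x\<close> and the sign fields used for testing.\<close>

definition mconv :: "real \<Rightarrow> ('a::euclidean_space \<Rightarrow> 'b::{banach,second_countable_topology}) \<Rightarrow> 'a \<Rightarrow> 'b" where
  "mconv e f x = (\<integral>y. moll e (x - y) *\<^sub>R f y \<partial>lborel)"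

definition dmconv :: "real \<Rightarrow> ('a::euclidean_space \<Rightarrow> real) \<Rightarrow> 'a \<Rightarrow> 'a" where
  "dmconv e f x = (\<integral>y. f y *\<^sub>R dmoll e (x - y) \<partial>lborel)"

lemma integrable_bounded_scaleR:
  fixes f :: "'a \<Rightarrow> 'b::{banach,second_countable_topology}" and k :: "'a \<Rightarrow> real"
  assumes f: "integrable M f" and k: "k \<in> borel_measurable M" "\<And>x. \<bar>k x\<bar> \<le> B"
  shows "integrable M (\<lambda>x. k x *\<^sub>R f x)"
proof -
  have "integrable M (\<lambda>x. B *\<^sub>R f x)" using f by simp
  then show ?thesis
  proof (rule Bochner_Integration.integrable_bound)
    show "(\<lambda>x. k x *\<^sub>R f x) \<in> borel_measurable M" using f k by (auto dest: borel_measurable_integrable)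
    show "AE x in M. norm (k x *\<^sub>R f x) \<le> norm (B *\<^sub>R f x)"
    proof (rule AE_I2)
      fix x show "norm (k x *\<^sub>R f x) \<le> norm (B *\<^sub>R f x)"
        using k(2)[of x] by (auto intro!: mult_right_mono)
    qed
  qed
qed

lemma integrable_bounded_inner:
  fixes f k :: "'a \<Rightarrow> 'b::euclidean_space"
  assumes f: "integrable M f" and k: "k \<in> borel_measurable M" "\<And>x. norm (k x) \<le> B"
  shows "integrable M (\<lambda>x. k x \<bullet> f x)"
proof -
  have "integrable M (\<lambda>x. B * norm (f x))" using f by simp
  then show ?thesis
  proof (rule Bochner_Integration.integrable_bound)
    show "(\<lambda>x. k x \<bullet> f x) \<in> borel_measurable M" using f k by (auto dest: borel_measurable_integrable)
    show "AE x in M. norm (k x \<bullet> f x) \<le> norm (B * norm (f x))"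
    proof (rule AE_I2)
      fix x
      have "\<bar>k x \<bullet> f x\<bar> \<le> norm (k x) * norm (f x)" by (rule Cauchy_Schwarz_ineq2)
      also have "\<dots> \<le> B * norm (f x)" using k(2)[of x] by (intro mult_right_mono) auto
      finally show "norm (k x \<bullet> f x) \<le> norm (B * norm (f x))" by simp
    qed
  qed
qed

lemma integrable_moll_scaleR:
  fixes f :: "'a::euclidean_space \<Rightarrow> 'b::{banach,second_countable_topology}"
  assumes "e > 0" "integrable lborel f"
  shows "integrable lborel (\<lambda>y. moll e (x - y) *\<^sub>R f y)"
proof -
  obtain B where "\<And>x::'a. \<bar>moll e x\<bar> \<le> B" using moll_bounded[OF assms(1)] by blast
  then show ?thesis by (intro integrable_bounded_scaleR[OF assms(2), of _ B]) auto
qed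

lemma integrable_dmoll_inner_scaleR:
  fixes f :: "'a::euclidean_space \<Rightarrow> 'b::{banach,second_countable_topology}"
  assumes "e > 0" "integrable lborel f"
  shows "integrable lborel (\<lambda>y. (dmoll e (x - y) \<bullet> h) *\<^sub>R f y)"
proof -
  obtain B where B: "\<And>x::'a. norm (dmoll e x) \<le> B" using dmoll_bounded[OF assms(1)] by blast
  have "\<bar>dmoll e z \<bullet> h\<bar> \<le> B * norm h" for z
    using Cauchy_Schwarz_ineq2[of "dmoll e z" h] mult_right_mono[OF B[of z] norm_ge_zero[of h]] by linarith
  then show ?thesis by (intro integrable_bounded_scaleR[OF assms(2), of _ "B * norm h"]) auto
qed

lemma integrable_scaleR_dmoll:
  fixes f :: "'a::euclidean_space \<Rightarrow> real"
  assumes "e > 0" "integrable lborel f"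
  shows "integrable lborel (\<lambda>y. f y *\<^sub>R dmoll e (x - y))"
proof -
  obtain B where B: "\<And>x::'a. norm (dmoll e x) \<le> B" using dmoll_bounded[OF assms(1)] by blast
  have "integrable lborel (\<lambda>y. B * f y)" using assms by simp
  then show ?thesis
  proof (rule Bochner_Integration.integrable_bound)
    show "(\<lambda>y. f y *\<^sub>R dmoll e (x - y)) \<in> borel_measurable lborel"
      using borel_measurable_integrable[OF assms(2)] by auto
    show "AE y in lborel. norm (f y *\<^sub>R dmoll e (x - y)) \<le> norm (B * f y)"
    proof (rule AE_I2)
      fix y show "norm (f y *\<^sub>R dmoll e (x - y)) \<le> norm (B * f y)"
        using mult_right_mono[OF order_trans[OF B[of "x - y"] abs_ge_self], of "\<bar>f y\<bar>"]
        by (simp add: abs_mult mult.commute)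
    qed
  qed
qed

text \<open>The quadratic remainder of the kernel is uniform in \<open>y\<close>; integrated against
  \<open>norm (f y)\<close> it remains a quadratic remainder. Hence \<open>f\<close> need only be in
  L1.\<close>

lemma mconv_has_derivative:
  fixes f :: "'a::euclidean_space \<Rightarrow> 'b::{banach,second_countable_topology}"
  assumes e: "e > 0" and f: "integrable lborel f"
  shows "(mconv e f has_derivative (\<lambda>h. \<integral>y. (dmoll e (x - y) \<bullet> h) *\<^sub>R f y \<partial>lborel)) (at x)"
proof -
  note iD = integrable_dmoll_inner_scaleR[OF e f]
  note iM = integrable_moll_scaleR[OF e f]
  obtain B where B: "\<And>x::'a. norm (dmoll e x) \<le> B" using dmoll_bounded[OF e] by blast
  obtain L where L: "L \<ge> 0"
    "\<And>x h :: 'a. \<bar>moll e (x + h) - moll e x - dmoll e x \<bullet> h\<bar> \<le> L * (norm h)\<^sup>2"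
    using moll_linearization[OF e] by blast
  show ?thesis
  proof (rule has_derivative_of_quadratic_bound[where C = "L * (\<integral>y. norm (f y) \<partial>lborel)"])
    show "bounded_linear (\<lambda>h. \<integral>y. (dmoll e (x - y) \<bullet> h) *\<^sub>R f y \<partial>lborel)"
    proof (rule bounded_linear_intro)
      fix h k show "(\<integral>y. (dmoll e (x - y) \<bullet> (h + k)) *\<^sub>R f y \<partial>lborel) =
         (\<integral>y. (dmoll e (x - y) \<bullet> h) *\<^sub>R f y \<partial>lborel) + (\<integral>y. (dmoll e (x - y) \<bullet> k) *\<^sub>R f y \<partial>lborel)"
        using iD by (simp add: inner_add_right scaleR_add_left)
    next
      fix r h show "(\<integral>y. (dmoll e (x - y) \<bullet> (r *\<^sub>R h)) *\<^sub>R f y \<partial>lborel) =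
         r *\<^sub>R (\<integral>y. (dmoll e (x - y) \<bullet> h) *\<^sub>R f y \<partial>lborel)"
        by (simp flip: scaleR_scaleR integral_scaleR_right)
    next
      fix h
      have "norm (\<integral>y. (dmoll e (x - y) \<bullet> h) *\<^sub>R f y \<partial>lborel) \<le> (\<integral>y. B * norm h * norm (f y) \<partial>lborel)"
      proof (rule Bochner_Integration.integral_norm_bound_integral)
        show "integrable lborel (\<lambda>y. B * norm h * norm (f y))" using f by simp
        fix y
        have "\<bar>dmoll e (x - y) \<bullet> h\<bar> \<le> B * norm h"
          using Cauchy_Schwarz_ineq2[of "dmoll e (x - y)" h]
            mult_right_mono[OF B[of "x - y"] norm_ge_zero[of h]] by linarith
        then show "norm ((dmoll e (x - y) \<bullet> h) *\<^sub>R f y) \<le> B * norm h * norm (f y)"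
          by (simp add: mult_right_mono)
      qed (rule iD)
      then show "norm (\<integral>y. (dmoll e (x - y) \<bullet> h) *\<^sub>R f y \<partial>lborel) \<le> norm h * (B * (\<integral>y. norm (f y) \<partial>lborel))"
        by (simp add: mult_ac)
    qed
    fix h
    have "mconv e f (x + h) - mconv e f x - (\<integral>y. (dmoll e (x - y) \<bullet> h) *\<^sub>R f y \<partial>lborel) =
      (\<integral>y. (moll e ((x - y) + h) - moll e (x - y) - dmoll e (x - y) \<bullet> h) *\<^sub>R f y \<partial>lborel)"
      using iM[of x] iM[of "x + h"] iD[of x h] unfolding mconv_def
      by (simp add: scaleR_diff_left algebra_simps)
    also have "norm \<dots> \<le> (\<integral>y. L * (norm h)\<^sup>2 * norm (f y) \<partial>lborel)"
    proof (rule Bochner_Integration.integral_norm_bound_integral)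
      show "integrable lborel (\<lambda>y. (moll e ((x - y) + h) - moll e (x - y) - dmoll e (x - y) \<bullet> h) *\<^sub>R f y)"
        using iM[of x] iM[of "x + h"] iD[of x h] by (simp add: scaleR_diff_left algebra_simps)
      show "integrable lborel (\<lambda>y. L * (norm h)\<^sup>2 * norm (f y))" using f by simp
      fix y show "norm ((moll e ((x - y) + h) - moll e (x - y) - dmoll e (x - y) \<bullet> h) *\<^sub>R f y)
          \<le> L * (norm h)\<^sup>2 * norm (f y)"
        using L(2)[of "x - y" h] by (simp add: mult_right_mono)
    qed
    finally show "norm (mconv e f (x + h) - mconv e f x - (\<integral>y. (dmoll e (x - y) \<bullet> h) *\<^sub>R f y \<partial>lborel))
        \<le> L * (\<integral>y. norm (f y) \<partial>lborel) * (norm h)\<^sup>2"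
      by (simp add: mult_ac)
  qed
qed

lemma continuous_on_mconv_derivative:
  fixes f :: "'a::euclidean_space \<Rightarrow> 'b::{banach,second_countable_topology}"
  assumes e: "e > 0" and f: "integrable lborel f"
  shows "continuous_on UNIV (\<lambda>x. \<integral>y. (dmoll e (x - y) \<bullet> h) *\<^sub>R f y \<partial>lborel)"
proof -
  note iD = integrable_dmoll_inner_scaleR[OF e f]
  obtain L where L: "L \<ge> 0" "\<And>x y :: 'a. norm (dmoll e x - dmoll e y) \<le> L * norm (x - y)"
    using dmoll_lipschitz[OF e] by blast
  have "(L * norm h * (\<integral>y. norm (f y) \<partial>lborel))-lipschitz_on UNIV
     (\<lambda>x. \<integral>y. (dmoll e (x - y) \<bullet> h) *\<^sub>R f y \<partial>lborel)"
  proof (rule lipschitz_onI)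
    fix x z :: 'a
    have "(\<integral>y. (dmoll e (x - y) \<bullet> h) *\<^sub>R f y \<partial>lborel) - (\<integral>y. (dmoll e (z - y) \<bullet> h) *\<^sub>R f y \<partial>lborel)
      = (\<integral>y. ((dmoll e (x - y) - dmoll e (z - y)) \<bullet> h) *\<^sub>R f y \<partial>lborel)"
      using iD by (simp add: inner_diff_left scaleR_diff_left)
    also have "norm \<dots> \<le> (\<integral>y. L * norm (x - z) * norm h * norm (f y) \<partial>lborel)"
    proof (rule Bochner_Integration.integral_norm_bound_integral)
      show "integrable lborel (\<lambda>y. ((dmoll e (x - y) - dmoll e (z - y)) \<bullet> h) *\<^sub>R f y)"
        using iD by (simp add: inner_diff_left scaleR_diff_left)
      show "integrable lborel (\<lambda>y. L * norm (x - z) * norm h * norm (f y))" using f by simp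
      fix y
      have "\<bar>(dmoll e (x - y) - dmoll e (z - y)) \<bullet> h\<bar> \<le> norm (dmoll e (x - y) - dmoll e (z - y)) * norm h"
        by (rule Cauchy_Schwarz_ineq2)
      also have "\<dots> \<le> L * norm (x - z) * norm h"
        using L(2)[of "x - y" "z - y"] by (intro mult_right_mono) auto
      finally show "norm (((dmoll e (x - y) - dmoll e (z - y)) \<bullet> h) *\<^sub>R f y) \<le> L * norm (x - z) * norm h * norm (f y)"
        by (simp add: mult_right_mono)
    qed
    finally show "dist (\<integral>y. (dmoll e (x - y) \<bullet> h) *\<^sub>R f y \<partial>lborel) (\<integral>y. (dmoll e (z - y) \<bullet> h) *\<^sub>R f y \<partial>lborel)
      \<le> L * norm h * (\<integral>y. norm (f y) \<partial>lborel) * dist x z"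
      by (simp add: dist_norm mult_ac)
  qed (use L in auto)
  then show ?thesis by (rule lipschitz_on_continuous_on)
qed

lemma dmconv_inner:
  assumes "e > 0" "integrable lborel f"
  shows "dmconv e f x \<bullet> h = (\<integral>y. (dmoll e (x - y) \<bullet> h) *\<^sub>R f y \<partial>lborel)"
  using integral_inner_left[of h lborel "\<lambda>y. f y *\<^sub>R dmoll e (x - y)"] integrable_scaleR_dmoll[OF assms, of x]
  unfolding dmconv_def by (simp add: mult.commute)

lemma borel_measurable_mconv [measurable]:
  assumes [measurable]: "f \<in> borel_measurable borel"
  shows "mconv e f \<in> borel_measurable borel"
proof -
  have "(\<lambda>x. mconv e f x) \<in> borel_measurable lborel"
    unfolding mconv_def by (rule lborel.borel_measurable_lebesgue_integral) measurable
  then show ?thesis by simp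
qed

lemma borel_measurable_dmconv [measurable]:
  assumes [measurable]: "f \<in> borel_measurable borel"
  shows "dmconv e f \<in> borel_measurable borel"
proof -
  have "(\<lambda>x. dmconv e f x) \<in> borel_measurable lborel"
    unfolding dmconv_def by (rule lborel.borel_measurable_lebesgue_integral) measurable
  then show ?thesis by simp
qed

lemma integrable_mconv:
  fixes f :: "'a::euclidean_space \<Rightarrow> 'b::{banach,second_countable_topology}"
  assumes e: "e > 0" and f: "integrable lborel f"
  shows "integrable lborel (mconv e f)"
proof -
  have [measurable]: "f \<in> borel_measurable borel" using f by (auto dest: borel_measurable_integrable)
  have "integrable (lborel \<Otimes>\<^sub>M lborel) (\<lambda>(y, x). moll e (x - y) *\<^sub>R f y)"
    by (rule integrable_pair_convolution_bound[OF f integrable_moll[OF e]]) (auto simp: mult.commute)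
  from lborel_pair.integrable_snd[OF this] show ?thesis by (simp add: mconv_def[abs_def])
qed

lemma integrable_dmconv:
  fixes f :: "'a::euclidean_space \<Rightarrow> real"
  assumes e: "e > 0" and f: "integrable lborel f"
  shows "integrable lborel (dmconv e f)"
proof -
  have [measurable]: "f \<in> borel_measurable borel" using f by (auto dest: borel_measurable_integrable)
  have "integrable (lborel \<Otimes>\<^sub>M lborel) (\<lambda>(y, x). f y *\<^sub>R dmoll e (x - y))"
    by (rule integrable_pair_convolution_bound[OF f integrable_dmoll[OF e]]) auto
  from lborel_pair.integrable_snd[OF this] show ?thesis by (simp add: dmconv_def[abs_def])
qed

text \<open>Mollification is averaging, as \<open>moll e\<close> is nonnegative with mass one.
  Mollified sign fields therefore keep the unit bound demanded of test fields.\<close>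

lemma norm_mconv_le:
  fixes f :: "'a::euclidean_space \<Rightarrow> 'b::{banach,second_countable_topology}"
  assumes e: "e > 0" and f: "integrable lborel f" and bd: "\<And>x. norm (f x) \<le> B"
  shows "norm (mconv e f x) \<le> B"
proof -
  have iM: "integrable lborel (\<lambda>y. moll e (x - y))"
    by (rule integrable_reflect_translate[OF integrable_moll[OF e]])
  have "norm (mconv e f x) \<le> (\<integral>y. moll e (x - y) * B \<partial>lborel)"
    unfolding mconv_def
  proof (rule Bochner_Integration.integral_norm_bound_integral[OF integrable_moll_scaleR[OF e f]])
    show "integrable lborel (\<lambda>y. moll e (x - y) * B)" using iM by simp
    fix y show "norm (moll e (x - y) *\<^sub>R f y) \<le> moll e (x - y) * B"
      using bd[of y] moll_nonneg[OF e, of "x - y"] by (simp add: mult_left_mono)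
  qed
  also have "\<dots> = (\<integral>y. moll e (x - y) \<partial>lborel) * B" by simp
  also have "(\<integral>y. moll e (x - y) \<partial>lborel) = 1"
    using integral_reflect_translate[of "moll e" x] integral_moll[OF e, where 'a='a] by simp
  finally show ?thesis by simp
qed

text \<open>Fubini together with the evenness of the kernel.\<close>

lemma mconv_adjoint:
  fixes f g :: "'a::euclidean_space \<Rightarrow> 'b::euclidean_space"
  assumes e: "e > 0" and f: "integrable lborel f" and g: "integrable lborel g"
  shows "(\<integral>x. mconv e f x \<bullet> g x \<partial>lborel) = (\<integral>x. f x \<bullet> mconv e g x \<partial>lborel)"
proof -
  have [measurable]: "f \<in> borel_measurable borel" "g \<in> borel_measurable borel"
    using f g by (auto dest: borel_measurable_integrable)
  obtain B where B: "\<And>x::'a. \<bar>moll e x\<bar> \<le> B" using moll_bounded[OF e] by blast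
  have int: "integrable (lborel \<Otimes>\<^sub>M lborel) (\<lambda>(x, y). moll e (x - y) *\<^sub>R f y \<bullet> g x)"
  proof (rule integrable_pair_product_bound[OF g f])
    fix x y
    have "\<bar>f y \<bullet> g x\<bar> \<le> norm (g x) * norm (f y)" 
      using Cauchy_Schwarz_ineq2[of "f y" "g x"] by (simp add: mult.commute)
    then have "\<bar>moll e (x - y)\<bar> * \<bar>f y \<bullet> g x\<bar> \<le> B * (norm (g x) * norm (f y))"
      using B[of "x - y"] by (intro mult_mono) auto
    then show "norm (case (x, y) of (x, y) \<Rightarrow> moll e (x - y) *\<^sub>R f y \<bullet> g x) \<le> B * norm (g x) * norm (f y)"
      by (simp add: abs_mult mult.assoc)
  qed measurable
  have "(\<integral>x. mconv e f x \<bullet> g x \<partial>lborel) = (\<integral>x. (\<integral>y. moll e (x - y) *\<^sub>R f y \<bullet> g x \<partial>lborel) \<partial>lborel)"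
    unfolding mconv_def using integral_inner_left[OF integrable_moll_scaleR[OF e f]]
    by (intro Bochner_Integration.integral_cong refl) (metis)
  also have "\<dots> = (\<integral>y. (\<integral>x. moll e (x - y) *\<^sub>R f y \<bullet> g x \<partial>lborel) \<partial>lborel)"
    by (rule lborel_pair.Fubini_integral[OF int, symmetric])
  also have "\<dots> = (\<integral>y. f y \<bullet> mconv e g y \<partial>lborel)"
  proof (intro Bochner_Integration.integral_cong refl)
    fix y
    have "(\<integral>x. moll e (x - y) *\<^sub>R f y \<bullet> g x \<partial>lborel) = (\<integral>x. f y \<bullet> moll e (y - x) *\<^sub>R g x \<partial>lborel)"
      using moll_minus[of e] by (metis (no_types, lifting) inner_scaleR_left inner_scaleR_right minus_diff_eq)
    also have "\<dots> = f y \<bullet> mconv e g y"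
      unfolding mconv_def by (rule integral_inner_right) (use integrable_moll_scaleR[OF e g] in blast)
    finally show "(\<integral>x. moll e (x - y) *\<^sub>R f y \<bullet> g x \<partial>lborel) = f y \<bullet> mconv e g y" .
  qed
  finally show ?thesis .
qed

text \<open>The error \<open>mconv e f x - f x\<close> is an average of translation errors
  \<open>f (x - z) - f x\<close> with \<open>norm z < e\<close>, and each of these is small in L1 by
  continuity of translation.\<close>

lemma mconv_L1_approx:
  fixes f :: "'a::euclidean_space \<Rightarrow> 'b::{banach,second_countable_topology}"
  assumes f: "integrable lborel f" and "\<delta> > 0"
  obtains d where "d > 0" "\<And>e. 0 < e \<Longrightarrow> e < d \<Longrightarrow> (\<integral>x. norm (mconv e f x - f x) \<partial>lborel) \<le> \<delta>"
proof -
  obtain d where d: "d > 0" "\<And>h. norm h < d \<Longrightarrow> (\<integral>x. norm (f (x - h) - f x) \<partial>lborel) < \<delta>"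
    using integrable_imp_L1_translation_continuous[OF f] \<open>\<delta> > 0\<close>
    unfolding L1_translation_continuous_def by blast
  have [measurable]: "f \<in> borel_measurable borel" using f by (auto dest: borel_measurable_integrable)
  have "(\<integral>x. norm (mconv e f x - f x) \<partial>lborel) \<le> \<delta>" if e: "0 < e" "e < d" for e
  proof -
    have iM: "integrable lborel (\<lambda>z. moll e z *\<^sub>R f (x - z))" for x
      using integrable_reflect_translate[OF integrable_moll_scaleR[OF e(1) f, of x], of x] by simp
    have iM2: "integrable lborel (\<lambda>z::'a. moll e z *\<^sub>R f x)" for x
      using integrable_moll[OF e(1)] by (rule integrable_scaleR_left)
    have eq: "mconv e f x - f x = (\<integral>z. moll e z *\<^sub>R (f (x - z) - f x) \<partial>lborel)" for x
    proof -
      have "mconv e f x = (\<integral>z. moll e (x - (x - z)) *\<^sub>R f (x - z) \<partial>lborel)"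
        unfolding mconv_def by (rule integral_reflect_translate[symmetric]) measurable
      moreover have "f x = (\<integral>z. moll e (z::'a) *\<^sub>R f x \<partial>lborel)"
        using integral_scaleR_left[of "f x" lborel "moll e :: 'a \<Rightarrow> real"] integral_moll[OF e(1), where 'a='a]
          integrable_moll[OF e(1), where 'a='a] by simp
      ultimately show ?thesis using iM iM2 by (simp add: scaleR_diff_right)
    qed
    \<comment> \<open>With nonnegative integrals the order of integration can be exchanged on the
      strength of measurability alone.\<close>
    have "(\<integral>\<^sup>+x. ennreal (norm (mconv e f x - f x)) \<partial>lborel) \<le>
        (\<integral>\<^sup>+x. (\<integral>\<^sup>+z. ennreal (norm (moll e z *\<^sub>R (f (x - z) - f x))) \<partial>lborel) \<partial>lborel)"
      unfolding eq by (intro nn_integral_mono integral_norm_bound_ennreal)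
        (use iM iM2 in \<open>simp add: scaleR_diff_right\<close>)
    also have "\<dots> = (\<integral>\<^sup>+z. (\<integral>\<^sup>+x. ennreal (norm (moll e z *\<^sub>R (f (x - z) - f x))) \<partial>lborel) \<partial>lborel)"
      by (rule lborel_pair.Fubini') measurable
    also have "\<dots> \<le> (\<integral>\<^sup>+z. ennreal (moll e (z::'a) * \<delta>) \<partial>lborel)"
    proof (rule nn_integral_mono)
      fix z :: 'a
      have int: "integrable lborel (\<lambda>x. norm (moll e z *\<^sub>R (f (x - z) - f x)))"
        using integrable_translate[OF f, of z] f by simp
      have "(\<integral>\<^sup>+x. ennreal (norm (moll e z *\<^sub>R (f (x - z) - f x))) \<partial>lborel) =
         ennreal (\<integral>x. norm (moll e z *\<^sub>R (f (x - z) - f x)) \<partial>lborel)"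
        by (rule nn_integral_eq_integral[OF int]) simp
      also have "(\<integral>x. norm (moll e z *\<^sub>R (f (x - z) - f x)) \<partial>lborel) =
          moll e z * (\<integral>x. norm (f (x - z) - f x) \<partial>lborel)"
        using moll_nonneg[OF e(1), of z] by simp
      also have "\<dots> \<le> moll e z * \<delta>"
      proof (cases "norm z < d")
        case True
        then show ?thesis using d(2)[OF True] moll_nonneg[OF e(1), of z] by (intro mult_left_mono) auto
      next
        case False
        then show ?thesis using moll_eq_0[of e z] e by simp
      qed
      finally show "(\<integral>\<^sup>+x. ennreal (norm (moll e z *\<^sub>R (f (x - z) - f x))) \<partial>lborel) \<le> ennreal (moll e z * \<delta>)"
        by (simp add: ennreal_leI)
    qed
    also have "\<dots> = ennreal (\<integral>z. moll e (z::'a) * \<delta> \<partial>lborel)"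
      using \<open>\<delta> > 0\<close> integrable_moll[OF e(1), where 'a='a] moll_nonneg[OF e(1), where 'a='a]
      by (intro nn_integral_eq_integral) auto
    also have "(\<integral>z. moll e (z::'a) * \<delta> \<partial>lborel) = \<delta>"
      using integral_moll[OF e(1), where 'a='a] by simp
    finally have "(\<integral>\<^sup>+x. ennreal (norm (mconv e f x - f x)) \<partial>lborel) \<le> ennreal \<delta>" .
    moreover have "integrable lborel (\<lambda>x. norm (mconv e f x - f x))"
      using integrable_mconv[OF e(1) f] f by simp
    ultimately show ?thesis using \<open>\<delta> > 0\<close>
      by (simp add: nn_integral_eq_integral)
  qed
  with d(1) show ?thesis by (rule that)
qed

section \<open>Test fields, integration by parts and cutoffs\<close>

text \<open>The regularity clause of \<open>C1c\<close> without its support clause: mollified fields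
  and constant fields become test fields in \<Omega> only after multiplication by a cutoff.\<close>

definition C1_field :: "('a::euclidean_space \<Rightarrow> 'a) \<Rightarrow> bool" where
  "C1_field \<phi> \<longleftrightarrow> (\<exists>D. (\<forall>x. (\<phi> has_derivative D x) (at x)) \<and> (\<forall>v. continuous_on UNIV (\<lambda>x. D x v)))"

definition C1_grad :: "('a::euclidean_space \<Rightarrow> real) \<Rightarrow> ('a \<Rightarrow> 'a) \<Rightarrow> bool" where
  "C1_grad \<psi> g \<longleftrightarrow> (\<forall>x. (\<psi> has_derivative (\<lambda>h. g x \<bullet> h)) (at x)) \<and> continuous_on UNIV g"

lemma C1c_iff:
  "\<phi> \<in> C1c \<Omega> \<longleftrightarrow> C1_field \<phi> \<and> compact (closure {x. \<phi> x \<noteq> 0}) \<and> closure {x. \<phi> x \<noteq> 0} \<subseteq> \<Omega>"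
  by (simp add: C1c_def C1_field_def)

lemma C1c_mono: "\<Omega> \<subseteq> \<Omega>' \<Longrightarrow> C1c \<Omega> \<subseteq> C1c \<Omega>'"
  unfolding C1c_iff subset_iff by blast

lemma divergence_eq:
  "(\<phi> has_derivative D) (at x) \<Longrightarrow> divergence \<phi> x = (\<Sum>b\<in>Basis. D b \<bullet> b)"
  by (simp add: divergence_def frechet_derivative_at[symmetric])

lemma C1_field_continuous: "C1_field \<phi> \<Longrightarrow> continuous_on UNIV \<phi>"
  unfolding C1_field_def by (auto intro!: continuous_at_imp_continuous_on dest: has_derivative_continuous)

lemma C1_grad_continuous: "C1_grad \<psi> g \<Longrightarrow> continuous_on UNIV \<psi>"
  unfolding C1_grad_def by (auto intro!: continuous_at_imp_continuous_on dest: has_derivative_continuous)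

lemma C1_field_divergence_continuous: "C1_field \<phi> \<Longrightarrow> continuous_on UNIV (divergence \<phi>)"
proof -
  assume "C1_field \<phi>"
  then obtain D where D: "\<And>x. (\<phi> has_derivative D x) (at x)" "\<And>v. continuous_on UNIV (\<lambda>x. D x v)"
    unfolding C1_field_def by auto
  have "divergence \<phi> = (\<lambda>x. \<Sum>b\<in>Basis. D x b \<bullet> b)" using divergence_eq[OF D(1)] by auto
  then show ?thesis by (auto intro!: continuous_intros D(2))
qed

lemma C1_field_borel:
  assumes "C1_field \<phi>"
  shows "\<phi> \<in> borel_measurable borel" "divergence \<phi> \<in> borel_measurable borel"
  using assms by (simp_all add: borel_measurable_continuous_onI C1_field_continuous C1_field_divergence_continuous)

lemma bounded_of_compact_support:
  fixes f :: "'a::euclidean_space \<Rightarrow> 'b::real_normed_vector"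
  assumes "continuous_on UNIV f" "\<And>x. norm x \<ge> R \<Longrightarrow> f x = 0"
  obtains B where "B \<ge> 0" "\<And>x. norm (f x) \<le> B"
proof -
  have "bounded (f ` cball 0 R)"
    by (intro compact_imp_bounded compact_continuous_image) (use assms(1) continuous_on_subset[of UNIV f] in auto)
  then obtain B where B: "B > 0" "\<And>x. x \<in> cball 0 R \<Longrightarrow> norm (f x) \<le> B" unfolding bounded_pos by auto
  have "norm (f x) \<le> B" for x
    using B assms(2)[of x] by (cases "norm x \<ge> R") auto
  with B(1) show ?thesis using that[of B] by auto
qed

lemma C1c_support_ball:
  assumes "\<phi> \<in> C1c \<Omega>" obtains R where "R > 0" "\<And>x. norm x \<ge> R \<Longrightarrow> \<phi> x = 0"
proof -
  define S where "S = {x. \<phi> x \<noteq> 0}"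
  have "bounded (closure S)" using assms unfolding C1c_iff S_def by (blast intro: compact_imp_bounded)
  then obtain R where R: "R > 0" "\<forall>x\<in>closure S. norm x \<le> R" unfolding bounded_pos by blast
  have "\<phi> x = 0" if "norm x \<ge> R + 1" for x
  proof (rule ccontr)
    assume "\<phi> x \<noteq> 0"
    then have "x \<in> closure S" using closure_subset[of S] by (simp add: S_def subset_iff)
    with R(2) have "norm x \<le> R" by (rule bspec)
    then show False using that by simp
  qed
  then show ?thesis using that[of "R + 1"] R(1) by simp
qed

text \<open>The unit margin leaves a whole ball around \<open>x\<close> on which \<phi>
  vanishes.\<close>

lemma derivative_eq_0_of_support:
  fixes \<phi> :: "'a::euclidean_space \<Rightarrow> 'b::real_normed_vector"
  assumes z: "\<And>x. norm x \<ge> R \<Longrightarrow> \<phi> x = 0" and D: "(\<phi> has_derivative D) (at x)" and x: "norm x \<ge> R + 1"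
  shows "D = (\<lambda>h. 0)"
proof -
  have "((\<lambda>x. 0) has_derivative (\<lambda>h. 0)) (at x)" by simp
  then have "(\<phi> has_derivative (\<lambda>h. 0)) (at x)"
  proof (rule has_derivative_transform_within_open[where s = "ball x 1"])
    fix y assume "y \<in> ball x 1"
    then have "norm y \<ge> R" using x norm_triangle_ineq2[of x y] by (simp add: dist_norm)
    then show "0 = \<phi> y" using z by simp
  qed auto
  then show ?thesis using D has_derivative_unique by blast
qed

lemma C1c_bounds:
  assumes "\<phi> \<in> C1c \<Omega>"
  obtains B where "B \<ge> 0" "\<And>x. norm (\<phi> x) \<le> B" "\<And>x. \<bar>divergence \<phi> x\<bar> \<le> B"
    "integrable lborel \<phi>" "integrable lborel (divergence \<phi>)"
proof -
  have f: "C1_field \<phi>" using assms by (simp add: C1c_iff)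
  obtain R where R: "R > 0" "\<And>x. norm x \<ge> R \<Longrightarrow> \<phi> x = 0" using C1c_support_ball[OF assms] by blast
  obtain D where D: "\<And>x. (\<phi> has_derivative D x) (at x)" using f unfolding C1_field_def by auto
  have dz: "divergence \<phi> x = 0" if "norm x \<ge> R + 1" for x
    using divergence_eq[OF D] derivative_eq_0_of_support[OF R(2) D that] by simp
  obtain B1 where "B1 \<ge> 0" "\<And>x. norm (\<phi> x) \<le> B1"
    using bounded_of_compact_support[OF C1_field_continuous[OF f] R(2)] by blast
  moreover obtain B2 where "B2 \<ge> 0" "\<And>x. norm (divergence \<phi> x) \<le> B2"
    using bounded_of_compact_support[OF C1_field_divergence_continuous[OF f] dz] by blast
  ultimately show ?thesis
    using that[of "max B1 B2"] integrable_of_compact_support[OF C1_field_continuous[OF f] R(2)]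
      integrable_of_compact_support[OF C1_field_divergence_continuous[OF f] dz]
    by (simp add: le_max_iff_disj)
qed

lemma C1_field_scaleR:
  assumes \<psi>: "C1_grad \<psi> g" and \<phi>: "C1_field \<phi>"
  shows "C1_field (\<lambda>x. \<psi> x *\<^sub>R \<phi> x)"
    and "divergence (\<lambda>x. \<psi> x *\<^sub>R \<phi> x) x = \<psi> x * divergence \<phi> x + g x \<bullet> \<phi> x"
proof -
  obtain D where D: "\<And>x. (\<phi> has_derivative D x) (at x)" "\<And>v. continuous_on UNIV (\<lambda>x. D x v)"
    using \<phi> unfolding C1_field_def by auto
  have \<psi>': "(\<psi> has_derivative (\<lambda>h. g x \<bullet> h)) (at x)" "continuous_on UNIV g" for x
    using \<psi> by (auto simp: C1_grad_def)
  have d: "((\<lambda>x. \<psi> x *\<^sub>R \<phi> x) has_derivative (\<lambda>h. \<psi> x *\<^sub>R D x h + (g x \<bullet> h) *\<^sub>R \<phi> x)) (at x)" for x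
    by (rule has_derivative_scaleR[OF \<psi>'(1) D(1)])
  show "C1_field (\<lambda>x. \<psi> x *\<^sub>R \<phi> x)"
    unfolding C1_field_def
  proof (intro exI conjI allI)
    show "((\<lambda>x. \<psi> x *\<^sub>R \<phi> x) has_derivative (\<lambda>h. \<psi> x *\<^sub>R D x h + (g x \<bullet> h) *\<^sub>R \<phi> x)) (at x)" for x by (rule d)
    show "continuous_on UNIV (\<lambda>x. \<psi> x *\<^sub>R D x v + (g x \<bullet> v) *\<^sub>R \<phi> x)" for v
      by (intro continuous_intros D(2) \<psi>'(2) C1_grad_continuous[OF \<psi>] C1_field_continuous[OF \<phi>])
  qed
  have "divergence (\<lambda>x. \<psi> x *\<^sub>R \<phi> x) x = (\<Sum>b\<in>Basis. \<psi> x * (D x b \<bullet> b) + (g x \<bullet> b) * (\<phi> x \<bullet> b))"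
    by (simp add: divergence_eq[OF d] inner_add_left)
  also have "\<dots> = \<psi> x * divergence \<phi> x + g x \<bullet> \<phi> x"
    by (subst euclidean_inner[of "g x" "\<phi> x"]) (simp add: divergence_eq[OF D(1)] sum.distrib sum_distrib_left)
  finally show "divergence (\<lambda>x. \<psi> x *\<^sub>R \<phi> x) x = \<psi> x * divergence \<phi> x + g x \<bullet> \<phi> x" .
qed

lemma C1cI:
  assumes "C1_field \<phi>" "{x. \<phi> x \<noteq> 0} \<subseteq> S" "compact (closure S)" "closure S \<subseteq> \<Omega>"
  shows "\<phi> \<in> C1c \<Omega>"
proof -
  have sub: "closure {x. \<phi> x \<noteq> 0} \<subseteq> closure S" by (rule closure_mono[OF assms(2)])
  have "bounded (closure {x. \<phi> x \<noteq> 0})"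
    by (rule bounded_subset[OF compact_imp_bounded[OF assms(3)] sub])
  then have "compact (closure {x. \<phi> x \<noteq> 0})" unfolding compact_eq_bounded_closed by (intro conjI closed_closure)
  then show ?thesis unfolding C1c_iff using assms(1) subset_trans[OF sub assms(4)] by (intro conjI)
qed

lemma C1c_scaleR_cutoff:
  assumes "C1_grad \<psi> g" "C1_field \<phi>" "compact (closure {x. \<psi> x \<noteq> 0})" "closure {x. \<psi> x \<noteq> 0} \<subseteq> \<Omega>"
  shows "(\<lambda>x. \<psi> x *\<^sub>R \<phi> x) \<in> C1c \<Omega>"
  by (rule C1cI[OF C1_field_scaleR(1)[OF assms(1,2)] _ assms(3,4)]) auto

lemma C1c_scaleR:
  assumes "C1_grad \<psi> g" "\<phi> \<in> C1c \<Omega>"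
  shows "(\<lambda>x. \<psi> x *\<^sub>R \<phi> x) \<in> C1c \<Omega>"
proof -
  have "C1_field \<phi>" "compact (closure {x. \<phi> x \<noteq> 0})" "closure {x. \<phi> x \<noteq> 0} \<subseteq> \<Omega>"
    using assms(2) unfolding C1c_iff by blast+
  then show ?thesis by (intro C1cI[OF C1_field_scaleR(1)[OF assms(1)]]) (assumption | force)+
qed

section \<open>Divergence theorem and integration by parts on the whole space\<close>

text \<open>Difference quotients integrate to zero by translation invariance, and dominated
  convergence carries this over to the derivative.\<close>

lemma integral_directional_derivative_eq_0:
  fixes f :: "'a::euclidean_space \<Rightarrow> real"
  assumes D: "\<And>x. (f has_derivative D x) (at x)" and c: "\<And>v. continuous_on UNIV (\<lambda>x. D x v)"
    and R: "\<And>x. norm x \<ge> R \<Longrightarrow> f x = 0" and v: "norm v \<le> 1"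
  shows "(\<integral>x. D x v \<partial>lborel) = 0"
proof -
  have Dz: "D x v = 0" if "norm x \<ge> R + 1" for x
    using derivative_eq_0_of_support[OF R D that] by simp
  obtain M where M: "M \<ge> 0" "\<And>x. norm (D x v) \<le> M"
    using bounded_of_compact_support[OF c Dz] by blast
  have cf: "continuous_on UNIV f"
    using has_derivative_continuous[OF D] by (simp add: continuous_at_imp_continuous_on)
  then have fm[measurable]: "f \<in> borel_measurable borel" by (rule borel_measurable_continuous_onI)
  have fi: "integrable lborel f" by (rule integrable_of_compact_support[OF cf R])
  \<comment> \<open>The increments are at most 1; with \<open>norm v \<le> 1\<close> each shift
    moves a point by at most 1, which is the margin in \<open>R + 1\<close>.\<close>
  define t where "t n = inverse (real (Suc n))" for n
  have t: "t n > 0" "t n \<le> 1" for n unfolding t_def by (auto simp: divide_simps)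
  define s where "s n x = (f (x + t n *\<^sub>R v) - f x) / t n" for n x
  have der: "((\<lambda>r. f (x + r *\<^sub>R v)) has_real_derivative D (x + r *\<^sub>R v) v) (at r)" for x r
  proof -
    have lin: "linear (D (x + r *\<^sub>R v))" by (rule has_derivative_linear[OF D])
    have "((\<lambda>r. x + r *\<^sub>R v) has_derivative (\<lambda>h. h *\<^sub>R v)) (at r)"
      by (auto intro!: derivative_eq_intros)
    from has_derivative_compose[OF this D]
    have "((\<lambda>r. f (x + r *\<^sub>R v)) has_derivative (\<lambda>h. D (x + r *\<^sub>R v) (h *\<^sub>R v))) (at r)" .
    moreover have "(\<lambda>h. D (x + r *\<^sub>R v) (h *\<^sub>R v)) = (*) (D (x + r *\<^sub>R v) v)"
    proof
      fix h show "D (x + r *\<^sub>R v) (h *\<^sub>R v) = D (x + r *\<^sub>R v) v * h"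
        by (simp only: linear_scale[OF lin] real_scaleR_def) (rule mult.commute)
    qed
    ultimately show ?thesis unfolding has_field_derivative_def by (simp only:)
  qed
  have lim: "(\<lambda>n. s n x) \<longlonglongrightarrow> D x v" for x
  proof -
    have "((\<lambda>h. (f (x + h *\<^sub>R v) - f x) / h) \<longlongrightarrow> D x v) (at 0)"
      using der[of x 0] unfolding DERIV_def by simp
    moreover have "filterlim t (at 0) sequentially"
      unfolding filterlim_at
    proof (intro conjI always_eventually allI)
      show "t \<longlonglongrightarrow> 0" using LIMSEQ_inverse_real_of_nat unfolding t_def .
      show "t n \<in> UNIV" "t n \<noteq> 0" for n using t(1)[of n] by simp_all
    qed
    ultimately show ?thesis unfolding s_def by (rule filterlim_compose)
  qed
  have int0: "(\<integral>x. s n x \<partial>lborel) = 0" for n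
  proof -
    have i: "integrable lborel (\<lambda>x. f (x + t n *\<^sub>R v))"
      using integrable_translate[OF fi, of "- (t n *\<^sub>R v)"] by simp
    have e: "(\<integral>x. f (x + t n *\<^sub>R v) \<partial>lborel) = (\<integral>x. f x \<partial>lborel)"
      using integral_translate[OF fm, of "- (t n *\<^sub>R v)"] by simp
    have "(\<integral>x. f (x + t n *\<^sub>R v) - f x \<partial>lborel) = 0"
      unfolding Bochner_Integration.integral_diff[OF i fi] e by simp
    then show ?thesis unfolding s_def integral_divide_zero by simp
  qed
  \<comment> \<open>The mean value theorem bounds the quotient by \<open>M\<close>; beyond radius
    \<open>R + 1\<close> both values in the quotient vanish.\<close>
  have bd: "norm (s n x) \<le> M * indicator (cball (0::'a) (R + 1)) x" for n x
  proof (cases "norm x \<le> R + 1")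
    case True
    obtain z where "f (x + t n *\<^sub>R v) - f (x + 0 *\<^sub>R v) = (t n - 0) * D (x + z *\<^sub>R v) v"
      using MVT2[OF t(1)[of n], of "\<lambda>r. f (x + r *\<^sub>R v)" "\<lambda>r. D (x + r *\<^sub>R v) v", OF der] by blast
    then have "s n x = D (x + z *\<^sub>R v) v" using t(1)[of n] unfolding s_def by simp
    moreover have "x \<in> cball 0 (R + 1)" using True by simp
    ultimately show ?thesis using M(2)[of "x + z *\<^sub>R v"] by (simp only: indicator_simps mult_1_right)
  next
    case False
    have "norm (t n *\<^sub>R v) \<le> 1" using t[of n] v by (simp add: mult_le_one)
    then have "norm (x + t n *\<^sub>R v) \<ge> R" "norm x \<ge> R"
      using False norm_triangle_ineq4[of "x + t n *\<^sub>R v" "t n *\<^sub>R v"] by simp_all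
    then have "s n x = 0" unfolding s_def using R[of x] R[of "x + t n *\<^sub>R v"] by simp
    moreover have "x \<notin> cball 0 (R + 1)" using False by simp
    ultimately show ?thesis by simp
  qed
  have "(\<lambda>n. \<integral>x. s n x \<partial>lborel) \<longlonglongrightarrow> (\<integral>x. D x v \<partial>lborel)"
  proof (rule integral_dominated_convergence[where w = "\<lambda>x. M * indicator (cball (0::'a) (R + 1)) x"])
    show "(\<lambda>x. D x v) \<in> borel_measurable lborel" using borel_measurable_continuous_onI[OF c[of v]] by simp
    show "s n \<in> borel_measurable lborel" for n unfolding s_def[abs_def] by measurable
    show "integrable lborel (\<lambda>x. M * indicator (cball (0::'a) (R + 1)) x :: real)"
      by (rule integrable_mult_right, rule integrable_real_indicator)
        (simp, rule emeasure_bounded_finite[OF bounded_cball])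
    show "AE x in lborel. (\<lambda>n. s n x) \<longlonglongrightarrow> D x v" by (intro AE_I2 lim)
    show "AE x in lborel. norm (s n x) \<le> M * indicator (cball 0 (R + 1)) x" for n by (intro AE_I2 bd)
  qed
  then have "(\<lambda>n. 0) \<longlonglongrightarrow> (\<integral>x. D x v \<partial>lborel)" unfolding int0 .
  then show ?thesis by (rule LIMSEQ_unique) (rule tendsto_const)
qed

lemma integral_divergence_eq_0:
  assumes "\<phi> \<in> C1c \<Omega>" shows "(\<integral>x. divergence \<phi> x \<partial>lborel) = 0"
proof -
  obtain D where D: "\<And>x. (\<phi> has_derivative D x) (at x)" "\<And>v. continuous_on UNIV (\<lambda>x. D x v)"
    using assms unfolding C1c_iff C1_field_def by auto
  obtain R where R: "R > 0" "\<And>x. norm x \<ge> R \<Longrightarrow> \<phi> x = 0" using C1c_support_ball[OF assms] by blast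
  have i: "integrable lborel (\<lambda>x. D x b \<bullet> b)" for b
  proof (rule integrable_of_compact_support)
    show "continuous_on UNIV (\<lambda>x. D x b \<bullet> b)" by (intro continuous_intros D(2))
    show "D x b \<bullet> b = 0" if "norm x \<ge> R + 1" for x
      using derivative_eq_0_of_support[OF R(2) D(1) that] by simp
  qed
  have z: "(\<integral>x. D x b \<bullet> b \<partial>lborel) = 0" if "b \<in> Basis" for b
  proof (rule integral_directional_derivative_eq_0[where f = "\<lambda>x. \<phi> x \<bullet> b" and D = "\<lambda>x h. D x h \<bullet> b" and R = R])
    show "((\<lambda>x. \<phi> x \<bullet> b) has_derivative (\<lambda>h. D x h \<bullet> b)) (at x)" for x
      by (rule has_derivative_inner_left[OF D(1)])
    show "continuous_on UNIV (\<lambda>x. D x v \<bullet> b)" for v by (intro continuous_intros D(2))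
  qed (use R that in auto)
  have "divergence \<phi> = (\<lambda>x. \<Sum>b\<in>Basis. D x b \<bullet> b)" using divergence_eq[OF D(1)] by auto
  then show ?thesis using z i by simp
qed

text \<open>The divergence of the product of \<psi> and \<phi> integrates to zero, and its product
  rule has exactly these two terms. The compact support of \<phi> carries the argument, so \<psi>
  may be spread over the whole space.\<close>

lemma integral_by_parts_C1:
  assumes \<psi>: "C1_grad \<psi> g" and \<phi>: "\<phi> \<in> C1c \<Omega>"
  shows "integrable lborel (\<lambda>x. \<psi> x * divergence \<phi> x)" "integrable lborel (\<lambda>x. g x \<bullet> \<phi> x)"
    and "(\<integral>x. \<psi> x * divergence \<phi> x \<partial>lborel) = - (\<integral>x. g x \<bullet> \<phi> x \<partial>lborel)"
proof -
  have f: "C1_field \<phi>" using \<phi> by (simp add: C1c_iff)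
  obtain R where R: "R > 0" "\<And>x. norm x \<ge> R \<Longrightarrow> \<phi> x = 0" using C1c_support_ball[OF \<phi>] by blast
  show i: "integrable lborel (\<lambda>x. g x \<bullet> \<phi> x)"
  proof (rule integrable_of_compact_support)
    show "continuous_on UNIV (\<lambda>x. g x \<bullet> \<phi> x)"
      using \<psi> C1_field_continuous[OF f] by (intro continuous_intros) (auto simp: C1_grad_def)
    show "g x \<bullet> \<phi> x = 0" if "norm x \<ge> R" for x using R(2)[OF that] by simp
  qed
  note p = C1c_scaleR[OF \<psi> \<phi>]
  have i2: "integrable lborel (divergence (\<lambda>x. \<psi> x *\<^sub>R \<phi> x))"
    using C1c_bounds[OF p] by blast
  have eq: "(\<lambda>x. \<psi> x * divergence \<phi> x) = (\<lambda>x. divergence (\<lambda>x. \<psi> x *\<^sub>R \<phi> x) x - g x \<bullet> \<phi> x)"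
    by (simp add: C1_field_scaleR(2)[OF \<psi> f])
  show "integrable lborel (\<lambda>x. \<psi> x * divergence \<phi> x)" unfolding eq using i i2 by simp
  show "(\<integral>x. \<psi> x * divergence \<phi> x \<partial>lborel) = - (\<integral>x. g x \<bullet> \<phi> x \<partial>lborel)"
    unfolding eq using i i2 integral_divergence_eq_0[OF p] by simp
qed

section \<open>Integration by parts with mollified functions and fields\<close>

lemma C1_grad_mconv:
  fixes f :: "'a::euclidean_space \<Rightarrow> real"
  assumes e: "e > 0" and f: "integrable lborel f"
  shows "C1_grad (mconv e f) (dmconv e f)"
  unfolding C1_grad_def
proof (intro conjI allI)
  show "(mconv e f has_derivative (\<bullet>) (dmconv e f x)) (at x)" for x
    using mconv_has_derivative[OF e f] dmconv_inner[OF e f] by presburger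
  show "continuous_on UNIV (dmconv e f)"
    unfolding continuous_on_componentwise[of _ "dmconv e f"] dmconv_inner[OF e f]
    using continuous_on_mconv_derivative[OF e f] by blast
qed

text \<open>The divergence is the trace of the derivative, and the trace of the map sending
  \<open>h\<close> to \<open>(a \<bullet> h) *\<^sub>R c\<close> is
  \<open>a \<bullet> c\<close>.\<close>

lemma C1_field_mconv:
  assumes e: "e > 0" and f: "integrable lborel \<Theta>"
  shows "C1_field (mconv e \<Theta>)"
    and "divergence (mconv e \<Theta>) x = (\<integral>y. dmoll e (x - y) \<bullet> \<Theta> y \<partial>lborel)"
proof -
  show "C1_field (mconv e \<Theta>)"
    unfolding C1_field_def
    by (intro exI[of _ "\<lambda>x h. \<integral>y. (dmoll e (x - y) \<bullet> h) *\<^sub>R \<Theta> y \<partial>lborel"] conjI allI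
        mconv_has_derivative[OF e f] continuous_on_mconv_derivative[OF e f])
  have "divergence (mconv e \<Theta>) x = (\<Sum>b\<in>Basis. (\<integral>y. (dmoll e (x - y) \<bullet> b) *\<^sub>R \<Theta> y \<partial>lborel) \<bullet> b)"
    by (rule divergence_eq[OF mconv_has_derivative[OF e f]])
  also have "\<dots> = (\<Sum>b\<in>Basis. (\<integral>y. ((dmoll e (x - y) \<bullet> b) *\<^sub>R \<Theta> y) \<bullet> b \<partial>lborel))"
    using integrable_dmoll_inner_scaleR[OF e f, of x] by (intro sum.cong refl integral_inner_left[symmetric]) auto
  also have "\<dots> = (\<integral>y. (\<Sum>b\<in>Basis. ((dmoll e (x - y) \<bullet> b) *\<^sub>R \<Theta> y) \<bullet> b) \<partial>lborel)"
    using integrable_dmoll_inner_scaleR[OF e f, of x]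
    by (intro Bochner_Integration.integral_sum[symmetric] integrable_inner_left) auto
  also have "\<dots> = (\<integral>y. dmoll e (x - y) \<bullet> \<Theta> y \<partial>lborel)"
    by (subst (2) euclidean_inner) simp
  finally show "divergence (mconv e \<Theta>) x = (\<integral>y. dmoll e (x - y) \<bullet> \<Theta> y \<partial>lborel)" .
qed

text \<open>Fubini moves the kernel from the field onto \<open>f\<close>, which is merely L1; the
  sign comes from \<open>dmoll\<close> being odd.\<close>

lemma integral_divergence_mconv:
  fixes f :: "'a::euclidean_space \<Rightarrow> real"
  assumes e: "e > 0" and f: "integrable lborel f" and \<Theta>: "integrable lborel \<Theta>"
  shows "integrable lborel (\<lambda>x. f x * divergence (mconv e \<Theta>) x)"
    and "(\<integral>x. f x * divergence (mconv e \<Theta>) x \<partial>lborel) = - (\<integral>x. dmconv e f x \<bullet> \<Theta> x \<partial>lborel)"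
proof -
  have [measurable]: "f \<in> borel_measurable borel" "\<Theta> \<in> borel_measurable borel"
    using f \<Theta> by (auto dest: borel_measurable_integrable)
  obtain B where B: "\<And>x::'a. norm (dmoll e x) \<le> B" using dmoll_bounded[OF e] by blast
  have int: "integrable (lborel \<Otimes>\<^sub>M lborel) (\<lambda>(x, y). f x * (dmoll e (x - y) \<bullet> \<Theta> y))"
  proof (rule integrable_pair_product_bound[OF f \<Theta>])
    fix x y
    have "\<bar>dmoll e (x - y) \<bullet> \<Theta> y\<bar> \<le> B * norm (\<Theta> y)"
      using Cauchy_Schwarz_ineq2[of "dmoll e (x - y)" "\<Theta> y"]
        mult_right_mono[OF B[of "x - y"] norm_ge_zero[of "\<Theta> y"]] by linarith
    then have "\<bar>f x\<bar> * \<bar>dmoll e (x - y) \<bullet> \<Theta> y\<bar> \<le> \<bar>f x\<bar> * (B * norm (\<Theta> y))"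
      by (intro mult_left_mono) auto
    then show "norm (case (x, y) of (x, y) \<Rightarrow> f x * (dmoll e (x - y) \<bullet> \<Theta> y)) \<le> B * norm (f x) * norm (\<Theta> y)"
      by (simp add: abs_mult mult_ac)
  qed measurable
  have eq: "(\<integral>y. f x * (dmoll e (x - y) \<bullet> \<Theta> y) \<partial>lborel) = f x * divergence (mconv e \<Theta>) x" for x
    by (simp add: C1_field_mconv(2)[OF e \<Theta>])
  show "integrable lborel (\<lambda>x. f x * divergence (mconv e \<Theta>) x)"
    using lborel_pair.integrable_fst[OF int] unfolding eq .
  have "(\<integral>x. f x * divergence (mconv e \<Theta>) x \<partial>lborel) =
      (\<integral>x. (\<integral>y. f x * (dmoll e (x - y) \<bullet> \<Theta> y) \<partial>lborel) \<partial>lborel)" by (simp only: eq)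
  also have "\<dots> = (\<integral>y. (\<integral>x. f x * (dmoll e (x - y) \<bullet> \<Theta> y) \<partial>lborel) \<partial>lborel)"
    by (rule lborel_pair.Fubini_integral[OF int, symmetric])
  also have "\<dots> = (\<integral>y. - (dmconv e f y \<bullet> \<Theta> y) \<partial>lborel)"
  proof (intro Bochner_Integration.integral_cong refl)
    fix y
    have "f x * (dmoll e (x - y) \<bullet> \<Theta> y) = - ((f x *\<^sub>R dmoll e (y - x)) \<bullet> \<Theta> y)" for x
      using dmoll_minus[of e "y - x"] by simp
    then have "(\<integral>x. f x * (dmoll e (x - y) \<bullet> \<Theta> y) \<partial>lborel) = - (\<integral>x. (f x *\<^sub>R dmoll e (y - x)) \<bullet> \<Theta> y \<partial>lborel)"
      by simp
    also have "(\<integral>x. (f x *\<^sub>R dmoll e (y - x)) \<bullet> \<Theta> y \<partial>lborel) = dmconv e f y \<bullet> \<Theta> y"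
      unfolding dmconv_def by (rule integral_inner_left) (use integrable_scaleR_dmoll[OF e f] in blast)
    finally show "(\<integral>x. f x * (dmoll e (x - y) \<bullet> \<Theta> y) \<partial>lborel) = - (dmconv e f y \<bullet> \<Theta> y)" .
  qed
  finally show "(\<integral>x. f x * divergence (mconv e \<Theta>) x \<partial>lborel) = - (\<integral>x. dmconv e f x \<bullet> \<Theta> x \<partial>lborel)"
    by simp
qed

lemma dmconv_bounded:
  fixes f :: "'a::euclidean_space \<Rightarrow> real"
  assumes e: "e > 0" and f: "integrable lborel f"
  obtains B where "\<And>x. norm (dmconv e f x) \<le> B"
proof -
  obtain B where B: "\<And>x::'a. norm (dmoll e x) \<le> B" using dmoll_bounded[OF e] by blast
  have "norm (dmconv e f x) \<le> (\<integral>y. \<bar>f y\<bar> * B \<partial>lborel)" for x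
    unfolding dmconv_def
  proof (rule Bochner_Integration.integral_norm_bound_integral[OF integrable_scaleR_dmoll[OF e f]])
    show "integrable lborel (\<lambda>y. \<bar>f y\<bar> * B)" using f by simp
    fix y show "norm (f y *\<^sub>R dmoll e (x - y)) \<le> \<bar>f y\<bar> * B"
      using B by (simp add: mult_left_mono)
  qed
  then show ?thesis by (rule that)
qed

section \<open>Cutoffs exhausting a bounded open set\<close>

text \<open>\<open>\<eta> k\<close> mollifies, at radius \<open>d k\<close>, the indicator of the
  points at distance at least \<open>2 * d k\<close> from the complement of \<Omega>. So it is 0 up
  to distance \<open>d k\<close> and 1 from distance \<open>3 * d k\<close> on.\<close>

lemma cutoff_sequence:
  fixes \<Omega> :: "'a::euclidean_space set"
  assumes "open \<Omega>" "bounded \<Omega>"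
  obtains \<eta> :: "nat \<Rightarrow> 'a \<Rightarrow> real" and d\<eta> where
    "\<And>k. C1_grad (\<eta> k) (d\<eta> k)" "\<And>k x. 0 \<le> \<eta> k x" "\<And>k x. \<eta> k x \<le> 1" "\<And>k x. \<eta> k x \<le> \<eta> (Suc k) x"
    "\<And>k. compact (closure {x. \<eta> k x \<noteq> 0})" "\<And>k. closure {x. \<eta> k x \<noteq> 0} \<subseteq> \<Omega>"
    "\<And>k. \<exists>B. \<forall>x. norm (d\<eta> k x) \<le> B"
    "\<And>K. compact K \<Longrightarrow> K \<subseteq> \<Omega> \<Longrightarrow> \<exists>N. \<forall>k\<ge>N. \<forall>x\<in>K. \<eta> k x = 1"
proof -
  define \<rho> where "\<rho> x = infdist x (- \<Omega>)" for x
  have \<rho>0: "\<rho> x = 0" if "x \<notin> \<Omega>" for x using that by (simp add: \<rho>_def)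
  have \<rho>tri: "\<rho> x \<le> \<rho> y + dist x y" for x y unfolding \<rho>_def by (rule infdist_triangle)
  \<comment> \<open>The distance to the empty set is 0 by convention, so the characterization of a
    closed set by zero distance requires a nonempty complement.\<close>
  have nonempty: "- \<Omega> \<noteq> {}" using assms(2) by (metis Compl_eq_Diff_UNIV Diff_eq_empty_iff bounded_subset not_bounded_UNIV)
  have \<rho>c: "continuous_on UNIV \<rho>" unfolding \<rho>_def by (intro continuous_intros)
  have lev: "compact {x. \<rho> x \<ge> c}" "{x. \<rho> x \<ge> c} \<subseteq> \<Omega>" if "c > 0" for c
  proof -
    show sub: "{x. \<rho> x \<ge> c} \<subseteq> \<Omega>" using \<rho>0 that by force
    have "closed {x. \<rho> x \<ge> c}" by (intro closed_Collect_le continuous_on_const \<rho>c)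
    then show "compact {x. \<rho> x \<ge> c}" using sub assms(2) bounded_subset compact_eq_bounded_closed by blast
  qed
  \<comment> \<open>The ratio \<open>1/4\<close> gives \<open>3 * d (Suc k) \<le> d k\<close>:
    wherever \<open>\<eta> k\<close> is nonzero, \<open>\<eta> (Suc k)\<close> is already 1. This
    yields monotonicity.\<close>
  define d where "d k = (1/4::real) ^ k" for k
  have d: "d k > 0" for k by (simp add: d_def)
  define A where "A k = {x. \<rho> x \<ge> 2 * d k}" for k
  have Ac: "compact (A k)" for k unfolding A_def using lev(1)[of "2 * d k"] d[of k] by simp
  have [measurable]: "A k \<in> sets borel" for k using Ac[of k] by (simp add: borel_compact)
  have iA: "integrable lborel (indicator (A k) :: 'a \<Rightarrow> real)" for k
    using emeasure_compact_finite[OF Ac] by simp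
  define \<eta> where "\<eta> k = mconv (d k) (indicator (A k) :: 'a \<Rightarrow> real)" for k
  define d\<eta> where "d\<eta> k = dmconv (d k) (indicator (A k) :: 'a \<Rightarrow> real)" for k
  have nn: "0 \<le> \<eta> k x" for k x
    unfolding \<eta>_def mconv_def by (rule Bochner_Integration.integral_nonneg) (simp add: moll_nonneg[OF d])
  have le1: "\<eta> k x \<le> 1" for k x
    using norm_mconv_le[OF d iA, of k 1 k x] by (auto simp: \<eta>_def indicator_def)
  have zero: "\<eta> k x = 0" if "\<rho> x \<le> d k" for k x
  proof -
    have "moll (d k) (x - y) *\<^sub>R indicator (A k) y = (0::real)" for y
    proof (cases "y \<in> A k")
      case True
      then have "norm (x - y) \<ge> d k" using that \<rho>tri[of y x] by (simp add: A_def dist_norm norm_minus_commute)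
      then show ?thesis by (simp add: moll_eq_0[OF d])
    qed simp
    then show ?thesis unfolding \<eta>_def mconv_def by (simp only:) simp
  qed
  have one: "\<eta> k x = 1" if "\<rho> x \<ge> 3 * d k" for k x
  proof -
    have "moll (d k) (x - y) *\<^sub>R indicator (A k) y = moll (d k) (x - y)" for y
    proof (cases "y \<in> A k")
      case False
      then have "norm (x - y) \<ge> d k" using that \<rho>tri[of x y] by (simp add: A_def dist_norm)
      then show ?thesis by (simp add: moll_eq_0[OF d])
    qed simp
    then have "\<eta> k x = (\<integral>y. moll (d k) (x - y) \<partial>lborel)" unfolding \<eta>_def mconv_def by (simp only:)
    also have "\<dots> = 1"
      using integral_reflect_translate[of "moll (d k)" x] integral_moll[OF d, where 'a='a] by simp
    finally show ?thesis .
  qed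
  have supp: "closure {x. \<eta> k x \<noteq> 0} \<subseteq> {x. \<rho> x \<ge> d k}" for k
    by (rule closure_minimal) (use zero[of _ k] lev(1)[OF d[of k]] compact_imp_closed in force)+
  show ?thesis
  proof (rule that[of \<eta> d\<eta>])
    show "C1_grad (\<eta> k) (d\<eta> k)" for k unfolding \<eta>_def d\<eta>_def by (rule C1_grad_mconv[OF d iA])
    show "\<eta> k x \<le> \<eta> (Suc k) x" for k x
    proof (cases "\<rho> x \<le> d k")
      case True then show ?thesis using zero nn by simp
    next
      case False
      moreover have "3 * d (Suc k) \<le> d k" by (simp add: d_def)
      ultimately have "\<rho> x \<ge> 3 * d (Suc k)" by linarith
      then show ?thesis using one le1 by simp
    qed
    show "compact (closure {x. \<eta> k x \<noteq> 0})" for k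
      using bounded_subset[OF compact_imp_bounded[OF lev(1)[OF d[of k]]] supp[of k]]
      unfolding compact_eq_bounded_closed by (intro conjI closed_closure)
    show "closure {x. \<eta> k x \<noteq> 0} \<subseteq> \<Omega>" for k using supp[of k] lev(2)[OF d[of k]] by blast
    show "\<exists>B. \<forall>x. norm (d\<eta> k x) \<le> B" for k
      unfolding d\<eta>_def using dmconv_bounded[OF d iA] by metis
    show "\<exists>N. \<forall>k\<ge>N. \<forall>x\<in>K. \<eta> k x = 1" if K: "compact K" "K \<subseteq> \<Omega>" for K
    proof (cases "K = {}")
      case False
      obtain x0 where x0: "x0 \<in> K" "\<And>x. x \<in> K \<Longrightarrow> \<rho> x0 \<le> \<rho> x"
        using continuous_attains_inf[OF K(1) False continuous_on_subset[OF \<rho>c]] by auto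
      have "\<rho> x0 \<noteq> 0"
        using in_closed_iff_infdist_zero[of "- \<Omega>" x0] assms(1) nonempty x0(1) K(2) by (auto simp: \<rho>_def)
      then have "\<rho> x0 > 0" using infdist_nonneg[of x0 "- \<Omega>"] by (simp add: \<rho>_def)
      \<comment> \<open>Division by 3 because \<open>\<eta> k\<close> equals 1 from distance
        \<open>3 * d k\<close> on.\<close>
      then obtain N where N: "(1/4) ^ N < \<rho> x0 / 3" using real_arch_pow_inv[of "\<rho> x0 / 3" "1/4"] by auto
      have "\<eta> k x = 1" if "k \<ge> N" "x \<in> K" for k x
      proof (rule one)
        have "d k \<le> (1/4) ^ N" unfolding d_def using that by (intro power_decreasing) auto
        then show "\<rho> x \<ge> 3 * d k" using N x0(2)[OF that(2)] by simp
      qed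
      then show ?thesis by blast
    qed simp
  qed (use nn le1 in auto)
qed

section \<open>Absolutely convergent series in L1 and passage to the limit in pairings\<close>

text \<open>Completeness of L1 for absolutely summable series, the sum being formed pointwise almost
  everywhere. The norm bound on \<open>F\<close> follows from the L1 convergence and the bound on
  the partial sums.\<close>

lemma L1_series:
  fixes f :: "nat \<Rightarrow> 'a \<Rightarrow> 'b::{banach,second_countable_topology}"
  assumes f: "\<And>i. integrable M (f i)" and bd: "\<And>n. (\<Sum>i<n. \<integral>x. norm (f i x) \<partial>M) \<le> B"
  obtains F where "integrable M F" "(\<integral>x. norm (F x) \<partial>M) \<le> B"
    "(\<lambda>n. \<integral>x. norm (F x - (\<Sum>i<n. f i x)) \<partial>M) \<longlonglongrightarrow> 0"
proof -
  have [measurable]: "f i \<in> borel_measurable M" for i by (rule borel_measurable_integrable[OF f])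
  have sm: "summable (\<lambda>i. \<integral>x. norm (f i x) \<partial>M)"
    by (rule summableI_nonneg_bounded[where x = B]) (simp_all add: bd)
  have "(\<integral>\<^sup>+x. (\<Sum>i. ennreal (norm (f i x))) \<partial>M) = (\<Sum>i. \<integral>\<^sup>+x. ennreal (norm (f i x)) \<partial>M)"
    by (rule nn_integral_suminf) measurable
  also have "\<dots> = (\<Sum>i. ennreal (\<integral>x. norm (f i x) \<partial>M))"
    by (intro suminf_cong nn_integral_eq_integral integrable_norm f) simp
  also have "\<dots> \<noteq> \<infinity>"
    unfolding infinity_ennreal_def by (rule ennreal_suminf_neq_top[OF sm]) simp
  finally have "AE x in M. (\<Sum>i. ennreal (norm (f i x))) \<noteq> \<infinity>"
    by (intro nn_integral_PInf_AE) measurable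
  then have ae: "AE x in M. summable (\<lambda>i. norm (f i x))"
    by eventually_elim (rule summable_suminf_not_top; simp)
  define F where "F x = (\<Sum>i. f i x)" for x
  have iF: "integrable M F" unfolding F_def by (rule integrable_suminf[OF f ae sm])
  have iN: "integrable M (\<lambda>x. \<Sum>i. norm (f i x))"
    by (rule integrable_suminf) (use f ae sm in auto)
  have "(\<lambda>n. \<integral>x. norm (F x - (\<Sum>i<n. f i x)) \<partial>M) \<longlonglongrightarrow> (\<integral>x. 0 \<partial>M)"
  \<comment> \<open>One copy of the sum of norms dominates \<open>F\<close>, the other dominates the
    partial sum.\<close>
  proof (rule integral_dominated_convergence[where w = "\<lambda>x. 2 * (\<Sum>i. norm (f i x))"])
    show "AE x in M. (\<lambda>n. norm (F x - (\<Sum>i<n. f i x))) \<longlonglongrightarrow> 0"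
      using ae
    proof eventually_elim
      fix x assume "summable (\<lambda>i. norm (f i x))"
      then have "(\<lambda>n. \<Sum>i<n. f i x) \<longlonglongrightarrow> F x" unfolding F_def by (rule summable_LIMSEQ[OF summable_norm_cancel])
      then have "(\<lambda>n. norm (F x - (\<Sum>i<n. f i x))) \<longlonglongrightarrow> norm (F x - F x)" by (intro tendsto_intros)
      then show "(\<lambda>n. norm (F x - (\<Sum>i<n. f i x))) \<longlonglongrightarrow> 0" by simp
    qed
    show "AE x in M. norm (norm (F x - (\<Sum>i<n. f i x))) \<le> 2 * (\<Sum>i. norm (f i x))" for n
      using ae
    proof eventually_elim
      fix x assume s: "summable (\<lambda>i. norm (f i x))"
      have "norm (\<Sum>i<n. f i x) \<le> (\<Sum>i<n. norm (f i x))" by (rule norm_sum)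
      also have "\<dots> \<le> (\<Sum>i. norm (f i x))" by (rule sum_le_suminf[OF s]) auto
      finally have "norm (\<Sum>i<n. f i x) \<le> (\<Sum>i. norm (f i x))" .
      moreover have "norm (F x) \<le> (\<Sum>i. norm (f i x))" unfolding F_def by (rule summable_norm[OF s])
      ultimately show "norm (norm (F x - (\<Sum>i<n. f i x))) \<le> 2 * (\<Sum>i. norm (f i x))"
        using norm_triangle_ineq4[of "F x" "\<Sum>i<n. f i x"] by simp
    qed
    show "(\<lambda>x. norm (F x - (\<Sum>i<n. f i x))) \<in> borel_measurable M" for n
      using borel_measurable_integrable[OF iF] by measurable
    show "integrable M (\<lambda>x. 2 * (\<Sum>i. norm (f i x)))" by (rule integrable_mult_right[OF iN])
  qed simp
  then have lim: "(\<lambda>n. \<integral>x. norm (F x - (\<Sum>i<n. f i x)) \<partial>M) \<longlonglongrightarrow> 0" by simp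
  have "(\<integral>x. norm (F x) \<partial>M) \<le> (\<integral>x. norm (F x - (\<Sum>i<n. f i x)) \<partial>M) + B" for n
  proof -
    have "(\<integral>x. norm (F x) \<partial>M) \<le> (\<integral>x. norm (F x - (\<Sum>i<n. f i x)) + (\<Sum>i<n. norm (f i x)) \<partial>M)"
    proof (rule integral_mono)
      fix x
      have "norm (F x) \<le> norm (F x - (\<Sum>i<n. f i x)) + norm (\<Sum>i<n. f i x)"
        using norm_triangle_ineq[of "F x - (\<Sum>i<n. f i x)" "\<Sum>i<n. f i x"] by simp
      then show "norm (F x) \<le> norm (F x - (\<Sum>i<n. f i x)) + (\<Sum>i<n. norm (f i x))"
        using norm_sum[of "\<lambda>i. f i x" "{..<n}"] by linarith
    qed (intro integrable_norm iF Bochner_Integration.integrable_add Bochner_Integration.integrable_diff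
        Bochner_Integration.integrable_sum f)+
    also have "\<dots> = (\<integral>x. norm (F x - (\<Sum>i<n. f i x)) \<partial>M) + (\<Sum>i<n. \<integral>x. norm (f i x) \<partial>M)"
      using f iF by (subst Bochner_Integration.integral_add) auto
    finally show ?thesis using bd[of n] by simp
  qed
  then have "(\<integral>x. norm (F x) \<partial>M) \<le> 0 + B"
    by (intro tendsto_lowerbound[OF tendsto_add[OF lim tendsto_const]] always_eventually allI) simp_all
  with iF lim show ?thesis using that by simp
qed

lemma C1c_sum:
  fixes \<Phi> :: "nat \<Rightarrow> 'a::euclidean_space \<Rightarrow> 'a"
  assumes "\<And>i. \<Phi> i \<in> C1c \<Omega>"
  shows "(\<lambda>x. \<Sum>i<n. \<Phi> i x) \<in> C1c \<Omega>"
    and "divergence (\<lambda>x. \<Sum>i<n. \<Phi> i x) x = (\<Sum>i<n. divergence (\<Phi> i) x)"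
proof -
  have "\<exists>D. \<forall>i. (\<forall>x. (\<Phi> i has_derivative D i x) (at x)) \<and> (\<forall>v. continuous_on UNIV (\<lambda>x. D i x v))"
    by (rule choice) (use assms in \<open>unfold C1c_iff C1_field_def, blast\<close>)
  then obtain D where D: "\<And>i x. (\<Phi> i has_derivative D i x) (at x)" "\<And>i v. continuous_on UNIV (\<lambda>x. D i x v)"
    by blast
  have d: "((\<lambda>x. \<Sum>i<n. \<Phi> i x) has_derivative (\<lambda>h. \<Sum>i<n. D i x h)) (at x)" for x
    by (rule has_derivative_sum[OF D(1)])
  define S where "S = (\<Union>i<n. closure {x. \<Phi> i x \<noteq> 0})"
  have c: "compact (closure {x. \<Phi> i x \<noteq> 0})" "closure {x. \<Phi> i x \<noteq> 0} \<subseteq> \<Omega>" for i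
    using assms[of i] unfolding C1c_iff by blast+
  show "(\<lambda>x. \<Sum>i<n. \<Phi> i x) \<in> C1c \<Omega>"
  proof (rule C1cI)
    show "C1_field (\<lambda>x. \<Sum>i<n. \<Phi> i x)"
      unfolding C1_field_def
      by (intro exI[of _ "\<lambda>x h. \<Sum>i<n. D i x h"] conjI allI d continuous_on_sum D(2))
    show "{x. (\<Sum>i<n. \<Phi> i x) \<noteq> 0} \<subseteq> S"
    proof (intro subsetI)
      fix x assume "x \<in> {x. (\<Sum>i<n. \<Phi> i x) \<noteq> 0}"
      then obtain i where "i < n" "\<Phi> i x \<noteq> 0"
        by (metis (mono_tags, lifting) mem_Collect_eq sum.neutral lessThan_iff)
      then show "x \<in> S" unfolding S_def using closure_subset[of "{x. \<Phi> i x \<noteq> 0}"] by blast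
    qed
    have S: "compact S" unfolding S_def by (intro compact_UN c(1)) simp
    then have cS: "closure S = S" by (simp add: closure_closed compact_imp_closed)
    show "compact (closure S)" unfolding cS by (rule S)
    show "closure S \<subseteq> \<Omega>" unfolding cS unfolding S_def using c(2) by (rule UN_least)
  qed
  have "divergence (\<lambda>x. \<Sum>i<n. \<Phi> i x) x = (\<Sum>b\<in>Basis. \<Sum>i<n. D i x b \<bullet> b)"
    unfolding divergence_eq[OF d] by (simp only: inner_sum_left)
  also have "\<dots> = (\<Sum>i<n. \<Sum>b\<in>Basis. D i x b \<bullet> b)" by (rule sum.swap)
  also have "\<dots> = (\<Sum>i<n. divergence (\<Phi> i) x)" by (simp only: divergence_eq[OF D(1)])
  finally show "divergence (\<lambda>x. \<Sum>i<n. \<Phi> i x) x = (\<Sum>i<n. divergence (\<Phi> i) x)" .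
qed

text \<open>Pairing with a bounded function is continuous on L1. For real values the inner product
  is multiplication, so the pairing of \<open>W\<close> with a divergence is also covered.\<close>

lemma L1_limit_inner:
  fixes F :: "'a::euclidean_space \<Rightarrow> 'b::euclidean_space"
  assumes F: "integrable M F" and S: "\<And>n. integrable M (S n)"
    and lim: "(\<lambda>n. \<integral>x. norm (F x - S n x) \<partial>M) \<longlonglongrightarrow> 0"
    and k: "k \<in> borel_measurable M" "\<And>x. norm (k x) \<le> B"
  shows "(\<lambda>n. \<integral>x. k x \<bullet> S n x \<partial>M) \<longlonglongrightarrow> (\<integral>x. k x \<bullet> F x \<partial>M)"
proof -
  note iF = integrable_bounded_inner[OF F k]
  note iS = integrable_bounded_inner[OF S k]
  have "\<bar>(\<integral>x. k x \<bullet> S n x \<partial>M) - (\<integral>x. k x \<bullet> F x \<partial>M)\<bar> \<le> B * (\<integral>x. norm (F x - S n x) \<partial>M)" for n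
  proof -
    have "(\<integral>x. k x \<bullet> S n x \<partial>M) - (\<integral>x. k x \<bullet> F x \<partial>M) = (\<integral>x. k x \<bullet> S n x - k x \<bullet> F x \<partial>M)"
      by (rule Bochner_Integration.integral_diff[OF iS iF, symmetric])
    also have "norm \<dots> \<le> (\<integral>x. B * norm (F x - S n x) \<partial>M)"
    proof (rule Bochner_Integration.integral_norm_bound_integral)
      show "integrable M (\<lambda>x. k x \<bullet> S n x - k x \<bullet> F x)"
        by (rule Bochner_Integration.integrable_diff[OF iS iF])
      show "integrable M (\<lambda>x. B * norm (F x - S n x))"
        by (intro integrable_mult_right integrable_norm Bochner_Integration.integrable_diff F S)
      fix x
      have "\<bar>k x \<bullet> (S n x - F x)\<bar> \<le> norm (k x) * norm (S n x - F x)" by (rule Cauchy_Schwarz_ineq2)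
      also have "\<dots> \<le> B * norm (S n x - F x)" using k(2) by (rule mult_right_mono) simp
      finally show "norm (k x \<bullet> S n x - k x \<bullet> F x) \<le> B * norm (F x - S n x)"
        by (simp only: inner_diff_right real_norm_def norm_minus_commute)
    qed
    finally show ?thesis by simp
  qed
  then have "\<forall>\<^sub>F n in sequentially. norm ((\<integral>x. k x \<bullet> S n x \<partial>M) - (\<integral>x. k x \<bullet> F x \<partial>M))
      \<le> B * (\<integral>x. norm (F x - S n x) \<partial>M)"
    unfolding real_norm_def by (intro always_eventually allI)
  from Lim_null_comparison[OF this tendsto_mult_right_zero[OF lim]]
  have "(\<lambda>n. (\<integral>x. k x \<bullet> S n x \<partial>M) - (\<integral>x. k x \<bullet> F x \<partial>M)) \<longlonglongrightarrow> 0" .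
  then show ?thesis by (rule LIM_zero_cancel)
qed

lemma integrable_scaleR_gradient:
  assumes \<eta>: "C1_grad \<psi> d\<psi>" and u: "integrable lborel u" and b: "\<And>x. norm (d\<psi> x) \<le> B"
  shows "integrable lborel (\<lambda>x. u x *\<^sub>R d\<psi> x)"
proof -
  have "d\<psi> \<in> borel_measurable borel" using \<eta> by (simp add: C1_grad_def borel_measurable_continuous_onI)
  then have m: "(\<lambda>x. u x *\<^sub>R d\<psi> x) \<in> borel_measurable lborel"
    using borel_measurable_integrable[OF u] by simp
  have "integrable lborel (\<lambda>x. B * u x)" using u by (rule integrable_mult_right)
  then show ?thesis
  proof (rule Bochner_Integration.integrable_bound[OF _ m], intro AE_I2)
    fix x
    have "norm (u x *\<^sub>R d\<psi> x) \<le> \<bar>u x\<bar> * \<bar>B\<bar>"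
      using order_trans[OF b abs_ge_self] by (simp add: mult_left_mono)
    then show "norm (u x *\<^sub>R d\<psi> x) \<le> norm (B * u x)" by (simp add: abs_mult mult.commute)
  qed
qed

section \<open>Partition of unity\<close>

text \<open>The pieces are telescoping differences of the cutoffs, nonnegative by monotonicity. On a
  compact set the partial sums are eventually exactly 1, not just close to it; this is what makes
  the gradients cancel under a test field.\<close>

lemma cutoff_partition:
  fixes \<Omega> :: "'a::euclidean_space set"
  assumes "open \<Omega>" "bounded \<Omega>"
  obtains \<psi> :: "nat \<Rightarrow> 'a \<Rightarrow> real" and d\<psi> where
    "\<And>i. C1_grad (\<psi> i) (d\<psi> i)" "\<And>i x. 0 \<le> \<psi> i x" "\<And>i x. \<psi> i x \<le> 1"
    "\<And>n x. (\<Sum>i<n. \<psi> i x) \<le> 1"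
    "\<And>i. compact (closure {x. \<psi> i x \<noteq> 0})" "\<And>i. closure {x. \<psi> i x \<noteq> 0} \<subseteq> \<Omega>"
    "\<And>i. \<exists>B. \<forall>x. norm (d\<psi> i x) \<le> B"
    "\<And>K. compact K \<Longrightarrow> K \<subseteq> \<Omega> \<Longrightarrow> \<exists>N. \<forall>n\<ge>N. \<forall>x\<in>K. (\<Sum>i<n. \<psi> i x) = 1"
proof -
  obtain \<eta> :: "nat \<Rightarrow> 'a \<Rightarrow> real" and d\<eta> where
    \<eta>: "\<And>k. C1_grad (\<eta> k) (d\<eta> k)" "\<And>k x. 0 \<le> \<eta> k x" "\<And>k x. \<eta> k x \<le> 1" "\<And>k x. \<eta> k x \<le> \<eta> (Suc k) x"
    "\<And>k. compact (closure {x. \<eta> k x \<noteq> 0})" "\<And>k. closure {x. \<eta> k x \<noteq> 0} \<subseteq> \<Omega>"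
    "\<And>k. \<exists>B. \<forall>x. norm (d\<eta> k x) \<le> B"
    "\<And>K. compact K \<Longrightarrow> K \<subseteq> \<Omega> \<Longrightarrow> \<exists>N. \<forall>k\<ge>N. \<forall>x\<in>K. \<eta> k x = 1"
    using cutoff_sequence[OF assms] by blast
  define \<psi> where "\<psi> i = (case i of 0 \<Rightarrow> \<eta> 0 | Suc k \<Rightarrow> (\<lambda>x. \<eta> (Suc k) x - \<eta> k x))" for i
  define d\<psi> where "d\<psi> i = (case i of 0 \<Rightarrow> d\<eta> 0 | Suc k \<Rightarrow> (\<lambda>x. d\<eta> (Suc k) x - d\<eta> k x))" for i
  \<comment> \<open>The first \<open>Suc n\<close> pieces add up to \<open>\<eta> n\<close>; the
    shift returns as \<open>Suc N\<close> at the end.\<close>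
  have sum: "(\<Sum>i<Suc n. \<psi> i x) = \<eta> n x" for n x
    by (induction n) (simp_all add: \<psi>_def)
  have le: "\<psi> i x \<le> \<eta> i x" for i x using \<eta>(2) by (cases i) (simp_all add: \<psi>_def)
  have nn: "0 \<le> \<psi> i x" for i x using \<eta>(2,4) by (cases i) (simp_all add: \<psi>_def)
  have sub: "{x. \<psi> i x \<noteq> 0} \<subseteq> {x. \<eta> i x \<noteq> 0}" for i
  proof (intro subsetI CollectI)
    fix x assume "x \<in> {x. \<psi> i x \<noteq> 0}"
    then show "\<eta> i x \<noteq> 0" using le[of i x] nn[of i x] by simp
  qed
  show ?thesis
  proof (rule that[of \<psi> d\<psi>])
    fix i
    show "C1_grad (\<psi> i) (d\<psi> i)"
    proof (cases i)
      case (Suc k)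
      have "((\<lambda>x. \<eta> (Suc k) x - \<eta> k x) has_derivative (\<lambda>h. (d\<eta> (Suc k) x - d\<eta> k x) \<bullet> h)) (at x)" for x
        unfolding inner_diff_left using \<eta>(1) unfolding C1_grad_def by (intro has_derivative_diff) blast+
      moreover have "continuous_on UNIV (\<lambda>x. d\<eta> (Suc k) x - d\<eta> k x)"
        using \<eta>(1) unfolding C1_grad_def by (intro continuous_on_diff) blast+
      ultimately show ?thesis by (simp add: Suc \<psi>_def d\<psi>_def C1_grad_def)
    qed (simp add: \<psi>_def d\<psi>_def \<eta>(1))
    show "0 \<le> \<psi> i x" for x by (rule nn)
    show "\<psi> i x \<le> 1" for x using le[of i x] \<eta>(3)[of i x] by linarith
    show "compact (closure {x. \<psi> i x \<noteq> 0})"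
      using bounded_subset[OF compact_imp_bounded[OF \<eta>(5)] closure_mono[OF sub[of i]]]
      unfolding compact_eq_bounded_closed by (intro conjI closed_closure)
    show "closure {x. \<psi> i x \<noteq> 0} \<subseteq> \<Omega>" by (rule subset_trans[OF closure_mono[OF sub] \<eta>(6)])
    show "\<exists>B. \<forall>x. norm (d\<psi> i x) \<le> B"
    proof (cases i)
      case 0 then show ?thesis using \<eta>(7)[of 0] by (simp add: d\<psi>_def)
    next
      case (Suc k)
      obtain B B' where B: "\<And>x. norm (d\<eta> (Suc k) x) \<le> B" "\<And>x. norm (d\<eta> k x) \<le> B'" using \<eta>(7) by meson
      have "norm (d\<psi> i x) \<le> B + B'" for x
        unfolding Suc d\<psi>_def using norm_triangle_le_diff[OF add_mono[OF B]] by simp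
      then show ?thesis by blast
    qed
  next
    fix n x show "(\<Sum>i<n. \<psi> i x) \<le> 1"
    proof (cases n)
      case (Suc m) show ?thesis unfolding Suc sum by (rule \<eta>(3))
    qed simp
  next
    fix K assume "compact K" "K \<subseteq> \<Omega>"
    then obtain N where N: "\<forall>k\<ge>N. \<forall>x\<in>K. \<eta> k x = 1" using \<eta>(8) by blast
    have "(\<Sum>i<n. \<psi> i x) = 1" if "n \<ge> Suc N" "x \<in> K" for n x
    proof -
      obtain m where m: "n = Suc m" "m \<ge> N" using \<open>n \<ge> Suc N\<close> by (cases n) auto
      show ?thesis unfolding m sum using N m(2) that(2) by blast
    qed
    then show "\<exists>N. \<forall>n\<ge>N. \<forall>x\<in>K. (\<Sum>i<n. \<psi> i x) = 1" by blast
  qed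
qed

lemma sum_halves_le: "(\<Sum>i<n. \<delta> * (1/2) ^ Suc i) \<le> \<delta>" if "\<delta> > 0" for \<delta> :: real
proof -
  have "(\<Sum>i<n. \<delta> * (1/2) ^ Suc i) = \<delta> - \<delta> * (1/2) ^ n"
    by (induction n) (simp_all add: algebra_simps)
  then show ?thesis using that by simp
qed

section \<open>Smoothing a function of bounded variation\<close>

lemma integrable_mult_divergence:
  assumes u: "integrable lborel u" and \<phi>: "\<phi> \<in> C1c \<Omega>"
  shows "integrable lborel (\<lambda>x. u x * divergence \<phi> x)"
proof -
  obtain B where B: "\<And>x. \<bar>divergence \<phi> x\<bar> \<le> B"
    by (rule C1c_bounds[OF \<phi>]) (rule that)
  have "C1_field \<phi>" using \<phi> by (simp add: C1c_iff)
  then have "divergence \<phi> \<in> borel_measurable lborel" by (simp add: C1_field_borel(2))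
  from integrable_bounded_scaleR[OF u this B] show ?thesis
    by (simp only: real_scaleR_def mult.commute)
qed

lemma integrable_inner_C1c:
  assumes h: "integrable lborel h" and \<phi>: "\<phi> \<in> C1c \<Omega>"
  shows "integrable lborel (\<lambda>x. h x \<bullet> \<phi> x)"
proof -
  obtain B where B: "\<And>x. norm (\<phi> x) \<le> B"
    by (rule C1c_bounds[OF \<phi>]) (rule that)
  have "C1_field \<phi>" using \<phi> by (simp add: C1c_iff)
  then have "\<phi> \<in> borel_measurable lborel" by (simp add: C1_field_borel(1))
  from integrable_bounded_inner[OF h this B] show ?thesis by (simp only: inner_commute)
qed

lemma integrable_mult_cutoff:
  fixes u :: "'a::euclidean_space \<Rightarrow> real"
  assumes u: "integrable lborel u" and \<psi>: "C1_grad \<psi> d\<psi>" "\<And>x. 0 \<le> \<psi> x" "\<And>x. \<psi> x \<le> 1"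
  shows "integrable lborel (\<lambda>x. \<psi> x * u x)"
proof -
  have "\<psi> \<in> borel_measurable lborel"
    using borel_measurable_continuous_onI[OF C1_grad_continuous[OF \<psi>(1)]] by simp
  moreover have "\<bar>\<psi> x\<bar> \<le> 1" for x using \<psi>(2,3)[of x] by linarith
  ultimately have "integrable lborel (\<lambda>x. \<psi> x *\<^sub>R u x)" by (rule integrable_bounded_scaleR[OF u])
  then show ?thesis by (simp only: real_scaleR_def)
qed

section \<open>Identities and estimates for a single piece\<close>

text \<open>The product rule moves \<psi> inside the divergence at the cost of the
  \<open>d\<psi>\<close> term, and the mollified part is integrated by parts. The support of \<phi>
  is left free, so this applies to fields on the whole space, while \<open>u\<close> only meets the
  cut off field.\<close>

lemma localized_by_parts:
  fixes u :: "'a::euclidean_space \<Rightarrow> real"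
  assumes u: "integrable lborel u" and \<psi>: "C1_grad \<psi> d\<psi>" "\<And>x. 0 \<le> \<psi> x" "\<And>x. \<psi> x \<le> 1"
    and B: "\<And>x. norm (d\<psi> x) \<le> B" and e: "e > 0" and \<phi>: "\<phi> \<in> C1c \<Omega>"
  shows "(\<integral>x. (\<psi> x * u x - mconv e (\<lambda>x. \<psi> x * u x) x) * divergence \<phi> x \<partial>lborel) =
    (\<integral>x. u x * divergence (\<lambda>x. \<psi> x *\<^sub>R \<phi> x) x \<partial>lborel) +
    (\<integral>x. (dmconv e (\<lambda>x. \<psi> x * u x) x - u x *\<^sub>R d\<psi> x) \<bullet> \<phi> x \<partial>lborel)"
proof -
  let ?f = "\<lambda>x. \<psi> x * u x"
  let ?q = "\<lambda>x. u x *\<^sub>R d\<psi> x"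
  have f: "integrable lborel ?f" by (rule integrable_mult_cutoff[OF u \<psi>])
  have q: "integrable lborel ?q" by (rule integrable_scaleR_gradient[OF \<psi>(1) u B])
  have F: "C1_field \<phi>" using \<phi> by (simp add: C1c_iff)
  note i1 = integrable_mult_divergence[OF f \<phi>]
  note i2 = integrable_mult_divergence[OF integrable_mconv[OF e f] \<phi>]
  note i3 = integrable_mult_divergence[OF u C1c_scaleR[OF \<psi>(1) \<phi>]]
  note i4 = integrable_inner_C1c[OF q \<phi>]
  note i5 = integrable_inner_C1c[OF integrable_dmconv[OF e f] \<phi>]
  have "(\<integral>x. (?f x - mconv e ?f x) * divergence \<phi> x \<partial>lborel) =
      (\<integral>x. ?f x * divergence \<phi> x \<partial>lborel) - (\<integral>x. mconv e ?f x * divergence \<phi> x \<partial>lborel)"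
    unfolding left_diff_distrib by (rule Bochner_Integration.integral_diff[OF i1 i2])
  also have "(\<integral>x. mconv e ?f x * divergence \<phi> x \<partial>lborel) = - (\<integral>x. dmconv e ?f x \<bullet> \<phi> x \<partial>lborel)"
    by (rule integral_by_parts_C1(3)[OF C1_grad_mconv[OF e f] \<phi>])
  also have "(\<lambda>x. ?f x * divergence \<phi> x) = (\<lambda>x. u x * divergence (\<lambda>x. \<psi> x *\<^sub>R \<phi> x) x - ?q x \<bullet> \<phi> x)"
    unfolding C1_field_scaleR(2)[OF \<psi>(1) F] by (simp add: fun_eq_iff algebra_simps)
  also have "(\<integral>x. u x * divergence (\<lambda>x. \<psi> x *\<^sub>R \<phi> x) x - ?q x \<bullet> \<phi> x \<partial>lborel) =
      (\<integral>x. u x * divergence (\<lambda>x. \<psi> x *\<^sub>R \<phi> x) x \<partial>lborel) - (\<integral>x. ?q x \<bullet> \<phi> x \<partial>lborel)"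
    by (rule Bochner_Integration.integral_diff[OF i3 i4])
  also have "\<dots> - - (\<integral>x. dmconv e ?f x \<bullet> \<phi> x \<partial>lborel) =
      (\<integral>x. u x * divergence (\<lambda>x. \<psi> x *\<^sub>R \<phi> x) x \<partial>lborel) +
      ((\<integral>x. dmconv e ?f x \<bullet> \<phi> x \<partial>lborel) - (\<integral>x. ?q x \<bullet> \<phi> x \<partial>lborel))" by linarith
  also have "(\<integral>x. dmconv e ?f x \<bullet> \<phi> x \<partial>lborel) - (\<integral>x. ?q x \<bullet> \<phi> x \<partial>lborel) =
      (\<integral>x. (dmconv e ?f x - ?q x) \<bullet> \<phi> x \<partial>lborel)"
    unfolding inner_diff_left by (rule Bochner_Integration.integral_diff[OF i5 i4, symmetric])
  finally show ?thesis .
qed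

text \<open>Adjointness moves the mollification from \<psi> u onto \<tau>, which turns the pairing
  into \<open>u\<close> against an admissible divergence. What is left is \<tau> paired with
  \<open>u x *\<^sub>R d\<psi> x\<close> minus its mollification, and this is at most \<epsilon> by
  \<open>err\<close>.\<close>

lemma localized_duality:
  fixes u :: "'a::euclidean_space \<Rightarrow> real"
  assumes u: "integrable lborel u" and \<psi>: "C1_grad \<psi> d\<psi>" "\<And>x. 0 \<le> \<psi> x" "\<And>x. \<psi> x \<le> 1"
    and supp: "compact (closure {x. \<psi> x \<noteq> 0})"
    and B: "\<And>x. norm (d\<psi> x) \<le> B" and e: "e > 0"
    and \<tau>: "integrable lborel \<tau>" "\<And>x. norm (\<tau> x) \<le> 1"
    and err: "(\<integral>x. norm (mconv e (\<lambda>x. u x *\<^sub>R d\<psi> x) x - u x *\<^sub>R d\<psi> x) \<partial>lborel) \<le> \<epsilon>"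
  shows "- (\<integral>x. \<tau> x \<bullet> (dmconv e (\<lambda>x. \<psi> x * u x) x - u x *\<^sub>R d\<psi> x) \<partial>lborel) \<le>
     (\<integral>x. u x * divergence (\<lambda>x. \<psi> x *\<^sub>R mconv e \<tau> x) x \<partial>lborel) + \<epsilon>"
proof -
  let ?f = "\<lambda>x. \<psi> x * u x"
  let ?q = "\<lambda>x. u x *\<^sub>R d\<psi> x"
  have f: "integrable lborel ?f" by (rule integrable_mult_cutoff[OF u \<psi>])
  have q: "integrable lborel ?q" by (rule integrable_scaleR_gradient[OF \<psi>(1) u B])
  have \<tau>m: "\<tau> \<in> borel_measurable lborel" by (rule borel_measurable_integrable[OF \<tau>(1)])
  note mt = C1_field_mconv(1)[OF e \<tau>(1)]
  have mtm: "mconv e \<tau> \<in> borel_measurable lborel" using C1_field_borel(1)[OF mt] by simp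
  have \<Phi>: "(\<lambda>x. \<psi> x *\<^sub>R mconv e \<tau> x) \<in> C1c UNIV"
    by (rule C1c_scaleR_cutoff[OF \<psi>(1) mt supp]) simp
  note i1 = integrable_mult_divergence[OF u \<Phi>]
  note i2 = integrable_bounded_inner[OF q mtm norm_mconv_le[OF e \<tau>]]
  note i3 = integrable_bounded_inner[OF q \<tau>m \<tau>(2)]
  note i4 = integrable_bounded_inner[OF integrable_dmconv[OF e f] \<tau>m \<tau>(2)]
  note i5 = integrable_bounded_inner[OF integrable_mconv[OF e q] \<tau>m \<tau>(2)]
  have 1: "- (\<integral>x. \<tau> x \<bullet> dmconv e ?f x \<partial>lborel) = (\<integral>x. ?f x * divergence (mconv e \<tau>) x \<partial>lborel)"
    using integral_divergence_mconv(2)[OF e f \<tau>(1)] by (simp only: inner_commute)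
  have "(\<lambda>x. ?f x * divergence (mconv e \<tau>) x) =
      (\<lambda>x. u x * divergence (\<lambda>x. \<psi> x *\<^sub>R mconv e \<tau> x) x - mconv e \<tau> x \<bullet> ?q x)"
    unfolding C1_field_scaleR(2)[OF \<psi>(1) mt] by (simp add: fun_eq_iff algebra_simps inner_commute)
  then have 2: "(\<integral>x. ?f x * divergence (mconv e \<tau>) x \<partial>lborel) =
      (\<integral>x. u x * divergence (\<lambda>x. \<psi> x *\<^sub>R mconv e \<tau> x) x \<partial>lborel) - (\<integral>x. mconv e \<tau> x \<bullet> ?q x \<partial>lborel)"
    using Bochner_Integration.integral_diff[OF i1 i2] by (simp only:)
  have 3: "(\<integral>x. mconv e \<tau> x \<bullet> ?q x \<partial>lborel) = (\<integral>x. \<tau> x \<bullet> mconv e ?q x \<partial>lborel)"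
    by (rule mconv_adjoint[OF e \<tau>(1) q])
  have 4: "(\<integral>x. \<tau> x \<bullet> (dmconv e ?f x - ?q x) \<partial>lborel) =
     (\<integral>x. \<tau> x \<bullet> dmconv e ?f x \<partial>lborel) - (\<integral>x. \<tau> x \<bullet> ?q x \<partial>lborel)"
    unfolding inner_diff_right by (rule Bochner_Integration.integral_diff[OF i4 i3])
  have 5: "(\<integral>x. \<tau> x \<bullet> ?q x \<partial>lborel) - (\<integral>x. \<tau> x \<bullet> mconv e ?q x \<partial>lborel) =
      (\<integral>x. \<tau> x \<bullet> (?q x - mconv e ?q x) \<partial>lborel)"
    unfolding inner_diff_right by (rule Bochner_Integration.integral_diff[OF i3 i5, symmetric])
  have iq: "integrable lborel (\<lambda>x. ?q x - mconv e ?q x)"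
    by (rule Bochner_Integration.integrable_diff[OF q integrable_mconv[OF e q]])
  have "(\<integral>x. \<tau> x \<bullet> (?q x - mconv e ?q x) \<partial>lborel) \<le> (\<integral>x. norm (?q x - mconv e ?q x) \<partial>lborel)"
  proof (rule integral_mono[OF integrable_bounded_inner[OF iq \<tau>m \<tau>(2)] integrable_norm[OF iq]])
    fix x
    have "\<tau> x \<bullet> (?q x - mconv e ?q x) \<le> norm (\<tau> x) * norm (?q x - mconv e ?q x)" by (rule norm_cauchy_schwarz)
    also have "\<dots> \<le> 1 * norm (?q x - mconv e ?q x)" using \<tau>(2) by (rule mult_right_mono) simp
    finally show "\<tau> x \<bullet> (?q x - mconv e ?q x) \<le> norm (?q x - mconv e ?q x)" by simp
  qed
  also have "\<dots> \<le> \<epsilon>" using err by (simp only: norm_minus_commute)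
  finally have 6: "(\<integral>x. \<tau> x \<bullet> (?q x - mconv e ?q x) \<partial>lborel) \<le> \<epsilon>" .
  show ?thesis using 1 2 3 4 5 6 by linarith
qed

text \<open>A sign field of modulus one must be integrable to be mollified. The ball found here
  permits truncating it without changing its pairing with the localized field.\<close>

lemma localized_gradient_support:
  fixes u :: "'a::euclidean_space \<Rightarrow> real"
  assumes "bounded \<Omega>" "\<And>x. x \<notin> \<Omega> \<Longrightarrow> u x = 0" and e: "e > 0"
  obtains R where "\<And>x. norm x > R \<Longrightarrow> dmconv e (\<lambda>x. \<psi> x * u x) x - u x *\<^sub>R d\<psi> x = 0"
proof -
  obtain R where R: "\<And>x. x \<in> \<Omega> \<Longrightarrow> norm x \<le> R" using assms(1) unfolding bounded_iff by blast
  have u0: "u x = 0" if "norm x > R" for x using R[of x] assms(2)[of x] that by linarith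
  have "dmconv e (\<lambda>x. \<psi> x * u x) x - u x *\<^sub>R d\<psi> x = 0" if x: "norm x > R + e" for x
  proof -
    have z: "(\<psi> y * u y) *\<^sub>R dmoll e (x - y) = 0" for y
    proof (cases "norm y > R")
      case True then show ?thesis by (simp add: u0)
    next
      case False
      then have "norm (x - y) \<ge> e" using x norm_triangle_ineq2[of x y] by linarith
      then show ?thesis by (simp add: dmoll_eq_0[OF e])
    qed
    have "dmconv e (\<lambda>x. \<psi> x * u x) x = 0" unfolding dmconv_def z by simp
    moreover have "u x = 0" using x e by (intro u0) linarith
    ultimately show ?thesis by simp
  qed
  then show ?thesis by (rule that)
qed

text \<open>The same radius has to serve twice: the first error makes the series for
  \<open>W\<close> summable, the second is the error term of the duality estimate.\<close>

lemma mollification_radius: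
  fixes f :: "'a::euclidean_space \<Rightarrow> 'b::{banach,second_countable_topology}"
    and q :: "'a \<Rightarrow> 'c::{banach,second_countable_topology}"
  assumes f: "integrable lborel f" and q: "integrable lborel q" and "\<delta> > 0"
  shows "\<exists>e>0. (\<integral>x. norm (mconv e f x - f x) \<partial>lborel) \<le> \<delta> \<and> (\<integral>x. norm (mconv e q x - q x) \<partial>lborel) \<le> \<delta>"
proof -
  obtain d1 where d1: "d1 > 0" "\<And>e. 0 < e \<Longrightarrow> e < d1 \<Longrightarrow> (\<integral>x. norm (mconv e f x - f x) \<partial>lborel) \<le> \<delta>"
    by (rule mconv_L1_approx[OF f \<open>\<delta> > 0\<close>]) (rule that)
  obtain d2 where d2: "d2 > 0" "\<And>e. 0 < e \<Longrightarrow> e < d2 \<Longrightarrow> (\<integral>x. norm (mconv e q x - q x) \<partial>lborel) \<le> \<delta>"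
    by (rule mconv_L1_approx[OF q \<open>\<delta> > 0\<close>]) (rule that)
  have "0 < min d1 d2 / 2" "min d1 d2 / 2 < d1" "min d1 d2 / 2 < d2" using d1(1) d2(1) by auto
  with d1(2) d2(2) show ?thesis by blast
qed

section \<open>Summation of the pieces\<close>

text \<open>\<open>W\<close> and \<open>H\<close> are the L1 sums of the \<open>w i\<close> and
  \<open>h i\<close> below, so \<open>u - W\<close> is the v of the overview and \<open>H\<close>
  its weak gradient in \<Omega>. In the last bound one \<open>V\<close> comes from testing
  \<open>u\<close>, and \<open>V + \<delta>\<close> from the norms of the
  \<open>h i\<close>.\<close>

lemma BV_smooth_decomposition:
  fixes u :: "'a::euclidean_space \<Rightarrow> real"
  assumes \<Omega>: "open \<Omega>" "bounded \<Omega>" and u: "integrable lborel u" and u0: "\<And>x. x \<notin> \<Omega> \<Longrightarrow> u x = 0"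
    and V: "\<And>\<phi>. \<phi> \<in> C1c \<Omega> \<Longrightarrow> (\<And>x. norm (\<phi> x) \<le> 1) \<Longrightarrow> (\<integral>x. u x * divergence \<phi> x \<partial>lborel) \<le> V"
    and \<delta>: "\<delta> > 0"
  obtains W H where "integrable lborel W" "integrable lborel H"
    "(\<integral>x. norm (W x) \<partial>lborel) \<le> \<delta>" "(\<integral>x. norm (H x) \<partial>lborel) \<le> V + \<delta>"
    "\<And>\<phi>. \<phi> \<in> C1c \<Omega> \<Longrightarrow> (\<integral>x. (u x - W x) * divergence \<phi> x \<partial>lborel) = - (\<integral>x. H x \<bullet> \<phi> x \<partial>lborel)"
    "\<forall>\<phi>\<in>C1c UNIV. (\<forall>x. norm (\<phi> x) \<le> 1) \<longrightarrow> (\<integral>x. W x * divergence \<phi> x \<partial>lborel) \<le> 2 * V + \<delta>"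
proof -
  obtain \<psi> :: "nat \<Rightarrow> 'a \<Rightarrow> real" and d\<psi> where
    \<psi>: "\<And>i. C1_grad (\<psi> i) (d\<psi> i)" "\<And>i x. 0 \<le> \<psi> i x" "\<And>i x. \<psi> i x \<le> 1"
    and \<psi>_sum: "\<And>n x. (\<Sum>i<n. \<psi> i x) \<le> 1"
    and \<psi>_supp: "\<And>i. compact (closure {x. \<psi> i x \<noteq> 0})" "\<And>i. closure {x. \<psi> i x \<noteq> 0} \<subseteq> \<Omega>"
    and d\<psi>_bound: "\<And>i. \<exists>B. \<forall>x. norm (d\<psi> i x) \<le> B"
    and \<psi>_one: "\<And>K. compact K \<Longrightarrow> K \<subseteq> \<Omega> \<Longrightarrow> \<exists>N. \<forall>n\<ge>N. \<forall>x\<in>K. (\<Sum>i<n. \<psi> i x) = 1"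
    by (rule cutoff_partition[OF \<Omega>]) (rule that)
  obtain B where B: "\<And>i x. norm (d\<psi> i x) \<le> B i" using choice[of "\<lambda>i B. \<forall>x. norm (d\<psi> i x) \<le> B"] d\<psi>_bound by blast
  define f where "f i x = \<psi> i x * u x" for i x
  define q where "q i x = u x *\<^sub>R d\<psi> i x" for i x
  have f: "integrable lborel (f i)" for i
    unfolding f_def[abs_def] by (rule integrable_mult_cutoff[OF u \<psi>])
  have q: "integrable lborel (q i)" for i
    unfolding q_def[abs_def] by (rule integrable_scaleR_gradient[OF \<psi>(1) u B])
  have "\<exists>e. \<forall>i. e i > 0 \<and> (\<integral>x. norm (mconv (e i) (f i) x - f i x) \<partial>lborel) \<le> \<delta> * (1/2) ^ Suc i \<and>
      (\<integral>x. norm (mconv (e i) (q i) x - q i x) \<partial>lborel) \<le> \<delta> * (1/2) ^ Suc i"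
    by (intro choice allI mollification_radius[OF f q]) (simp add: \<delta>)
  then obtain e where e: "\<And>i. e i > 0"
    and ef: "\<And>i. (\<integral>x. norm (mconv (e i) (f i) x - f i x) \<partial>lborel) \<le> \<delta> * (1/2) ^ Suc i"
    and eq: "\<And>i. (\<integral>x. norm (mconv (e i) (q i) x - q i x) \<partial>lborel) \<le> \<delta> * (1/2) ^ Suc i" by blast
  define w where "w i x = f i x - mconv (e i) (f i) x" for i x
  \<comment> \<open>Formally the gradient of the mollified piece is the mollification of \<psi>_i Du
    plus that of \<open>q i\<close>. Subtracting \<open>q i\<close> leaves a variation part and a
    mollification error that was made small.\<close>
  define h where "h i x = dmconv (e i) (f i) x - q i x" for i x
  have w: "integrable lborel (w i)" for i
    unfolding w_def[abs_def] by (rule Bochner_Integration.integrable_diff[OF f integrable_mconv[OF e f]])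
  have h: "integrable lborel (h i)" for i
    unfolding h_def[abs_def] by (rule Bochner_Integration.integrable_diff[OF integrable_dmconv[OF e f] q])
  have w_sum: "(\<Sum>i<n. \<integral>x. norm (w i x) \<partial>lborel) \<le> \<delta>" for n
  proof -
    have "(\<Sum>i<n. \<integral>x. norm (w i x) \<partial>lborel) \<le> (\<Sum>i<n. \<delta> * (1/2) ^ Suc i)"
      unfolding w_def by (subst norm_minus_commute) (rule sum_mono[OF ef])
    also have "\<dots> \<le> \<delta>" by (rule sum_halves_le[OF \<delta>])
    finally show ?thesis .
  qed
  have h_sum: "(\<Sum>i<n. \<integral>x. norm (h i x) \<partial>lborel) \<le> V + \<delta>" for n
  proof -
    have "\<exists>R. \<forall>i. \<forall>x. norm x > R i \<longrightarrow> h i x = 0"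
    proof (rule choice, rule allI)
      fix i
      obtain R where "\<And>x. norm x > R \<Longrightarrow> dmconv (e i) (\<lambda>x. \<psi> i x * u x) x - u x *\<^sub>R d\<psi> i x = 0"
        by (rule localized_gradient_support[where u = u and e = "e i" and \<psi> = "\<psi> i" and d\<psi> = "d\<psi> i", OF \<Omega>(2) _ e], erule u0, rule that)
      then show "\<exists>R. \<forall>x. norm x > R \<longrightarrow> h i x = 0" unfolding h_def f_def[abs_def] q_def by blast
    qed
    then obtain R where R: "\<And>i x. norm x > R i \<Longrightarrow> h i x = 0" by blast
    \<comment> \<open>The minus sign matches the orientation of the duality estimate; the ball
      contains all of \<open>h i\<close> and makes the sign field integrable.\<close>
    define \<tau> where "\<tau> i x = - (indicator (cball 0 (R i)) x *\<^sub>R sgn (h i x))" for i x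
    have sgnm: "sgn \<in> borel_measurable (borel :: 'a measure)"
    proof -
      have "(\<lambda>x::'a. x /\<^sub>R norm x) \<in> borel_measurable borel" by measurable
      then show ?thesis by (simp only: sgn_div_norm[abs_def])
    qed
    have \<tau>_bd: "norm (\<tau> i x) \<le> 1" for i x
      by (simp add: \<tau>_def norm_sgn indicator_def)
    have \<tau>_int: "integrable lborel (\<tau> i)" for i
    proof (rule Bochner_Integration.integrable_bound)
      show "integrable lborel (indicator (cball (0::'a) (R i)) :: 'a \<Rightarrow> real)"
        by (rule integrable_real_indicator) (simp, rule emeasure_bounded_finite[OF bounded_cball])
      have [measurable]: "cball (0::'a) (R i) \<in> sets borel" by (simp add: borel_closed)
      have [measurable]: "(\<lambda>x. sgn (h i x)) \<in> borel_measurable lborel"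
        by (rule measurable_compose[OF borel_measurable_integrable[OF h] sgnm])
      show "\<tau> i \<in> borel_measurable lborel" unfolding \<tau>_def[abs_def] by measurable
      show "AE x in lborel. norm (\<tau> i x) \<le> norm (indicator (cball 0 (R i)) x :: real)"
        by (rule AE_I2) (simp add: \<tau>_def norm_sgn indicator_def)
    qed
    have \<tau>_h: "- (\<tau> i x \<bullet> h i x) = norm (h i x)" for i x
    proof (cases "norm x > R i")
      case True then show ?thesis by (simp add: R)
    next
      case False
      then have "- (\<tau> i x \<bullet> h i x) = sgn (h i x) \<bullet> h i x" by (simp add: \<tau>_def)
      also have "\<dots> = norm (h i x)"
        by (cases "h i x = 0") (simp_all add: sgn_div_norm power2_norm_eq_inner[symmetric] power2_eq_square)
      finally show ?thesis .
    qed
    \<comment> \<open>The cutoff stands outside the mollification: it keeps the support inside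
      \<Omega> whatever the radius, and the pointwise norms of the \<open>\<Phi> i\<close> sum to at
      most the sum of the \<open>\<psi> i\<close>.\<close>
    define \<Phi> where "\<Phi> i x = \<psi> i x *\<^sub>R mconv (e i) (\<tau> i) x" for i x
    have \<Phi>: "\<Phi> i \<in> C1c \<Omega>" for i
      unfolding \<Phi>_def[abs_def] by (rule C1c_scaleR_cutoff[OF \<psi>(1) C1_field_mconv(1)[OF e \<tau>_int] \<psi>_supp])
    have "(\<integral>x. norm (h i x) \<partial>lborel) \<le> (\<integral>x. u x * divergence (\<Phi> i) x \<partial>lborel) + \<delta> * (1/2) ^ Suc i" for i
    proof -
      have "(\<integral>x. norm (h i x) \<partial>lborel) = - (\<integral>x. \<tau> i x \<bullet> h i x \<partial>lborel)"
        unfolding \<tau>_h[symmetric] by simp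
      also have "\<dots> \<le> (\<integral>x. u x * divergence (\<Phi> i) x \<partial>lborel) + \<delta> * (1/2) ^ Suc i"
        unfolding h_def f_def[abs_def] q_def \<Phi>_def[abs_def]
        by (rule localized_duality[OF u \<psi> \<psi>_supp(1) B e \<tau>_int \<tau>_bd eq[unfolded q_def[abs_def]]])
      finally show ?thesis .
    qed
    then have "(\<Sum>i<n. \<integral>x. norm (h i x) \<partial>lborel) \<le>
        (\<Sum>i<n. (\<integral>x. u x * divergence (\<Phi> i) x \<partial>lborel) + \<delta> * (1/2) ^ Suc i)"
      by (rule sum_mono)
    also have "\<dots> = (\<Sum>i<n. \<integral>x. u x * divergence (\<Phi> i) x \<partial>lborel) + (\<Sum>i<n. \<delta> * (1/2) ^ Suc i)"
      by (rule sum.distrib)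
    also have "(\<Sum>i<n. \<integral>x. u x * divergence (\<Phi> i) x \<partial>lborel) = (\<integral>x. (\<Sum>i<n. u x * divergence (\<Phi> i) x) \<partial>lborel)"
      by (rule Bochner_Integration.integral_sum[symmetric]) (rule integrable_mult_divergence[OF u \<Phi>])
    also have "\<dots> = (\<integral>x. u x * divergence (\<lambda>x. \<Sum>i<n. \<Phi> i x) x \<partial>lborel)"
      unfolding C1c_sum(2)[OF \<Phi>] by (simp only: sum_distrib_left)
    \<comment> \<open>The sum of the \<open>\<Phi> i\<close> is one admissible field, so
      \<open>V\<close> is paid once for all pieces rather than once for each.\<close>
    also have "\<dots> \<le> V"
    proof (rule V[OF C1c_sum(1)[OF \<Phi>]])
      fix x
      have "norm (\<Sum>i<n. \<Phi> i x) \<le> (\<Sum>i<n. \<psi> i x)"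
      proof (rule sum_norm_le)
        fix i
        have "norm (mconv (e i) (\<tau> i) x) \<le> 1" by (rule norm_mconv_le[OF e \<tau>_int \<tau>_bd])
        then show "norm (\<Phi> i x) \<le> \<psi> i x"
          using mult_left_mono[OF _ \<psi>(2)[of i x], of _ 1] \<psi>(2)[of i x] by (simp add: \<Phi>_def)
      qed
      also have "\<dots> \<le> 1" by (rule \<psi>_sum)
      finally show "norm (\<Sum>i<n. \<Phi> i x) \<le> 1" .
    qed
    also have "(\<Sum>i<n. \<delta> * (1/2) ^ Suc i) \<le> \<delta>" by (rule sum_halves_le[OF \<delta>])
    finally show ?thesis by simp
  qed
  obtain W where W: "integrable lborel W" "(\<integral>x. norm (W x) \<partial>lborel) \<le> \<delta>"
    "(\<lambda>n. \<integral>x. norm (W x - (\<Sum>i<n. w i x)) \<partial>lborel) \<longlonglongrightarrow> 0"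
    by (rule L1_series[OF w w_sum]) (rule that)
  obtain H where H: "integrable lborel H" "(\<integral>x. norm (H x) \<partial>lborel) \<le> V + \<delta>"
    "(\<lambda>n. \<integral>x. norm (H x - (\<Sum>i<n. h i x)) \<partial>lborel) \<longlonglongrightarrow> 0"
    by (rule L1_series[OF h h_sum]) (rule that)
  have sw: "integrable lborel (\<lambda>x. \<Sum>i<n. w i x)" for n by (rule Bochner_Integration.integrable_sum[OF w])
  have sh: "integrable lborel (\<lambda>x. \<Sum>i<n. h i x)" for n by (rule Bochner_Integration.integrable_sum[OF h])
  define \<Psi> where "\<Psi> \<phi> n x = (\<Sum>i<n. \<psi> i x *\<^sub>R \<phi> x)" for \<phi> :: "'a \<Rightarrow> 'a" and n x
  have \<Psi>: "\<Psi> \<phi> n \<in> C1c \<Omega>" if "C1_field \<phi>" for \<phi> n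
    unfolding \<Psi>_def[abs_def] by (rule C1c_sum(1)[OF C1c_scaleR_cutoff[OF \<psi>(1) that \<psi>_supp]])
  \<comment> \<open>Stated for fields on the whole space, so that it yields both the weak gradient
    in \<Omega> and the variation of \<open>W\<close> across the boundary. The inner product of
    reals is the form in which the limit lemma applies.\<close>
  have key: "(\<integral>x. divergence \<phi> x \<bullet> (\<Sum>i<n. w i x) \<partial>lborel) =
      (\<integral>x. u x * divergence (\<Psi> \<phi> n) x \<partial>lborel) + (\<integral>x. \<phi> x \<bullet> (\<Sum>i<n. h i x) \<partial>lborel)"
    if \<phi>: "\<phi> \<in> C1c UNIV" for \<phi> n
  proof -
    have F: "C1_field \<phi>" using \<phi> by (simp add: C1c_iff)
    note p = C1c_scaleR_cutoff[OF \<psi>(1) F \<psi>_supp]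
    have "(\<integral>x. divergence \<phi> x \<bullet> (\<Sum>i<n. w i x) \<partial>lborel) = (\<integral>x. (\<Sum>i<n. w i x * divergence \<phi> x) \<partial>lborel)"
      by (simp only: inner_real_def sum_distrib_left mult.commute)
    also have "\<dots> = (\<Sum>i<n. \<integral>x. w i x * divergence \<phi> x \<partial>lborel)"
      by (rule Bochner_Integration.integral_sum) (rule integrable_mult_divergence[OF w \<phi>])
    also have "\<dots> = (\<Sum>i<n. (\<integral>x. u x * divergence (\<lambda>x. \<psi> i x *\<^sub>R \<phi> x) x \<partial>lborel) + (\<integral>x. h i x \<bullet> \<phi> x \<partial>lborel))"
      unfolding w_def h_def f_def[abs_def] q_def
      by (rule sum.cong[OF refl]) (rule localized_by_parts[OF u \<psi> B e \<phi>])
    also have "\<dots> = (\<Sum>i<n. \<integral>x. u x * divergence (\<lambda>x. \<psi> i x *\<^sub>R \<phi> x) x \<partial>lborel) + (\<Sum>i<n. \<integral>x. h i x \<bullet> \<phi> x \<partial>lborel)"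
      by (rule sum.distrib)
    also have "(\<Sum>i<n. \<integral>x. u x * divergence (\<lambda>x. \<psi> i x *\<^sub>R \<phi> x) x \<partial>lborel) =
        (\<integral>x. (\<Sum>i<n. u x * divergence (\<lambda>x. \<psi> i x *\<^sub>R \<phi> x) x) \<partial>lborel)"
      by (rule Bochner_Integration.integral_sum[symmetric]) (rule integrable_mult_divergence[OF u p])
    also have "\<dots> = (\<integral>x. u x * divergence (\<Psi> \<phi> n) x \<partial>lborel)"
      unfolding \<Psi>_def[abs_def] C1c_sum(2)[OF p] by (simp only: sum_distrib_left)
    also have "(\<Sum>i<n. \<integral>x. h i x \<bullet> \<phi> x \<partial>lborel) = (\<integral>x. (\<Sum>i<n. h i x \<bullet> \<phi> x) \<partial>lborel)"
      by (rule Bochner_Integration.integral_sum[symmetric]) (rule integrable_inner_C1c[OF h \<phi>])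
    also have "\<dots> = (\<integral>x. \<phi> x \<bullet> (\<Sum>i<n. h i x) \<partial>lborel)"
      by (simp only: inner_sum_right inner_commute)
    finally show ?thesis .
  qed
  have limW: "(\<lambda>n. \<integral>x. divergence \<phi> x \<bullet> (\<Sum>i<n. w i x) \<partial>lborel) \<longlonglongrightarrow> (\<integral>x. divergence \<phi> x \<bullet> W x \<partial>lborel)"
    and limH: "(\<lambda>n. \<integral>x. \<phi> x \<bullet> (\<Sum>i<n. h i x) \<partial>lborel) \<longlonglongrightarrow> (\<integral>x. \<phi> x \<bullet> H x \<partial>lborel)"
    if \<phi>: "\<phi> \<in> C1c UNIV" for \<phi>
  proof -
    have F: "C1_field \<phi>" using \<phi> by (simp add: C1c_iff)
    have m: "\<phi> \<in> borel_measurable lborel" "divergence \<phi> \<in> borel_measurable lborel"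
      using C1_field_borel[OF F] by simp_all
    obtain C where C: "\<And>x. norm (\<phi> x) \<le> C" "\<And>x. \<bar>divergence \<phi> x\<bar> \<le> C"
      by (rule C1c_bounds[OF \<phi>]) (rule that)
    show "(\<lambda>n. \<integral>x. divergence \<phi> x \<bullet> (\<Sum>i<n. w i x) \<partial>lborel) \<longlonglongrightarrow> (\<integral>x. divergence \<phi> x \<bullet> W x \<partial>lborel)"
      by (rule L1_limit_inner[OF W(1) sw W(3) m(2)]) (use C(2) in \<open>simp only: real_norm_def\<close>)
    show "(\<lambda>n. \<integral>x. \<phi> x \<bullet> (\<Sum>i<n. h i x) \<partial>lborel) \<longlonglongrightarrow> (\<integral>x. \<phi> x \<bullet> H x \<partial>lborel)"
      by (rule L1_limit_inner[OF H(1) sh H(3) m(1) C(1)])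
  qed
  show ?thesis
  proof (rule that[OF W(1) H(1) W(2) H(2)])
    fix \<phi> assume \<phi>\<Omega>: "\<phi> \<in> C1c \<Omega>"
    then have \<phi>: "\<phi> \<in> C1c UNIV" using C1c_mono[of \<Omega> UNIV] by blast
    have K: "compact (closure {x. \<phi> x \<noteq> 0})" "closure {x. \<phi> x \<noteq> 0} \<subseteq> \<Omega>" using \<phi>\<Omega> unfolding C1c_iff by blast+
    \<comment> \<open>From \<open>N\<close> on, the cutoffs sum to 1 on the support of \<phi>, so
      \<open>\<Psi> \<phi> n\<close> is \<phi> itself and the gradients of the cutoffs have
      disappeared.\<close>
    obtain N where N: "\<And>n x. n \<ge> N \<Longrightarrow> x \<in> closure {x. \<phi> x \<noteq> 0} \<Longrightarrow> (\<Sum>i<n. \<psi> i x) = 1"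
      using \<psi>_one[OF K] by blast
    have "\<Psi> \<phi> n = \<phi>" if "n \<ge> N" for n
    proof
      fix x
      have eq: "\<Psi> \<phi> n x = (\<Sum>i<n. \<psi> i x) *\<^sub>R \<phi> x" unfolding \<Psi>_def by (rule scaleR_sum_left[symmetric])
      show "\<Psi> \<phi> n x = \<phi> x"
      proof (cases "\<phi> x = 0")
        case False
        then have "x \<in> closure {x. \<phi> x \<noteq> 0}" by (intro subsetD[OF closure_subset] CollectI)
        from N[OF that this] show ?thesis unfolding eq by simp
      qed (simp add: eq)
    qed
    then have "\<forall>\<^sub>F n in sequentially. (\<integral>x. u x * divergence \<phi> x \<partial>lborel) + (\<integral>x. \<phi> x \<bullet> (\<Sum>i<n. h i x) \<partial>lborel)
       = (\<integral>x. divergence \<phi> x \<bullet> (\<Sum>i<n. w i x) \<partial>lborel)"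
      unfolding key[OF \<phi>] eventually_sequentially by (intro exI[of _ N]) simp
    from Lim_transform_eventually[OF tendsto_add[OF tendsto_const limH[OF \<phi>]] this]
    have "(\<integral>x. divergence \<phi> x \<bullet> W x \<partial>lborel) = (\<integral>x. u x * divergence \<phi> x \<partial>lborel) + (\<integral>x. \<phi> x \<bullet> H x \<partial>lborel)"
      by (rule LIMSEQ_unique[OF limW[OF \<phi>]])
    moreover have "(\<integral>x. (u x - W x) * divergence \<phi> x \<partial>lborel) =
        (\<integral>x. u x * divergence \<phi> x \<partial>lborel) - (\<integral>x. W x * divergence \<phi> x \<partial>lborel)"
      unfolding left_diff_distrib
      by (rule Bochner_Integration.integral_diff[OF integrable_mult_divergence[OF u \<phi>] integrable_mult_divergence[OF W(1) \<phi>]])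
    moreover have "(\<integral>x. divergence \<phi> x \<bullet> W x \<partial>lborel) = (\<integral>x. W x * divergence \<phi> x \<partial>lborel)"
      by (simp only: inner_real_def mult.commute)
    moreover have "(\<integral>x. \<phi> x \<bullet> H x \<partial>lborel) = (\<integral>x. H x \<bullet> \<phi> x \<partial>lborel)" by (simp only: inner_commute)
    ultimately show "(\<integral>x. (u x - W x) * divergence \<phi> x \<partial>lborel) = - (\<integral>x. H x \<bullet> \<phi> x \<partial>lborel)" by linarith
  next
    show "\<forall>\<phi>\<in>C1c UNIV. (\<forall>x. norm (\<phi> x) \<le> 1) \<longrightarrow> (\<integral>x. W x * divergence \<phi> x \<partial>lborel) \<le> 2 * V + \<delta>"
    proof (intro ballI impI)
      fix \<phi> :: "'a \<Rightarrow> 'a" assume \<phi>: "\<phi> \<in> C1c UNIV" and "\<forall>x. norm (\<phi> x) \<le> 1"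
      then have bd: "\<And>x. norm (\<phi> x) \<le> 1" by blast
      have F: "C1_field \<phi>" using \<phi> by (simp add: C1c_iff)
      have m: "\<phi> \<in> borel_measurable lborel" using C1_field_borel(1)[OF F] by simp
      \<comment> \<open>A field crossing the boundary may never coincide with its cut off version.
        The term with \<open>u\<close> is therefore only bounded, uniformly in \<open>n\<close>,
        before the limit is taken on the left.\<close>
      have "(\<integral>x. divergence \<phi> x \<bullet> (\<Sum>i<n. w i x) \<partial>lborel) \<le> V + (V + \<delta>)" for n
      proof -
        have "(\<integral>x. u x * divergence (\<Psi> \<phi> n) x \<partial>lborel) \<le> V"
        proof (rule V[OF \<Psi>[OF F]])
          fix x
          have "norm (\<Psi> \<phi> n x) = (\<Sum>i<n. \<psi> i x) * norm (\<phi> x)"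
            unfolding \<Psi>_def scaleR_sum_left[symmetric] using sum_nonneg[of "{..<n}" "\<lambda>i. \<psi> i x"] \<psi>(2) by simp
          also have "\<dots> \<le> 1" using \<psi>_sum bd by (intro mult_le_one) simp_all
          finally show "norm (\<Psi> \<phi> n x) \<le> 1" .
        qed
        moreover have "(\<integral>x. \<phi> x \<bullet> (\<Sum>i<n. h i x) \<partial>lborel) \<le> V + \<delta>"
        proof -
          have "(\<integral>x. \<phi> x \<bullet> (\<Sum>i<n. h i x) \<partial>lborel) \<le> (\<integral>x. (\<Sum>i<n. norm (h i x)) \<partial>lborel)"
          proof (rule integral_mono[OF integrable_bounded_inner[OF sh m bd]])
            show "integrable lborel (\<lambda>x. \<Sum>i<n. norm (h i x))"
              by (intro Bochner_Integration.integrable_sum integrable_norm h)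
            fix x
            have "\<phi> x \<bullet> (\<Sum>i<n. h i x) \<le> norm (\<phi> x) * norm (\<Sum>i<n. h i x)" by (rule norm_cauchy_schwarz)
            also have "\<dots> \<le> 1 * norm (\<Sum>i<n. h i x)" using bd by (rule mult_right_mono) simp
            also have "\<dots> \<le> (\<Sum>i<n. norm (h i x))" using norm_sum by simp
            finally show "\<phi> x \<bullet> (\<Sum>i<n. h i x) \<le> (\<Sum>i<n. norm (h i x))" .
          qed
          also have "\<dots> = (\<Sum>i<n. \<integral>x. norm (h i x) \<partial>lborel)"
            by (rule Bochner_Integration.integral_sum) (rule integrable_norm[OF h])
          also have "\<dots> \<le> V + \<delta>" by (rule h_sum)
          finally show ?thesis .
        qed
        ultimately show ?thesis unfolding key[OF \<phi>] by (rule add_mono)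
      qed
      then have "(\<integral>x. divergence \<phi> x \<bullet> W x \<partial>lborel) \<le> V + (V + \<delta>)"
        by (intro LIMSEQ_le_const2[OF limW[OF \<phi>]] exI allI impI)
      then show "(\<integral>x. W x * divergence \<phi> x \<partial>lborel) \<le> 2 * V + \<delta>"
        by (simp only: inner_real_def mult.commute)
    qed
  qed
qed

section \<open>Weak gradients and total variation on a domain\<close>

lemma borel_measurable_lebesgue_on_borel:
  "f \<in> borel_measurable borel \<Longrightarrow> f \<in> borel_measurable (lebesgue_on \<Omega>)"
  by (intro measurable_restrict_space1 measurable_completion) simp

lemma lebesgue_on_lborel:
  fixes f :: "'a::euclidean_space \<Rightarrow> 'b::euclidean_space"
  assumes \<Omega>: "\<Omega> \<in> sets borel" and f: "f \<in> borel_measurable borel" and z: "\<And>x. x \<notin> \<Omega> \<Longrightarrow> f x = 0"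
  shows integral_lebesgue_on_lborel: "integral\<^sup>L (lebesgue_on \<Omega>) f = integral\<^sup>L lborel f"
    and integrable_lebesgue_on_lborel: "integrable (lebesgue_on \<Omega>) f \<longleftrightarrow> integrable lborel f"
proof -
  have \<Omega>': "\<Omega> \<inter> space lebesgue \<in> sets lebesgue" using \<Omega> by simp
  have eq: "(\<lambda>x. indicator \<Omega> x *\<^sub>R f x) = f" using z by (auto simp: fun_eq_iff indicator_def)
  have f': "f \<in> borel_measurable lborel" using f by simp
  show "integral\<^sup>L (lebesgue_on \<Omega>) f = integral\<^sup>L lborel f"
    unfolding integral_restrict_space[OF \<Omega>'] eq by (rule integral_completion[OF f'])
  show "integrable (lebesgue_on \<Omega>) f \<longleftrightarrow> integrable lborel f"
    unfolding integrable_restrict_space[OF \<Omega>'] eq by (rule integrable_completion[OF f'])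
qed

lemma integrable_lborel_imp_lebesgue_on:
  fixes f :: "'a::euclidean_space \<Rightarrow> 'b::euclidean_space"
  assumes \<Omega>: "\<Omega> \<in> sets borel" and f: "integrable lborel f"
  shows "integrable (lebesgue_on \<Omega>) f" and "L1_norm \<Omega> f \<le> (\<integral>x. norm (f x) \<partial>lborel)"
proof -
  have \<Omega>': "\<Omega> \<inter> space lebesgue \<in> sets lebesgue" using \<Omega> by simp
  have i: "integrable lborel (\<lambda>x. indicator \<Omega> x *\<^sub>R f x)"
    by (rule integrable_mult_indicator) (use \<Omega> f in simp_all)
  then show "integrable (lebesgue_on \<Omega>) f"
    unfolding integrable_restrict_space[OF \<Omega>'] by (subst integrable_completion) (rule borel_measurable_integrable)
  have i2: "integrable lborel (\<lambda>x. indicator \<Omega> x *\<^sub>R norm (f x))"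
    by (rule integrable_mult_indicator) (use \<Omega> f in simp_all)
  have "L1_norm \<Omega> f = (\<integral>x. indicator \<Omega> x *\<^sub>R norm (f x) \<partial>lborel)"
    unfolding L1_norm_def integral_restrict_space[OF \<Omega>']
    by (rule integral_completion[OF borel_measurable_integrable[OF i2]])
  also have "\<dots> \<le> (\<integral>x. norm (f x) \<partial>lborel)"
    by (rule integral_mono[OF i2 integrable_norm[OF f]]) (simp add: indicator_def)
  finally show "L1_norm \<Omega> f \<le> (\<integral>x. norm (f x) \<partial>lborel)" .
qed

text \<open>Functions on \<Omega> are only Lebesgue measurable, whereas the convolution arguments
  work in the product of two copies of \<open>lborel\<close>. A Borel version extended by zero
  connects the two settings.\<close>

lemma borel_representative:
  fixes f :: "'a::euclidean_space \<Rightarrow> real"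
  assumes \<Omega>: "\<Omega> \<in> sets borel" and f: "integrable (lebesgue_on \<Omega>) f"
  obtains f0 where "integrable lborel f0" "\<And>x. x \<notin> \<Omega> \<Longrightarrow> f0 x = 0" "AE x in lebesgue_on \<Omega>. f x = f0 x"
proof -
  have \<Omega>': "\<Omega> \<inter> space lebesgue \<in> sets lebesgue" using \<Omega> by simp
  have F: "integrable lebesgue (\<lambda>x. indicator \<Omega> x *\<^sub>R f x)"
    using f unfolding integrable_restrict_space[OF \<Omega>'] .
  obtain g where g: "g \<in> borel_measurable lborel" and ae: "AE x in lborel. indicator \<Omega> x *\<^sub>R f x = g x"
    using completion_ex_borel_measurable_real[OF borel_measurable_integrable[OF F]] by auto
  define f0 where "f0 x = indicator \<Omega> x * g x" for x
  have f0m: "f0 \<in> borel_measurable lborel" unfolding f0_def[abs_def] using g \<Omega> by simp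
  have "AE x in lborel. indicator \<Omega> x *\<^sub>R f x = f0 x"
    using ae by eventually_elim (auto simp: f0_def indicator_def split: if_splits)
  then have ae': "AE x in lebesgue. indicator \<Omega> x *\<^sub>R f x = f0 x" by (rule AE_completion)
  show ?thesis
  proof (rule that)
    have "integrable lebesgue f0"
      using F by (rule integrable_cong_AE_imp) (use ae' measurable_completion[OF f0m] in \<open>simp_all add: eq_commute\<close>)
    then show "integrable lborel f0" unfolding integrable_completion[OF f0m] .
    show "f0 x = 0" if "x \<notin> \<Omega>" for x using that by (simp add: f0_def)
    show "AE x in lebesgue_on \<Omega>. f x = f0 x"
      unfolding AE_restrict_space_iff[OF \<Omega>'] using ae' by eventually_elim (auto simp: indicator_def)
  qed
qed

lemma C1c_eq_0_outside:
  assumes \<phi>: "\<phi> \<in> C1c \<Omega>" and x: "x \<notin> \<Omega>"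
  shows "\<phi> x = 0" "divergence \<phi> x = 0"
proof -
  define S where "S = - closure {x. \<phi> x \<noteq> 0}"
  have sub: "closure {x. \<phi> x \<noteq> 0} \<subseteq> \<Omega>" using \<phi> by (simp add: C1c_iff)
  have xS: "x \<in> S" unfolding S_def using subsetD[OF sub, of x] x by blast
  have z: "\<phi> y = 0" if "y \<in> S" for y
    using that subsetD[OF closure_subset, of y "{x. \<phi> x \<noteq> 0}"] by (auto simp: S_def)
  show "\<phi> x = 0" by (rule z[OF xS])
  obtain D where D: "(\<phi> has_derivative D) (at x)" using \<phi> unfolding C1c_iff C1_field_def by auto
  have "((\<lambda>x. 0) has_derivative (\<lambda>h. 0)) (at x)" by simp
  then have "(\<phi> has_derivative (\<lambda>h. 0)) (at x)"
  proof (rule has_derivative_transform_within_open[where s = S])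
    show "open S" unfolding S_def by (rule open_Compl[OF closed_closure])
    show "0 = \<phi> y" if "y \<in> S" for y by (rule z[OF that, symmetric])
  qed (rule xS)
  from divergence_eq[OF this] show "divergence \<phi> x = 0" by simp
qed

lemma integral_lebesgue_on_test:
  fixes f :: "'a::euclidean_space \<Rightarrow> real"
  assumes \<Omega>: "\<Omega> \<in> sets borel" and \<phi>: "\<phi> \<in> C1c \<Omega>"
  shows "f \<in> borel_measurable borel \<Longrightarrow>
      (\<integral>x. f x * divergence \<phi> x \<partial>lebesgue_on \<Omega>) = (\<integral>x. f x * divergence \<phi> x \<partial>lborel)"
    and "g \<in> borel_measurable borel \<Longrightarrow>
      (\<integral>x. g x \<bullet> \<phi> x \<partial>lebesgue_on \<Omega>) = (\<integral>x. g x \<bullet> \<phi> x \<partial>lborel)"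
proof -
  have F: "C1_field \<phi>" using \<phi> by (simp add: C1c_iff)
  have [measurable]: "\<phi> \<in> borel_measurable borel" "divergence \<phi> \<in> borel_measurable borel"
    by (rule C1_field_borel[OF F])+
  show "(\<integral>x. f x * divergence \<phi> x \<partial>lebesgue_on \<Omega>) = (\<integral>x. f x * divergence \<phi> x \<partial>lborel)"
    if [measurable]: "f \<in> borel_measurable borel"
    by (rule integral_lebesgue_on_lborel[OF \<Omega>]) (measurable, simp add: C1c_eq_0_outside[OF \<phi>])
  show "(\<integral>x. g x \<bullet> \<phi> x \<partial>lebesgue_on \<Omega>) = (\<integral>x. g x \<bullet> \<phi> x \<partial>lborel)"
    if [measurable]: "g \<in> borel_measurable borel"
    by (rule integral_lebesgue_on_lborel[OF \<Omega>]) (measurable, simp add: C1c_eq_0_outside[OF \<phi>])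
qed

lemma zero_in_C1c: "(\<lambda>x. 0) \<in> C1c \<Omega>"
proof (rule C1cI[where S = "{}"])
  show "C1_field (\<lambda>x. 0)" unfolding C1_field_def by (intro exI[of _ "\<lambda>x h. 0"]) simp
qed simp_all

lemma integrable_lebesgue_on_mult_divergence:
  assumes u: "integrable (lebesgue_on \<Omega>) u" and \<phi>: "\<phi> \<in> C1c \<Omega>"
  shows "integrable (lebesgue_on \<Omega>) (\<lambda>x. u x * divergence \<phi> x)"
proof -
  have F: "C1_field \<phi>" using \<phi> by (simp add: C1c_iff)
  obtain B where B: "\<And>x. \<bar>divergence \<phi> x\<bar> \<le> B"
    by (rule C1c_bounds[OF \<phi>]) (rule that)
  have "divergence \<phi> \<in> borel_measurable (lebesgue_on \<Omega>)"
    by (rule borel_measurable_lebesgue_on_borel[OF C1_field_borel(2)[OF F]])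
  from integrable_bounded_scaleR[OF u this B] show ?thesis
    by (simp only: real_scaleR_def mult.commute)
qed

lemma integrable_lebesgue_on_inner_C1c:
  assumes u: "integrable (lebesgue_on \<Omega>) g" and \<phi>: "\<phi> \<in> C1c \<Omega>"
  shows "integrable (lebesgue_on \<Omega>) (\<lambda>x. g x \<bullet> \<phi> x)"
proof -
  have F: "C1_field \<phi>" using \<phi> by (simp add: C1c_iff)
  obtain B where B: "\<And>x. norm (\<phi> x) \<le> B"
    by (rule C1c_bounds[OF \<phi>]) (rule that)
  have "\<phi> \<in> borel_measurable (lebesgue_on \<Omega>)"
    by (rule borel_measurable_lebesgue_on_borel[OF C1_field_borel(1)[OF F]])
  from integrable_bounded_inner[OF u this B] show ?thesis by (simp only: inner_commute)
qed

section \<open>Elementary properties of the BV norm\<close>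

text \<open>The zero field is admissible. Together with \<open>< \<infinity>\<close> this rules out
  the infinite values, which \<open>real_of_ereal\<close> would send to 0.\<close>

lemma total_variation_nonneg: "0 \<le> total_variation \<Omega> u"
proof -
  have "divergence (\<lambda>x::'a. 0) = (\<lambda>x. 0)"
    using divergence_eq[of "\<lambda>x::'a. 0" "\<lambda>h. 0"] by auto
  then have "ereal 0 = ereal (\<integral>x. u x * divergence (\<lambda>x. 0) x \<partial>lebesgue_on \<Omega>)" by simp
  also have "\<dots> \<le> total_variation \<Omega> u"
    unfolding total_variation_def by (rule SUP_upper) (simp add: zero_in_C1c)
  finally show ?thesis by (simp add: zero_ereal_def)
qed

lemma BV_I:
  assumes u: "integrable (lebesgue_on \<Omega>) u"
    and c: "\<And>\<phi>. \<phi> \<in> C1c \<Omega> \<Longrightarrow> (\<And>x. norm (\<phi> x) \<le> 1) \<Longrightarrow> (\<integral>x. u x * divergence \<phi> x \<partial>lebesgue_on \<Omega>) \<le> c"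
  shows "u \<in> BV \<Omega>" "BV_norm \<Omega> u \<le> L1_norm \<Omega> u + c"
proof -
  have le: "total_variation \<Omega> u \<le> ereal c"
    unfolding total_variation_def by (rule SUP_least) (use c in auto)
  then have fin: "total_variation \<Omega> u < \<infinity>" by (rule le_less_trans) simp
  then show "u \<in> BV \<Omega>" using u by (simp add: BV_def)
  have "real_of_ereal (total_variation \<Omega> u) \<le> c"
    using real_of_ereal_positive_mono[OF total_variation_nonneg le] by simp
  then show "BV_norm \<Omega> u \<le> L1_norm \<Omega> u + c" by (simp add: BV_norm_def)
qed

lemma BV_D:
  assumes u: "u \<in> BV \<Omega>" and \<phi>: "\<phi> \<in> C1c \<Omega>" "\<And>x. norm (\<phi> x) \<le> 1"
  shows "(\<integral>x. u x * divergence \<phi> x \<partial>lebesgue_on \<Omega>) \<le> real_of_ereal (total_variation \<Omega> u)"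
proof -
  have "ereal (\<integral>x. u x * divergence \<phi> x \<partial>lebesgue_on \<Omega>) \<le> total_variation \<Omega> u"
    unfolding total_variation_def by (rule SUP_upper) (use \<phi> in simp)
  also have "total_variation \<Omega> u = ereal (real_of_ereal (total_variation \<Omega> u))"
    using u total_variation_nonneg[of \<Omega> u] by (intro ereal_real'[symmetric]) (auto simp: BV_def)
  finally show ?thesis by simp
qed

lemma L1_norm_nonneg: "0 \<le> L1_norm \<Omega> u"
  unfolding L1_norm_def by (rule Bochner_Integration.integral_nonneg) simp

lemma BV_norm_nonneg: "0 \<le> BV_norm \<Omega> u"
  unfolding BV_norm_def by (intro add_nonneg_nonneg L1_norm_nonneg real_of_ereal_pos total_variation_nonneg)

lemma L1_norm_add_le:
  assumes "integrable (lebesgue_on \<Omega>) a" "integrable (lebesgue_on \<Omega>) b"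
  shows "L1_norm \<Omega> (\<lambda>x. a x + b x) \<le> L1_norm \<Omega> a + L1_norm \<Omega> b"
proof -
  have "L1_norm \<Omega> (\<lambda>x. a x + b x) \<le> (\<integral>x. norm (a x) + norm (b x) \<partial>lebesgue_on \<Omega>)"
    unfolding L1_norm_def
    by (rule integral_mono) (use assms in \<open>simp_all add: norm_triangle_ineq\<close>)
  also have "\<dots> = L1_norm \<Omega> a + L1_norm \<Omega> b"
    unfolding L1_norm_def by (rule Bochner_Integration.integral_add) (use assms in simp_all)
  finally show ?thesis .
qed

lemma BV_add:
  assumes a: "a \<in> BV \<Omega>" and b: "b \<in> BV \<Omega>"
  shows "(\<lambda>x. a x + b x) \<in> BV \<Omega>" "BV_norm \<Omega> (\<lambda>x. a x + b x) \<le> BV_norm \<Omega> a + BV_norm \<Omega> b"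
proof -
  have ia: "integrable (lebesgue_on \<Omega>) a" and ib: "integrable (lebesgue_on \<Omega>) b"
    using a b by (simp_all add: BV_def)
  have i: "integrable (lebesgue_on \<Omega>) (\<lambda>x. a x + b x)" using ia ib by (rule Bochner_Integration.integrable_add)
  have le: "(\<integral>x. (a x + b x) * divergence \<phi> x \<partial>lebesgue_on \<Omega>) \<le>
      real_of_ereal (total_variation \<Omega> a) + real_of_ereal (total_variation \<Omega> b)"
    if "\<phi> \<in> C1c \<Omega>" "\<And>x. norm (\<phi> x) \<le> 1" for \<phi>
    unfolding distrib_right
      Bochner_Integration.integral_add[OF integrable_lebesgue_on_mult_divergence[OF ia that(1)]
        integrable_lebesgue_on_mult_divergence[OF ib that(1)]]
    by (rule add_mono[OF BV_D[OF a that] BV_D[OF b that]])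
  show "(\<lambda>x. a x + b x) \<in> BV \<Omega>" by (rule BV_I(1)[OF i le])
  have "BV_norm \<Omega> (\<lambda>x. a x + b x) \<le> L1_norm \<Omega> (\<lambda>x. a x + b x) +
     (real_of_ereal (total_variation \<Omega> a) + real_of_ereal (total_variation \<Omega> b))"
    by (rule BV_I(2)[OF i le])
  then show "BV_norm \<Omega> (\<lambda>x. a x + b x) \<le> BV_norm \<Omega> a + BV_norm \<Omega> b"
    using L1_norm_add_le[OF ia ib] unfolding BV_norm_def by linarith
qed

section \<open>Fundamental lemma and uniqueness of weak gradients\<close>

text \<open>Testing with translated kernels, cut off by \<open>\<psi> i\<close> and pointing along
  \<open>b\<close>, shows that every mollification of \<open>\<psi> i\<close> times \<open>h\<close>
  vanishes; hence so does this product. Countably many cutoffs then cover \<Omega>.\<close>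

lemma fundamental_lemma_borel:
  fixes h :: "'a::euclidean_space \<Rightarrow> real"
  assumes \<Omega>: "open \<Omega>" "bounded \<Omega>" and h: "integrable lborel h" and b: "b \<in> Basis"
    and z: "\<And>\<phi>. \<phi> \<in> C1c \<Omega> \<Longrightarrow> (\<integral>x. (h x *\<^sub>R b) \<bullet> \<phi> x \<partial>lborel) = 0"
  shows "AE x in lborel. x \<in> \<Omega> \<longrightarrow> h x = 0"
proof -
  obtain \<psi> :: "nat \<Rightarrow> 'a \<Rightarrow> real" and d\<psi> where
    \<psi>: "\<And>i. C1_grad (\<psi> i) (d\<psi> i)" "\<And>i x. 0 \<le> \<psi> i x" "\<And>i x. \<psi> i x \<le> 1"
    and \<psi>_supp: "\<And>i. compact (closure {x. \<psi> i x \<noteq> 0})" "\<And>i. closure {x. \<psi> i x \<noteq> 0} \<subseteq> \<Omega>"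
    and \<psi>_one: "\<And>K. compact K \<Longrightarrow> K \<subseteq> \<Omega> \<Longrightarrow> \<exists>N. \<forall>n\<ge>N. \<forall>x\<in>K. (\<Sum>i<n. \<psi> i x) = 1"
    by (rule cutoff_partition[OF \<Omega>]) (rule that)
  have "AE x in lborel. \<psi> i x * h x = 0" for i
  proof -
    let ?f = "\<lambda>x. \<psi> i x * h x"
    have f: "integrable lborel ?f" by (rule integrable_mult_cutoff[OF h \<psi>])
    have m0: "mconv e ?f x = 0" if e: "e > 0" for e x
    proof -
      have g: "C1_grad (\<lambda>y. moll e (y - x)) (\<lambda>y. dmoll e (y - x))"
        unfolding C1_grad_def
      proof (intro conjI allI)
        fix y
        have "((\<lambda>y. y - x) has_derivative (\<lambda>h. h)) (at y)" by (auto intro!: derivative_eq_intros)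
        from has_derivative_compose[OF this moll_has_derivative]
        show "((\<lambda>y. moll e (y - x)) has_derivative (\<bullet>) (dmoll e (y - x))) (at y)" .
        show "continuous_on UNIV (\<lambda>y. dmoll e (y - x))"
          by (rule continuous_on_compose2[OF continuous_on_dmoll]) (auto intro!: continuous_intros)
      qed
      have c: "C1_field (\<lambda>y::'a. b)" unfolding C1_field_def by (intro exI[of _ "\<lambda>x h. 0"]) simp
      \<comment> \<open>The translated kernel may reach outside \<Omega>; the factor
        \<open>\<psi> i\<close> makes it admissible and at the same time becomes part of the
        mollified function.\<close>
      have \<Phi>: "(\<lambda>y. \<psi> i y *\<^sub>R (moll e (y - x) *\<^sub>R b)) \<in> C1c \<Omega>"
        by (rule C1c_scaleR_cutoff[OF \<psi>(1) C1_field_scaleR(1)[OF g c] \<psi>_supp])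
      have "mconv e ?f x = (\<integral>y. (h y *\<^sub>R b) \<bullet> (\<psi> i y *\<^sub>R (moll e (y - x) *\<^sub>R b)) \<partial>lborel)"
        unfolding mconv_def
      proof (rule Bochner_Integration.integral_cong[OF refl])
        fix y
        have "moll e (x - y) = moll e (y - x)" using moll_minus[of e "y - x"] by simp
        then show "moll e (x - y) *\<^sub>R (\<psi> i y * h y) = (h y *\<^sub>R b) \<bullet> (\<psi> i y *\<^sub>R (moll e (y - x) *\<^sub>R b))"
          using b by simp
      qed
      also have "\<dots> = 0" by (rule z[OF \<Phi>])
      finally show ?thesis .
    qed
    \<comment> \<open>As all mollifications vanish, the approximation error is the L1 norm of
      \<open>?f\<close> itself, which is therefore arbitrarily small.\<close>
    have "(\<integral>x. norm (?f x) \<partial>lborel) \<le> 0"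
    proof (rule field_le_epsilon)
      fix \<delta> :: real assume "\<delta> > 0"
      obtain d where d: "d > 0" "\<And>e. 0 < e \<Longrightarrow> e < d \<Longrightarrow> (\<integral>x. norm (mconv e ?f x - ?f x) \<partial>lborel) \<le> \<delta>"
        by (rule mconv_L1_approx[OF f \<open>\<delta> > 0\<close>]) (rule that)
      have "d / 2 > 0" "d / 2 < d" using d(1) by simp_all
      from d(2)[OF this] show "(\<integral>x. norm (?f x) \<partial>lborel) \<le> 0 + \<delta>"
        by (simp only: m0[OF \<open>d / 2 > 0\<close>] diff_0 norm_minus_cancel add_0)
    qed
    moreover have "(\<integral>x. norm (?f x) \<partial>lborel) \<ge> 0" by (rule Bochner_Integration.integral_nonneg) simp
    ultimately have "(\<integral>x. norm (?f x) \<partial>lborel) = 0" by linarith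
    then show ?thesis
      using integral_nonneg_eq_0_iff_AE[OF integrable_norm[OF f]] by simp
  qed
  then have "AE x in lborel. \<forall>i. \<psi> i x * h x = 0" unfolding AE_all_countable by blast
  then show ?thesis
  proof eventually_elim
    case (elim x)
    show "x \<in> \<Omega> \<longrightarrow> h x = 0"
    proof
      assume "x \<in> \<Omega>"
      then obtain N where "\<forall>n\<ge>N. \<forall>y\<in>{x}. (\<Sum>i<n. \<psi> i y) = 1" using \<psi>_one[of "{x}"] by auto
      then have "(\<Sum>i<N. \<psi> i x) = 1" by simp
      then have "h x = (\<Sum>i<N. \<psi> i x) * h x" by simp
      also have "\<dots> = 0" using elim by (simp only: sum_distrib_right) simp
      finally show "h x = 0" .
    qed
  qed
qed

text \<open>The difference of the two gradients annihilates all test fields; it is treated one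
  coordinate at a time through a Borel version.\<close>

lemma weak_gradient_unique:
  fixes g G :: "'a::euclidean_space \<Rightarrow> 'a"
  assumes \<Omega>: "open \<Omega>" "bounded \<Omega>"
    and g: "integrable (lebesgue_on \<Omega>) g" "weak_gradient \<Omega> u g"
    and G: "integrable (lebesgue_on \<Omega>) G" "weak_gradient \<Omega> u G"
  shows "AE x in lebesgue_on \<Omega>. g x = G x"
proof -
  have \<Omega>b: "\<Omega> \<in> sets borel" using \<Omega>(1) by simp
  have \<Omega>': "\<Omega> \<inter> space lebesgue \<in> sets lebesgue" using \<Omega>b by simp
  have "AE x in lebesgue_on \<Omega>. (g x - G x) \<bullet> b = 0" if b: "b \<in> Basis" for b
  proof -
    have i: "integrable (lebesgue_on \<Omega>) (\<lambda>x. (g x - G x) \<bullet> b)"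
      by (intro integrable_inner_left Bochner_Integration.integrable_diff g(1) G(1))
    obtain h where h: "integrable lborel h" "\<And>x. x \<notin> \<Omega> \<Longrightarrow> h x = 0"
      "AE x in lebesgue_on \<Omega>. (g x - G x) \<bullet> b = h x"
      by (rule borel_representative[OF \<Omega>b i]) (rule that)
    have hb: "h \<in> borel_measurable borel" using borel_measurable_integrable[OF h(1)] by simp
    have "(\<integral>x. (h x *\<^sub>R b) \<bullet> \<phi> x \<partial>lborel) = 0" if \<phi>: "\<phi> \<in> C1c \<Omega>" for \<phi>
    proof -
      have F: "C1_field \<phi>" using \<phi> by (simp add: C1c_iff)
      obtain D where D: "\<And>x. (\<phi> has_derivative D x) (at x)" "\<And>v. continuous_on UNIV (\<lambda>x. D x v)"
        using F unfolding C1_field_def by auto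
      \<comment> \<open>Projecting \<phi> onto the direction \<open>b\<close> isolates the
        \<open>b\<close> component of the difference.\<close>
      have F': "C1_field (\<lambda>x. (\<phi> x \<bullet> b) *\<^sub>R b)"
        unfolding C1_field_def
        by (intro exI[of _ "\<lambda>x h. (D x h \<bullet> b) *\<^sub>R b"] conjI allI has_derivative_scaleR_left
            has_derivative_inner_left D(1) continuous_intros D(2))
      have \<phi>': "(\<lambda>x. (\<phi> x \<bullet> b) *\<^sub>R b) \<in> C1c \<Omega>"
        by (rule C1cI[OF F', of "{x. \<phi> x \<noteq> 0}"]) (use \<phi> in \<open>auto simp: C1c_def\<close>)
      have eq: "y \<bullet> ((\<phi> x \<bullet> b) *\<^sub>R b) = ((y \<bullet> b) *\<^sub>R b) \<bullet> \<phi> x" for x y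
        by (simp add: inner_commute)
      have "(\<integral>x. (h x *\<^sub>R b) \<bullet> \<phi> x \<partial>lborel) = (\<integral>x. (h x *\<^sub>R b) \<bullet> \<phi> x \<partial>lebesgue_on \<Omega>)"
        by (rule integral_lebesgue_on_test(2)[OF \<Omega>b \<phi>, symmetric]) (use hb in measurable)
      also have "\<dots> = (\<integral>x. (g x - G x) \<bullet> ((\<phi> x \<bullet> b) *\<^sub>R b) \<partial>lebesgue_on \<Omega>)"
      proof (rule integral_cong_AE)
        show "(\<lambda>x. (g x - G x) \<bullet> ((\<phi> x \<bullet> b) *\<^sub>R b)) \<in> borel_measurable (lebesgue_on \<Omega>)"
          by (rule borel_measurable_integrable[OF integrable_lebesgue_on_inner_C1c[OF Bochner_Integration.integrable_diff[OF g(1) G(1)] \<phi>']])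
        have "(\<lambda>x. (h x *\<^sub>R b) \<bullet> \<phi> x) \<in> borel_measurable borel" using hb C1_field_borel(1)[OF F] by measurable
        then show "(\<lambda>x. (h x *\<^sub>R b) \<bullet> \<phi> x) \<in> borel_measurable (lebesgue_on \<Omega>)"
          by (rule borel_measurable_lebesgue_on_borel)
        show "AE x in lebesgue_on \<Omega>. (h x *\<^sub>R b) \<bullet> \<phi> x = (g x - G x) \<bullet> ((\<phi> x \<bullet> b) *\<^sub>R b)"
          using h(3) by eventually_elim (simp only: eq)
      qed
      also have "\<dots> = (\<integral>x. g x \<bullet> ((\<phi> x \<bullet> b) *\<^sub>R b) \<partial>lebesgue_on \<Omega>) - (\<integral>x. G x \<bullet> ((\<phi> x \<bullet> b) *\<^sub>R b) \<partial>lebesgue_on \<Omega>)"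
        unfolding inner_diff_left
        by (rule Bochner_Integration.integral_diff[OF integrable_lebesgue_on_inner_C1c[OF g(1) \<phi>']
            integrable_lebesgue_on_inner_C1c[OF G(1) \<phi>']])
      also have "\<dots> = 0"
        using bspec[OF g(2)[unfolded weak_gradient_def] \<phi>'] bspec[OF G(2)[unfolded weak_gradient_def] \<phi>']
        by linarith
      finally show ?thesis .
    qed
    from AE_completion[OF fundamental_lemma_borel[OF \<Omega> h(1) b this]]
    have "AE x in lebesgue_on \<Omega>. h x = 0" unfolding AE_restrict_space_iff[OF \<Omega>'] .
    with h(3) show ?thesis by eventually_elim simp
  qed
  then have "AE x in lebesgue_on \<Omega>. \<forall>b\<in>Basis. (g x - G x) \<bullet> b = 0" by (intro AE_finite_allI) simp_all
  then show ?thesis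
  proof eventually_elim
    case (elim x)
    then have "g x - G x = 0" by (rule euclidean_all_zero_iff[THEN iffD1])
    then show ?case by simp
  qed
qed

text \<open>\<open>W11_norm\<close> selects some weak gradient by \<open>SOME\<close>; uniqueness
  almost everywhere lets any explicitly known gradient, such as \<open>H\<close>, compute the
  norm.\<close>

lemma W11_norm_eq:
  fixes \<Omega> :: "'a::euclidean_space set"
  assumes \<Omega>: "open \<Omega>" "bounded \<Omega>" and G: "integrable (lebesgue_on \<Omega>) G" "weak_gradient \<Omega> u G"
  shows "W11_norm \<Omega> u = L1_norm \<Omega> u + L1_norm \<Omega> G"
proof -
  define g where "g = (SOME g. integrable (lebesgue_on \<Omega>) g \<and> weak_gradient \<Omega> u g)"
  have g: "integrable (lebesgue_on \<Omega>) g \<and> weak_gradient \<Omega> u g"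
    unfolding g_def by (rule someI[of _ G]) (use G in blast)
  have ae: "AE x in lebesgue_on \<Omega>. g x = G x"
    by (rule weak_gradient_unique[OF \<Omega> conjunct1[OF g] conjunct2[OF g] G])
  have "L1_norm \<Omega> g = L1_norm \<Omega> G"
    unfolding L1_norm_def
  proof (rule integral_cong_AE)
    show "AE x in lebesgue_on \<Omega>. norm (g x) = norm (G x)" using ae by eventually_elim simp
  qed (intro borel_measurable_integrable integrable_norm conjunct1[OF g] G(1))+
  then show ?thesis unfolding W11_norm_def g_def by simp
qed

section \<open>The two function spaces compared\<close>

lemma W11_imp_BV:
  fixes \<Omega> :: "'a::euclidean_space set"
  assumes u: "u \<in> W11 \<Omega>"
  shows "u \<in> BV \<Omega>" "BV_norm \<Omega> u \<le> W11_norm \<Omega> u"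
proof -
  \<comment> \<open>The very gradient selected in \<open>W11_norm\<close>, so that the norms compare
    with constant 1.\<close>
  define g where "g = (SOME g. integrable (lebesgue_on \<Omega>) g \<and> weak_gradient \<Omega> u g)"
  have iu: "integrable (lebesgue_on \<Omega>) u" using u by (simp add: W11_def)
  have "\<exists>g. integrable (lebesgue_on \<Omega>) g \<and> weak_gradient \<Omega> u g" using u by (simp add: W11_def)
  then have g: "integrable (lebesgue_on \<Omega>) g \<and> weak_gradient \<Omega> u g" unfolding g_def by (rule someI_ex)
  have le: "(\<integral>x. u x * divergence \<phi> x \<partial>lebesgue_on \<Omega>) \<le> L1_norm \<Omega> g"
    if \<phi>: "\<phi> \<in> C1c \<Omega>" and bd: "\<And>x. norm (\<phi> x) \<le> 1" for \<phi>
  proof -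
    note ig = integrable_lebesgue_on_inner_C1c[OF conjunct1[OF g] \<phi>]
    have "(\<integral>x. u x * divergence \<phi> x \<partial>lebesgue_on \<Omega>) = - (\<integral>x. g x \<bullet> \<phi> x \<partial>lebesgue_on \<Omega>)"
      using g \<phi> by (simp add: weak_gradient_def)
    also have "\<dots> = (\<integral>x. - (g x \<bullet> \<phi> x) \<partial>lebesgue_on \<Omega>)" by simp
    also have "\<dots> \<le> (\<integral>x. norm (g x) \<partial>lebesgue_on \<Omega>)"
    proof (rule integral_mono)
      show "integrable (lebesgue_on \<Omega>) (\<lambda>x. - (g x \<bullet> \<phi> x))" using ig by simp
      show "integrable (lebesgue_on \<Omega>) (\<lambda>x. norm (g x))" using g by simp
      fix x
      have "- (g x \<bullet> \<phi> x) \<le> \<bar>g x \<bullet> \<phi> x\<bar>" by simp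
      also have "\<dots> \<le> norm (g x) * norm (\<phi> x)" by (rule Cauchy_Schwarz_ineq2)
      also have "\<dots> \<le> norm (g x) * 1" using bd by (rule mult_left_mono) simp
      finally show "- (g x \<bullet> \<phi> x) \<le> norm (g x)" by simp
    qed
    finally show ?thesis unfolding L1_norm_def .
  qed
  show "u \<in> BV \<Omega>" by (rule BV_I(1)[OF iu le])
  show "BV_norm \<Omega> u \<le> W11_norm \<Omega> u"
    unfolding W11_norm_def g_def[symmetric] by (rule BV_I(2)[OF iu le])
qed

text \<open>Apply the decomposition with tolerance \<open>U\<close>, the L1 norm of
  \<open>u\<close>; \<open>pos\<close> makes it an admissible tolerance. Then v costs
  \<open>2 * U\<close> in L1 and \<open>V + U\<close> for its gradient, together at most
  \<open>3 * (U + V)\<close>, while \<open>W\<close> costs \<open>U\<close> plus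
  \<open>2 * V + U\<close>, which is \<open>2 * (U + V)\<close>.\<close>

lemma BV_eq_W11_plus_BV_UNIV:
  fixes \<Omega> :: "'a::euclidean_space set"
  assumes \<Omega>: "open \<Omega>" "bounded \<Omega>" and u: "u \<in> BV \<Omega>" and pos: "L1_norm \<Omega> u > 0"
  obtains v W where "v \<in> W11 \<Omega>" "W11_norm \<Omega> v \<le> 3 * BV_norm \<Omega> u"
    "W \<in> BV UNIV" "BV_norm UNIV W \<le> 2 * BV_norm \<Omega> u" "AE x in lebesgue_on \<Omega>. u x = v x + W x"
proof -
  have \<Omega>b: "\<Omega> \<in> sets borel" using \<Omega>(1) by simp
  have iu: "integrable (lebesgue_on \<Omega>) u" using u by (simp add: BV_def)
  define U where "U = L1_norm \<Omega> u"
  define V where "V = real_of_ereal (total_variation \<Omega> u)"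
  have V0: "V \<ge> 0" unfolding V_def by (intro real_of_ereal_pos total_variation_nonneg)
  have UV: "BV_norm \<Omega> u = U + V" by (simp add: BV_norm_def U_def V_def)
  have U: "U > 0" using pos by (simp add: U_def)
  obtain u0 where u0: "integrable lborel u0" "\<And>x. x \<notin> \<Omega> \<Longrightarrow> u0 x = 0" "AE x in lebesgue_on \<Omega>. u x = u0 x"
    by (rule borel_representative[OF \<Omega>b iu]) (rule that)
  have u0b: "u0 \<in> borel_measurable borel" using borel_measurable_integrable[OF u0(1)] by simp
  have var: "(\<integral>x. u0 x * divergence \<phi> x \<partial>lborel) \<le> V" if \<phi>: "\<phi> \<in> C1c \<Omega>" "\<And>x. norm (\<phi> x) \<le> 1" for \<phi>
  proof -
    have F: "C1_field \<phi>" using \<phi>(1) by (simp add: C1c_iff)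
    have "(\<integral>x. u0 x * divergence \<phi> x \<partial>lborel) = (\<integral>x. u0 x * divergence \<phi> x \<partial>lebesgue_on \<Omega>)"
      by (rule integral_lebesgue_on_test(1)[OF \<Omega>b \<phi>(1) u0b, symmetric])
    also have "\<dots> = (\<integral>x. u x * divergence \<phi> x \<partial>lebesgue_on \<Omega>)"
    proof (rule integral_cong_AE)
      have "(\<lambda>x. u0 x * divergence \<phi> x) \<in> borel_measurable borel"
        using u0b C1_field_borel(2)[OF F] by measurable
      then show "(\<lambda>x. u0 x * divergence \<phi> x) \<in> borel_measurable (lebesgue_on \<Omega>)"
        by (rule borel_measurable_lebesgue_on_borel)
      show "(\<lambda>x. u x * divergence \<phi> x) \<in> borel_measurable (lebesgue_on \<Omega>)"
        by (rule borel_measurable_integrable[OF integrable_lebesgue_on_mult_divergence[OF iu \<phi>(1)]])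
      show "AE x in lebesgue_on \<Omega>. u0 x * divergence \<phi> x = u x * divergence \<phi> x"
        using u0(3) by eventually_elim simp
    qed
    also have "\<dots> \<le> V" unfolding V_def by (rule BV_D[OF u \<phi>])
    finally show ?thesis .
  qed
  obtain W H where W: "integrable lborel W" and H: "integrable lborel H"
    and WU: "(\<integral>x. norm (W x) \<partial>lborel) \<le> U" and HU: "(\<integral>x. norm (H x) \<partial>lborel) \<le> V + U"
    and wg: "\<And>\<phi>. \<phi> \<in> C1c \<Omega> \<Longrightarrow> (\<integral>x. (u0 x - W x) * divergence \<phi> x \<partial>lborel) = - (\<integral>x. H x \<bullet> \<phi> x \<partial>lborel)"
    and Wv: "\<forall>\<phi>\<in>C1c UNIV. (\<forall>x. norm (\<phi> x) \<le> 1) \<longrightarrow> (\<integral>x. W x * divergence \<phi> x \<partial>lborel) \<le> 2 * V + U"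
    by (rule BV_smooth_decomposition[OF \<Omega> u0(1) _ var U]; (erule u0(2) | assumption | rule that))
  have Wb: "W \<in> borel_measurable borel" and Hb: "H \<in> borel_measurable borel"
    using borel_measurable_integrable[OF W] borel_measurable_integrable[OF H] by simp_all
  define v where "v x = u0 x - W x" for x
  have v: "integrable lborel v" unfolding v_def[abs_def] by (rule Bochner_Integration.integrable_diff[OF u0(1) W])
  have vb: "v \<in> borel_measurable borel" using borel_measurable_integrable[OF v] by simp
  note iv = integrable_lborel_imp_lebesgue_on(1)[OF \<Omega>b v]
  note iH = integrable_lborel_imp_lebesgue_on(1)[OF \<Omega>b H]
  note iW = integrable_lborel_imp_lebesgue_on(1)[OF \<Omega>b W]
  have grad: "weak_gradient \<Omega> v H"
    unfolding weak_gradient_def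
  proof
    fix \<phi> assume \<phi>: "\<phi> \<in> C1c \<Omega>"
    show "(\<integral>x. v x * divergence \<phi> x \<partial>lebesgue_on \<Omega>) = - (\<integral>x. H x \<bullet> \<phi> x \<partial>lebesgue_on \<Omega>)"
      unfolding integral_lebesgue_on_test(1)[OF \<Omega>b \<phi> vb] integral_lebesgue_on_test(2)[OF \<Omega>b \<phi> Hb]
      unfolding v_def by (rule wg[OF \<phi>])
  qed
  show ?thesis
  proof (rule that[of v W])
    show "v \<in> W11 \<Omega>" unfolding W11_def using iv iH grad by blast
    have "L1_norm \<Omega> v \<le> L1_norm \<Omega> u + L1_norm \<Omega> W"
    proof -
      have "L1_norm \<Omega> v = (\<integral>x. norm (u x - W x) \<partial>lebesgue_on \<Omega>)"
        unfolding L1_norm_def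
      proof (rule integral_cong_AE)
        show "AE x in lebesgue_on \<Omega>. norm (v x) = norm (u x - W x)"
          using u0(3) by eventually_elim (simp add: v_def)
      qed (intro borel_measurable_integrable integrable_norm Bochner_Integration.integrable_diff iv iu iW)+
      also have "\<dots> \<le> (\<integral>x. norm (u x) + norm (W x) \<partial>lebesgue_on \<Omega>)"
        by (rule integral_mono; (intro integrable_norm Bochner_Integration.integrable_diff
            Bochner_Integration.integrable_add iu iW norm_triangle_ineq4)?)
      also have "\<dots> = L1_norm \<Omega> u + L1_norm \<Omega> W"
        unfolding L1_norm_def by (rule Bochner_Integration.integral_add[OF integrable_norm[OF iu] integrable_norm[OF iW]])
      finally show ?thesis .
    qed
    moreover have "L1_norm \<Omega> W \<le> U" by (rule order_trans[OF integrable_lborel_imp_lebesgue_on(2)[OF \<Omega>b W] WU])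
    moreover have "L1_norm \<Omega> H \<le> V + U" by (rule order_trans[OF integrable_lborel_imp_lebesgue_on(2)[OF \<Omega>b H] HU])
    ultimately show "W11_norm \<Omega> v \<le> 3 * BV_norm \<Omega> u"
      unfolding W11_norm_eq[OF \<Omega> iH grad] UV using V0 by (simp add: U_def)
    have UNb: "UNIV \<in> sets borel" by simp
    note iWU = integrable_lborel_imp_lebesgue_on(1)[OF UNb W]
    have le: "(\<integral>x. W x * divergence \<phi> x \<partial>lebesgue_on UNIV) \<le> 2 * V + U"
      if \<phi>: "\<phi> \<in> C1c UNIV" "\<And>x. norm (\<phi> x) \<le> 1" for \<phi>
      unfolding integral_lebesgue_on_test(1)[OF UNb \<phi>(1) Wb] using Wv \<phi> by blast
    show "W \<in> BV UNIV" by (rule BV_I(1)[OF iWU le])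
    have "L1_norm UNIV W \<le> U" by (rule order_trans[OF integrable_lborel_imp_lebesgue_on(2)[OF UNb W] WU])
    then show "BV_norm UNIV W \<le> 2 * BV_norm \<Omega> u"
      using BV_I(2)[OF iWU le] unfolding UV by simp
    show "AE x in lebesgue_on \<Omega>. u x = v x + W x" using u0(3) by eventually_elim (simp add: v_def)
  qed
qed

theorem theorem1p1:
  fixes \<Omega> :: "'a::euclidean_space set"
  assumes "DIM('a) \<ge> 2"
    and "bounded_domain \<Omega>"
  shows "BV_BV_extension_domain \<Omega> \<longleftrightarrow> W11_BV_extension_domain \<Omega>"
proof
  have \<Omega>: "open \<Omega>" "bounded \<Omega>" using assms(2) by (simp_all add: bounded_domain_def)
  show "W11_BV_extension_domain \<Omega>" if bv: "BV_BV_extension_domain \<Omega>"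
  proof -
    obtain E C where C: "C > 1" and E: "\<And>u. u \<in> BV \<Omega> \<Longrightarrow> E u \<in> BV (UNIV::'a set) \<and>
        (AE x in lebesgue_on \<Omega>. E u x = u x) \<and> BV_norm UNIV (E u) \<le> C * BV_norm \<Omega> u"
      using bv unfolding BV_BV_extension_domain_def by blast
    have "E u \<in> BV (UNIV::'a set) \<and> (AE x in lebesgue_on \<Omega>. E u x = u x) \<and>
        BV_norm UNIV (E u) \<le> C * W11_norm \<Omega> u" if u: "u \<in> W11 \<Omega>" for u
    proof -
      have "C * BV_norm \<Omega> u \<le> C * W11_norm \<Omega> u" using W11_imp_BV(2)[OF u] C by simp
      with E[OF W11_imp_BV(1)[OF u]] show ?thesis by (blast intro: order_trans)
    qed
    then show ?thesis unfolding W11_BV_extension_domain_def using \<Omega>(2) C by blast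
  qed
  show "BV_BV_extension_domain \<Omega>" if w11: "W11_BV_extension_domain \<Omega>"
  proof -
    obtain E C where C: "C > 1" and E: "\<And>u. u \<in> W11 \<Omega> \<Longrightarrow> E u \<in> BV (UNIV::'a set) \<and>
        (AE x in lebesgue_on \<Omega>. E u x = u x) \<and> BV_norm UNIV (E u) \<le> C * W11_norm \<Omega> u"
      using w11 unfolding W11_BV_extension_domain_def by blast
    \<comment> \<open>The constant is \<open>C * 3\<close> for the extension of v plus
      \<open>2\<close> for \<open>W\<close>.\<close>
    have "\<exists>w. w \<in> BV (UNIV::'a set) \<and> (AE x in lebesgue_on \<Omega>. w x = u x) \<and>
        BV_norm UNIV w \<le> (3 * C + 2) * BV_norm \<Omega> u" if u: "u \<in> BV \<Omega>" for u
    proof (cases "L1_norm \<Omega> u > 0")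
      case True
      obtain v W where v: "v \<in> W11 \<Omega>" "W11_norm \<Omega> v \<le> 3 * BV_norm \<Omega> u"
        and W: "W \<in> BV UNIV" "BV_norm UNIV W \<le> 2 * BV_norm \<Omega> u"
        and ae: "AE x in lebesgue_on \<Omega>. u x = v x + W x"
        by (rule BV_eq_W11_plus_BV_UNIV[OF \<Omega> u True]) (rule that)
      have Ev: "E v \<in> BV UNIV" "AE x in lebesgue_on \<Omega>. E v x = v x" "BV_norm UNIV (E v) \<le> C * W11_norm \<Omega> v"
        using E[OF v(1)] by simp_all
      have "BV_norm UNIV (\<lambda>x. E v x + W x) \<le> BV_norm UNIV (E v) + BV_norm UNIV W"
        by (rule BV_add(2)[OF Ev(1) W(1)])
      also have "\<dots> \<le> C * (3 * BV_norm \<Omega> u) + 2 * BV_norm \<Omega> u"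
        using C by (intro add_mono order_trans[OF Ev(3)] mult_left_mono v(2) W(2)) simp
      also have "\<dots> = (3 * C + 2) * BV_norm \<Omega> u" by (simp add: algebra_simps)
      finally have "BV_norm UNIV (\<lambda>x. E v x + W x) \<le> (3 * C + 2) * BV_norm \<Omega> u" .
      moreover have "AE x in lebesgue_on \<Omega>. E v x + W x = u x"
        using ae Ev(2) by eventually_elim simp
      ultimately show ?thesis using BV_add(1)[OF Ev(1) W(1)] by (intro exI[of _ "\<lambda>x. E v x + W x"] conjI)
    next
      \<comment> \<open>The tolerance of the decomposition is the L1 norm of \<open>u\<close>. If
        that norm is zero, \<open>u\<close> vanishes almost everywhere and the zero function extends
        it.\<close>
      case False
      have iu: "integrable (lebesgue_on \<Omega>) u" using u by (simp add: BV_def)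
      have "L1_norm \<Omega> u = 0" using False L1_norm_nonneg[of \<Omega> u] by linarith
      then have "AE x in lebesgue_on \<Omega>. norm (u x) = 0"
        unfolding L1_norm_def using integral_nonneg_eq_0_iff_AE[OF integrable_norm[OF iu]] by simp
      then have ae: "AE x in lebesgue_on \<Omega>. (0::real) = u x" by eventually_elim simp
      have i0: "integrable (lebesgue_on UNIV) (\<lambda>x::'a. 0::real)" by simp
      have le: "(\<integral>x. 0 * divergence \<phi> x \<partial>lebesgue_on UNIV) \<le> 0" for \<phi> :: "'a \<Rightarrow> 'a" by simp
      have "BV_norm UNIV (\<lambda>x::'a. 0) \<le> L1_norm UNIV (\<lambda>x::'a. 0::real) + 0"
        by (rule BV_I(2)[OF i0 le])
      also have "\<dots> = 0" by (simp add: L1_norm_def)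
      also have "\<dots> \<le> (3 * C + 2) * BV_norm \<Omega> u" using C BV_norm_nonneg[of \<Omega> u] by simp
      finally show ?thesis using BV_I(1)[OF i0 le] ae by (intro exI[of _ "\<lambda>x. 0"] conjI)
    qed
    \<comment> \<open>An extension operator is a plain map, so a witness may be chosen separately
      for each \<open>u\<close>; the decomposition, whose tolerance and radii depend on
      \<open>u\<close>, would not supply a linear choice by itself.\<close>
    then obtain E' where "\<And>u. u \<in> BV \<Omega> \<Longrightarrow> E' u \<in> BV (UNIV::'a set) \<and>
        (AE x in lebesgue_on \<Omega>. E' u x = u x) \<and> BV_norm UNIV (E' u) \<le> (3 * C + 2) * BV_norm \<Omega> u"
      by metis
    moreover have "3 * C + 2 > 1" using C by simp
    ultimately show ?thesis unfolding BV_BV_extension_domain_def using \<Omega>(2) by blast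
  qed
qed

end
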